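(* Let $G = (D; +_G, -_G)$ be a finite group and let $\Gamma$ be a constraint language such that for each $R \in \Gamma$ there is an integer $k$ such that $R$ is a coset of some subgroup of $G^k$. Then W-Max Sol$(\Gamma)$ is in APX.
   Context: $D\subset\mathbb{N}$ is finite and $G^k$ is the direct product of $k$ copies of $G$. W-Max Sol$(\Gamma)$: instances $(V,D,C,w)$ with constraints from $\Gamma$, $w:V\to\mathbb{N}$; maximise $\sum_v w(v)f(v)$ over satisfying assignments $f:V\to D$. *)

theory Defs
  imports
    Complex_Main
    "HOL-Library.List_Lexorder"
    "HOL-Computational_Algebra.Polynomial"
    "HOL-Algebra.Product_Groups"
begin

section \<open>Polynomial time\<close>

text \<open>
  The machine model is a multi-stack machine over the alphabet bool, with structured control. A
  program uses finitely many registers, each of which holds a stack of bits (top = head of the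
  list). Every executed instruction and every evaluated test costs one time unit and only touches
  the top of one stack, so it is one step of a multitape Turing machine that keeps each register
  on its own tape. Conversely, two stacks simulate one Turing machine tape, and the program
  counter is simulated by nested tests inside a single loop. Running times therefore agree with
  those of multitape Turing machines up to a constant factor.
\<close>

datatype test =
    NonEmpty nat
  | TopTrue nat

datatype prog =
    Skip
  | Push nat bool
  | Pop nat
  | Seq prog prog
  | Cond test prog prog
  | While test prog

type_synonym state = "nat \<Rightarrow> bool list"

fun holds :: "test \<Rightarrow> state \<Rightarrow> bool" where
  "holds (NonEmpty r) s \<longleftrightarrow> s r \<noteq> []"
| "holds (TopTrue r) s \<longleftrightarrow> s r \<noteq> [] \<and> hd (s r)"

text \<open>\<open>exec c s t s'\<close>: started in \<open>s\<close>, the program \<open>c\<close> halts in \<open>s'\<close> after \<open>t\<close> time units.\<close>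

inductive exec :: "prog \<Rightarrow> state \<Rightarrow> nat \<Rightarrow> state \<Rightarrow> bool" where
  Skip: "exec Skip s 1 s"
| Push: "exec (Push r b) s 1 (s(r := b # s r))"
| Pop: "exec (Pop r) s 1 (s(r := tl (s r)))"
| Seq: "exec c1 s t1 s1 \<Longrightarrow> exec c2 s1 t2 s2 \<Longrightarrow> exec (Seq c1 c2) s (t1 + t2) s2"
| CondTrue: "holds b s \<Longrightarrow> exec c1 s t s' \<Longrightarrow> exec (Cond b c1 c2) s (t + 1) s'"
| CondFalse: "\<not> holds b s \<Longrightarrow> exec c2 s t s' \<Longrightarrow> exec (Cond b c1 c2) s (t + 1) s'"
| WhileFalse: "\<not> holds b s \<Longrightarrow> exec (While b c) s 1 s"
| WhileTrue: "holds b s \<Longrightarrow> exec c s t1 s1 \<Longrightarrow> exec (While b c) s1 t2 s2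
    \<Longrightarrow> exec (While b c) s (t1 + t2 + 1) s2"

definition init_state :: "bool list list \<Rightarrow> state" where
  "init_state xs = (\<lambda>r. if r < length xs then xs ! r else [])"

text \<open>
  One program computes the (possibly multi-argument) function \<open>f\<close> on every input in \<open>S\<close>, leaving
  the result in register 0, in time polynomial in the total input length.
\<close>

definition polytime_on :: "bool list list set \<Rightarrow> (bool list list \<Rightarrow> bool list) \<Rightarrow> bool" where
  "polytime_on S f \<longleftrightarrow> (\<exists>c. \<exists>p :: nat poly. \<forall>xs\<in>S. \<exists>t s.
     exec c (init_state xs) t s \<and> s 0 = f xs \<and> t \<le> poly p (sum_list (map length xs)))"

definition polytime_decidable :: "nat \<Rightarrow> bool list list set \<Rightarrow> bool" where
  "polytime_decidable k L \<longleftrightarrow> polytime_on {xs. length xs = k} (\<lambda>xs. [xs \<in> L])"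


section \<open>Encodings as bit strings\<close>

text \<open>Binary representation, least significant bit first, without leading zeros.\<close>

fun nat_bits :: "nat \<Rightarrow> bool list" where
  "nat_bits n = (if n = 0 then [] else odd n # nat_bits (n div 2))"

declare nat_bits.simps [simp del]

text \<open>The markers before each element and at the end make the code self-delimiting.\<close>

definition enc_list :: "('a \<Rightarrow> bool list) \<Rightarrow> 'a list \<Rightarrow> bool list" where
  "enc_list e xs = concat (map (\<lambda>x. True # e x) xs) @ [False]"

definition enc_nat :: "nat \<Rightarrow> bool list" where
  "enc_nat n = enc_list (\<lambda>b. [b]) (nat_bits n)"


section \<open>Maximisation problems, NPO and APX\<close>

text \<open>
  A maximisation problem over mathematical instances and solutions, together with the bit-string
  encodings with respect to which complexity is measured. The encoding of a solution may refer to
  the instance (e.g. an assignment is written down as the list of its values).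
\<close>

record ('i, 's) max_problem =
  instances :: "'i set"
  sols :: "'i \<Rightarrow> 's set"
  objective :: "'i \<Rightarrow> 's \<Rightarrow> nat"
  enc_inst :: "'i \<Rightarrow> bool list"
  enc_sol :: "'i \<Rightarrow> 's \<Rightarrow> bool list"

definition opt :: "('i, 's) max_problem \<Rightarrow> 'i \<Rightarrow> nat" where
  "opt P i = Max (objective P i ` sols P i)"

text \<open>
  NPO: instances are recognisable in polynomial time, feasible solutions are polynomially bounded
  and recognisable in polynomial time, and the measure (output in binary) is computable in
  polynomial time.
\<close>

definition in_NPO :: "('i, 's) max_problem \<Rightarrow> bool" where
  "in_NPO P \<longleftrightarrow>
     inj_on (enc_inst P) (instances P) \<and>
     (\<forall>i\<in>instances P. inj_on (enc_sol P i) (sols P i)) \<and>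
     polytime_decidable 1 {[enc_inst P i] |i. i \<in> instances P} \<and>
     (\<exists>q :: nat poly. \<forall>i\<in>instances P. \<forall>f\<in>sols P i.
        length (enc_sol P i f) \<le> poly q (length (enc_inst P i))) \<and>
     polytime_decidable 2 {[enc_inst P i, enc_sol P i f] |i f. i \<in> instances P \<and> f \<in> sols P i} \<and>
     (\<exists>g. polytime_on {[enc_inst P i, enc_sol P i f] |i f. i \<in> instances P \<and> f \<in> sols P i} g \<and>
        (\<forall>i\<in>instances P. \<forall>f\<in>sols P i.
           g [enc_inst P i, enc_sol P i f] = nat_bits (objective P i f)))"

text \<open>
  For a maximisation problem the performance ratio is \<open>opt / measure\<close>; writing the bound
  multiplicatively means that if the optimum is 0, every feasible solution is optimal.
\<close>

definition approx_sol :: "('i, 's) max_problem \<Rightarrow> real \<Rightarrow> 'i \<Rightarrow> 's \<Rightarrow> bool" where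
  "approx_sol P r i f \<longleftrightarrow> f \<in> sols P i \<and> real (opt P i) \<le> r * real (objective P i f)"

text \<open>
  The algorithm has to halt in polynomial time on every instance; its output is unconstrained on
  instances without feasible solutions.
\<close>

definition in_APX :: "('i, 's) max_problem \<Rightarrow> bool" where
  "in_APX P \<longleftrightarrow> in_NPO P \<and>
     (\<exists>r\<ge>1. \<exists>A. polytime_on {[enc_inst P i] |i. i \<in> instances P} A \<and>
        (\<forall>i\<in>instances P. sols P i \<noteq> {} \<longrightarrow>
           (\<exists>f. approx_sol P r i f \<and> A [enc_inst P i] = enc_sol P i f)))"


section \<open>The problem W-Max Sol\<close>

text \<open>A finite set of finitary relations over \<open>D\<close>; tuples are lists.\<close>

definition constraint_language :: "nat set \<Rightarrow> nat list set set \<Rightarrow> bool" where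
  "constraint_language D \<Gamma> \<longleftrightarrow>
     finite D \<and> finite \<Gamma> \<and> (\<forall>R\<in>\<Gamma>. \<exists>k. \<forall>t\<in>R. length t = k \<and> set t \<subseteq> D)"

text \<open>
  Variables are named by arbitrary natural numbers. A constraint is a pair of a scope (a list of
  variables, repetitions allowed) and a relation.
\<close>

record wms_inst =
  Vars :: "nat set"
  Dom :: "nat set"
  Constraints :: "(nat list \<times> nat list set) list"
  Weight :: "nat \<Rightarrow> nat"

definition wms_instances :: "nat set \<Rightarrow> nat list set set \<Rightarrow> wms_inst set" where
  "wms_instances D \<Gamma> = {I. finite (Vars I) \<and> Dom I = D \<and>
     (\<forall>(s, R)\<in>set (Constraints I). R \<in> \<Gamma> \<and> set s \<subseteq> Vars I \<and> (\<forall>t\<in>R. length t = length s)) \<and>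
     Weight I \<in> Vars I \<rightarrow>\<^sub>E UNIV}"

definition wms_solutions :: "wms_inst \<Rightarrow> (nat \<Rightarrow> nat) set" where
  "wms_solutions I = {f \<in> Vars I \<rightarrow>\<^sub>E Dom I. \<forall>(s, R)\<in>set (Constraints I). map f s \<in> R}"

definition wms_measure :: "wms_inst \<Rightarrow> (nat \<Rightarrow> nat) \<Rightarrow> nat" where
  "wms_measure I f = (\<Sum>v\<in>Vars I. Weight I v * f v)"

text \<open>
  Sets are written down in increasing order (lexicographic order for sets of tuples), relations by
  listing all their tuples, and weights and variable names in binary.
\<close>

definition enc_wms_inst :: "wms_inst \<Rightarrow> bool list" where
  "enc_wms_inst I =
     enc_list (\<lambda>v. enc_nat v @ enc_nat (Weight I v)) (sorted_list_of_set (Vars I)) @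
     enc_list enc_nat (sorted_list_of_set (Dom I)) @
     enc_list (\<lambda>(s, R). enc_list enc_nat s @ enc_list (enc_list enc_nat) (sorted_list_of_set R))
       (Constraints I)"

definition enc_wms_sol :: "wms_inst \<Rightarrow> (nat \<Rightarrow> nat) \<Rightarrow> bool list" where
  "enc_wms_sol I f = enc_list enc_nat (map f (sorted_list_of_set (Vars I)))"

definition W_Max_Sol ::
  "nat set \<Rightarrow> nat list set set \<Rightarrow> (wms_inst, nat \<Rightarrow> nat) max_problem" where
  "W_Max_Sol D \<Gamma> = \<lparr>
     instances = wms_instances D \<Gamma>,
     sols = wms_solutions,
     objective = wms_measure,
     enc_inst = enc_wms_inst,
     enc_sol = enc_wms_sol\<rparr>"


section \<open>Cosets of subgroups of direct powers\<close>

abbreviation group_power :: "('a, 'b) monoid_scheme \<Rightarrow> nat \<Rightarrow> (nat \<Rightarrow> 'a) monoid" where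
  "group_power G k \<equiv> product_group {..<k} (\<lambda>_. G)"

text \<open>The elements of \<open>group_power G k\<close> are functions on \<open>{..<k}\<close>, those of a relation are lists.\<close>

definition tuple_fun :: "'a list \<Rightarrow> nat \<Rightarrow> 'a" where
  "tuple_fun t = restrict (\<lambda>i. t ! i) {..<length t}"

text \<open>
  Right cosets are no restriction: the left coset \<open>a H\<close> is the right coset of \<open>a\<close> with respect to
  the subgroup \<open>a H a\<inverse>\<close>.
\<close>

definition coset_relation :: "('a, 'b) monoid_scheme \<Rightarrow> nat \<Rightarrow> 'a list set \<Rightarrow> bool" where
  "coset_relation G k R \<longleftrightarrow> (\<forall>t\<in>R. length t = k) \<and>
     (\<exists>H. subgroup H (group_power G k) \<and> tuple_fun ` R \<in> rcosets\<^bsub>group_power G k\<^esub> H)"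

end

theory Submission
  imports Defs
begin

text \<open>
  The solutions of an instance form a coset \<open>H a\<close> of a subgroup \<open>H\<close> of a power of \<open>G\<close>. Such a coset is
  described by a base point and a strong generating set of \<open>H\<close>, which has polynomial size. Imposing one
  more constraint only requires the elements of \<open>H\<close> up to their values on the scope; as the arity is
  bounded there are boundedly many of these, and they are obtained level by level from the generators.
  Under a uniformly random solution every variable is uniformly distributed on a coset of a subgroup
  of \<open>G\<close>, so the expected measure is at least \<open>1/|G|\<close> of the optimum; the method of conditional
  expectations along the levels of the generating set finds a solution that is at least as good.

  For polynomial time, data are coded as self-delimiting preorder codes of binary trees on top of one
  stack, so that programs compose like functions; these functions are closed under iteration as long as
  the intermediate results stay polynomially small. Malformed instances are recognised by parsing
  and comparing the re-encoding with the input.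
\<close>

text \<open>The obstacle is that the group behind a solution set may be exponentially large, while
  only short lists of its elements can be kept. Projection to a scope is a homomorphism, so in a
  product \<open>t k\<close> the factor \<open>k\<close> may be exchanged for any element with the
  same values there. One representative per value pattern therefore suffices, and a level keeps a
  constant number of vectors however many constraints have been imposed. The elements
  \<open>h\<close> for which \<open>h a\<close> satisfies a further constraint form a subgroup only
  if \<open>a\<close> itself satisfies it; so each constraint costs one pass to move the base point
  and a second one to cut down the group.

  The ratio |G| arises at each variable separately: a value is at most the sum of the distinct
  values in its coset, and |G| times their mean is a multiple of that sum. Linearity of expectation
  combines the variables without any independence. Estimates are scaled by |G| because Lagrange's
  theorem then makes them natural numbers, so that conditional expectations are compared in integer
  arithmetic.\<close>

section \<open>Codes of trees and timed runs\<close>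

datatype tree = Leaf | Node tree tree

fun code :: "tree \<Rightarrow> bool list" where
  "code Leaf = [False]"
| "code (Node a b) = True # code a @ code b"

text \<open>Coefficients in \<open>nat\<close> are nonnegative. Bounds can therefore be enlarged
  inside a polynomial, which is what makes them compose.\<close>

lemma poly_nat_mono: "m \<le> n \<Longrightarrow> poly p m \<le> poly p n" for p :: "nat poly"
  by (induction p) (auto intro!: add_mono mult_mono)

text \<open>An upper bound replaces the exact time, so that branches of different cost can share one
  bound.\<close>

definition runs :: "prog \<Rightarrow> state \<Rightarrow> nat \<Rightarrow> state \<Rightarrow> bool" where
  "runs c s b s' \<longleftrightarrow> (\<exists>t\<le>b. exec c s t s')"

lemma runs_mono: "runs c s b s' \<Longrightarrow> b \<le> b' \<Longrightarrow> runs c s b' s'"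
  unfolding runs_def using le_trans by blast

lemma runs_Skip: "runs Skip s 1 s"
  unfolding runs_def using exec.Skip by blast

lemma runs_Push: "runs (Push r b) s 1 (s(r := b # s r))"
  unfolding runs_def using exec.Push by blast

lemma runs_Pop: "runs (Pop r) s 1 (s(r := tl (s r)))"
  unfolding runs_def using exec.Pop by blast

lemma runs_Seq: "runs c1 s b1 s1 \<Longrightarrow> runs c2 s1 b2 s2 \<Longrightarrow> runs (Seq c1 c2) s (b1 + b2) s2"
  unfolding runs_def by (meson add_mono exec.Seq)

lemma runs_CondT: "holds t s \<Longrightarrow> runs c1 s b s' \<Longrightarrow> runs (Cond t c1 c2) s (b + 1) s'"
  unfolding runs_def by (meson add_le_mono1 exec.CondTrue)

lemma runs_CondF: "\<not> holds t s \<Longrightarrow> runs c2 s b s' \<Longrightarrow> runs (Cond t c1 c2) s (b + 1) s'"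
  unfolding runs_def by (meson add_le_mono1 exec.CondFalse)

lemma runs_WhileF: "\<not> holds t s \<Longrightarrow> runs (While t c) s 1 s"
  unfolding runs_def using exec.WhileFalse by blast

lemma runs_WhileT:
  "holds t s \<Longrightarrow> runs c s b1 s1 \<Longrightarrow> runs (While t c) s1 b2 s2 \<Longrightarrow> runs (While t c) s (b1 + b2 + 1) s2"
  unfolding runs_def by (meson add_le_mono1 add_mono exec.WhileTrue)

text \<open>An instruction pushes at most one bit. Time bounds thus yield size bounds, the source of
  \<open>PT_size\<close>.\<close>

lemma runs_length: "runs c s b s' \<Longrightarrow> length (s' r) \<le> length (s r) + b"
proof -
  have "exec c s t s' \<Longrightarrow> length (s' r) \<le> length (s r) + t" for t
    by (induction rule: exec.induct) auto
  then show "runs c s b s' \<Longrightarrow> length (s' r) \<le> length (s r) + b"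
    unfolding runs_def by fastforce
qed

fun seqs :: "prog list \<Rightarrow> prog" where
  "seqs [] = Skip"
| "seqs (c # cs) = Seq c (seqs cs)"

lemma runs_Nil: "runs (seqs []) s 1 s"
  using runs_Skip by simp

lemma runs_Cons: "runs c s b1 s1 \<Longrightarrow> runs (seqs cs) s1 b2 s2 \<Longrightarrow> runs (seqs (c # cs)) s (b1 + b2) s2"
  by (simp add: runs_Seq)

lemma runs_eq: "runs c s b s1 \<Longrightarrow> s1 = s2 \<Longrightarrow> b \<le> b' \<Longrightarrow> runs c s b' s2"
  using runs_mono by blast

section \<open>Moving trees between stacks\<close>

text \<open>While a tree is read, stack 3 counts the subtrees that are still to come; the bits go to
  stack 2, each below a mark \<open>True\<close>, so that the end of the tree is found on the way back.\<close>

fun mark :: "bool list \<Rightarrow> bool list \<Rightarrow> bool list" where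
  "mark [] st = st"
| "mark (b # bs) st = mark bs (True # b # st)"

lemma mark_append: "mark (as @ bs) st = mark bs (mark as st)"
  by (induction as st rule: mark.induct) auto

definition scan_body :: "nat \<Rightarrow> prog" where
  "scan_body i = Cond (TopTrue i)
     (seqs [Pop i, Push 2 True, Push 2 True, Push 3 True])
     (seqs [Pop i, Push 2 False, Push 2 True, Pop 3])"

text \<open>The loop does not stop after a subtree, so the claim has the form of a continuation: a
  run from the state behind the tree is extended to a run from the state before it.\<close>

lemma runs_scan_loop:
  assumes "i < 2" "s i = code x @ rest" "s 3 = True # cnt"
    "runs (While (TopTrue 3) (scan_body i)) (s(i := rest, 3 := cnt, 2 := mark (code x) (s 2))) b s'"
  shows "runs (While (TopTrue 3) (scan_body i)) s (b + 7 * length (code x)) s'"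
  using assms(2-)
proof (induction x arbitrary: s rest cnt b)
  case Leaf
  have 1: "runs (scan_body i) s 6 (s(i := rest, 2 := True # False # s 2, 3 := cnt))"
    unfolding scan_body_def using Leaf \<open>i < 2\<close>
    by - (rule runs_eq, rule runs_CondF, simp, (rule runs_Cons runs_Nil runs_Push runs_Pop)+,
       auto simp: fun_eq_iff)
  have "s(i := rest, 2 := True # False # s 2, 3 := cnt) = s(i := rest, 3 := cnt, 2 := mark (code Leaf) (s 2))"
    by (auto simp: fun_eq_iff)
  then have "runs (While (TopTrue 3) (scan_body i)) (s(i := rest, 2 := True # False # s 2, 3 := cnt)) b s'"
    using Leaf(3) by (simp only:)
  from runs_WhileT[OF _ 1 this] show ?case
    by (rule runs_mono) (use Leaf in auto)
next
  case (Node x y)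
  have 1: "runs (scan_body i) s 6 (s(i := tl (s i), 2 := True # True # s 2, 3 := True # s 3))"
    unfolding scan_body_def using Node.prems \<open>i < 2\<close>
    by - (rule runs_eq, rule runs_CondT, simp, (rule runs_Cons runs_Nil runs_Push runs_Pop)+,
       auto simp: fun_eq_iff)
  let ?s = "s(i := tl (s i), 2 := True # True # s 2, 3 := True # s 3)"
  let ?s2 = "?s(i := code y @ rest, 3 := s 3, 2 := mark (code x) (?s 2))"
  have "?s2(i := rest, 3 := cnt, 2 := mark (code y) (?s2 2)) =
      s(i := rest, 3 := cnt, 2 := mark (code (Node x y)) (s 2))"
    by (auto simp: fun_eq_iff mark_append)
  then have "runs (While (TopTrue 3) (scan_body i)) (?s2(i := rest, 3 := cnt, 2 := mark (code y) (?s2 2))) b s'"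
    using Node.prems(3) by (simp only:)
  \<comment> \<open>The right subtree is treated first, since its run is the continuation required
    for the left one.\<close>
  then have 2: "runs (While (TopTrue 3) (scan_body i)) ?s2 (b + 7 * length (code y)) s'"
    by (rule Node.IH(2)[rotated 2]) (use Node.prems \<open>i < 2\<close> in auto)
  have "runs (While (TopTrue 3) (scan_body i)) ?s (b + 7 * length (code y) + 7 * length (code x)) s'"
    by (rule Node.IH(1)[OF _ _ 2]) (use Node.prems \<open>i < 2\<close> in auto)
  from runs_WhileT[OF _ 1 this] show ?case
    by (rule runs_mono) (use Node.prems in auto)
qed

fun push_all :: "nat list \<Rightarrow> bool \<Rightarrow> prog" where
  "push_all [] b = Skip"
| "push_all (d # ds) b = Seq (Push d b) (push_all ds b)"

lemma runs_push_all:
  "distinct ds \<Longrightarrow> runs (push_all ds b) s (length ds + 1) (\<lambda>r. if r \<in> set ds then b # s r else s r)"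
proof (induction ds arbitrary: s)
  case Nil
  then show ?case using runs_Skip by simp
next
  case (Cons d ds)
  then have "runs (push_all ds b) (s(d := b # s d)) (length ds + 1)
    (\<lambda>r. if r \<in> set ds then b # (s(d := b # s d)) r else (s(d := b # s d)) r)"
    by simp
  from runs_Seq[OF runs_Push[of d b s] this] show ?case
    using Cons.prems by (auto elim!: runs_eq simp: fun_eq_iff)
qed

definition unmark_body :: "nat list \<Rightarrow> prog" where
  "unmark_body ds = Seq (Pop 2) (Cond (TopTrue 2)
     (Seq (Pop 2) (push_all ds True)) (Seq (Pop 2) (push_all ds False)))"

text \<open>The bits return last one first, hence the induction from the end of the list. The
  unmarked \<open>False\<close> is the sentinel that keeps the loop away from the older contents of
  stack 2.\<close>

lemma runs_unmark_loop:
  assumes "distinct ds" "2 \<notin> set ds" "s 2 = mark bs (False # st)"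
  shows "runs (While (TopTrue 2) (unmark_body ds)) s ((length ds + 5) * length bs + 1)
    (\<lambda>r. if r = 2 then False # st else if r \<in> set ds then bs @ s r else s r)"
  using assms(3)
proof (induction bs arbitrary: s rule: rev_induct)
  case Nil
  have "(\<lambda>r. if r = 2 then False # st else if r \<in> set ds then [] @ s r else s r) = s"
    using Nil by (auto simp: fun_eq_iff)
  then show ?case using runs_WhileF[of "TopTrue 2" s] Nil by auto
next
  case (snoc b bs)
  have s2: "s 2 = True # b # mark bs (False # st)"
    using snoc.prems by (simp add: mark_append)
  define s1 where "s1 = s(2 := mark bs (False # st))"
  define s2 where "s2 = (\<lambda>r. if r \<in> set ds then b # s1 r else s1 r)"
  have 1: "runs (unmark_body ds) s (1 + (1 + (length ds + 1) + 1)) s2"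
    unfolding unmark_body_def
    apply (rule runs_Seq[OF runs_Pop])
    apply (cases b)
     apply (rule runs_CondT)
      apply (simp add: s2)
     apply (rule runs_eq[OF runs_Seq[OF runs_Pop runs_push_all]])
       apply (use assms s2 in \<open>auto simp: s1_def s2_def fun_eq_iff\<close>)
    apply (rule runs_CondF[where b = "1 + (length ds + 1)", simplified])
     apply (simp add: s2)
    apply (rule runs_eq[OF runs_Seq[OF runs_Pop runs_push_all]])
      apply (use assms s2 in \<open>auto simp: s1_def s2_def fun_eq_iff\<close>)
    done
  have "s2 2 = mark bs (False # st)" using assms by (simp add: s1_def s2_def)
  then have 2: "runs (While (TopTrue 2) (unmark_body ds)) s2 ((length ds + 5) * length bs + 1)
    (\<lambda>r. if r = 2 then False # st else if r \<in> set ds then bs @ s2 r else s2 r)"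
    by (rule snoc.IH)
  show ?case
    by (rule runs_eq[OF runs_WhileT[OF _ 1 2]])
       (use s2 assms in \<open>auto simp: s1_def s2_def fun_eq_iff\<close>)
qed

text \<open>One program for three purposes: with \<open>ds = []\<close> it deletes the tree, with
  one target it moves it, with \<open>[0, 1]\<close> it duplicates it. Stacks 2 and 3 are used as
  scratch space above sentinels and are restored.\<close>

definition transfer :: "nat \<Rightarrow> nat list \<Rightarrow> prog" where
  "transfer i ds = Seq (seqs [Push 2 False, Push 3 False, Push 3 True])
     (Seq (While (TopTrue 3) (scan_body i)) (Seq (Pop 3)
     (Seq (While (TopTrue 2) (unmark_body ds)) (Pop 2))))"

lemma runs_transfer:
  assumes "i < 2" "distinct ds" "set ds \<subseteq> {0, 1}" "s i = code x @ rest"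
  shows "runs (transfer i ds) s (20 * length (code x) + 20)
    (\<lambda>r. (if r \<in> set ds then code x else []) @ (s(i := rest)) r)"
proof -
  have len: "length ds \<le> 2"
    using card_mono[OF _ assms(3)] distinct_card[OF assms(2)] by simp
  define s1 where "s1 = s(2 := False # s 2, 3 := True # False # s 3)"
  define s2 where "s2 = s1(i := rest, 3 := False # s 3, 2 := mark (code x) (False # s 2))"
  define s3 where "s3 = s2(3 := s 3)"
  define s4 where "s4 = (\<lambda>r. if r = 2 then False # s 2 else if r \<in> set ds then code x @ s3 r else s3 r)"
  have a: "runs (seqs [Push 2 False, Push 3 False, Push 3 True]) s 4 s1"
    by (rule runs_eq, (rule runs_Cons runs_Nil runs_Push runs_Pop)+) (auto simp: s1_def fun_eq_iff)
  have b: "runs (While (TopTrue 3) (scan_body i)) s1 (1 + 7 * length (code x)) s2"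
    by (rule runs_scan_loop[where rest = rest and cnt = "False # s 3"])
       (use assms in \<open>auto intro!: runs_WhileF[unfolded One_nat_def] simp: s1_def s2_def\<close>)
  have c: "runs (Pop 3) s2 1 s3"
    by (rule runs_eq[OF runs_Pop]) (auto simp: s2_def s3_def)
  have d: "runs (While (TopTrue 2) (unmark_body ds)) s3 ((length ds + 5) * length (code x) + 1) s4"
    unfolding s4_def using assms by (intro runs_unmark_loop) (auto simp: s3_def s2_def)
  have e: "runs (Pop 2) s4 1 (\<lambda>r. (if r \<in> set ds then code x else []) @ (s(i := rest)) r)"
    by (rule runs_eq[OF runs_Pop]) (use assms in \<open>auto simp: s4_def s3_def s2_def s1_def fun_eq_iff\<close>)
  \<comment> \<open>Reading costs seven units per bit and writing at most seven; 20 is a round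
    number above the total.\<close>
  have bd: "(length ds + 5) * length (code x) \<le> 7 * length (code x)"
    using len by (intro mult_right_mono) auto
  show ?thesis
    unfolding transfer_def
    by (rule runs_eq, (rule runs_Seq a b c d e)+, rule refl, use bd in linarith)
qed
section \<open>Polynomial-time functions between coded types\<close>

class codable = fixes tr :: "'a \<Rightarrow> tree"

definition sz :: "'a::codable \<Rightarrow> nat" where "sz x = length (code (tr x))"

text \<open>Everything below the argument on stack 0 and all other stacks are preserved, so programs
  compose without any side conditions on registers.\<close>

definition computes :: "prog \<Rightarrow> nat poly \<Rightarrow> ('a::codable \<Rightarrow> 'b::codable) \<Rightarrow> bool" where
  "computes c p f \<longleftrightarrow> (\<forall>x s rest. s 0 = code (tr x) @ rest \<longrightarrow>
     runs c s (poly p (sz x)) (s(0 := code (tr (f x)) @ rest)))"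

text \<open>Every value of the type counts as input, malformed or not. Later functions therefore
  carry default values that keep them small outside their intended domain.\<close>

definition PT :: "('a::codable \<Rightarrow> 'b::codable) \<Rightarrow> bool" where
  "PT f \<longleftrightarrow> (\<exists>c p. computes c p f)"

instantiation bool :: codable begin
definition "tr b = (if b then Node Leaf Leaf else Leaf)"
instance ..
end

instantiation prod :: (codable, codable) codable begin
definition "tr p = Node (tr (fst p)) (tr (snd p))"
instance ..
end

instantiation list :: (codable) codable begin
primrec tr_list :: "'a list \<Rightarrow> tree" where
  "tr_list [] = Leaf"
| "tr_list (x # xs) = Node (tr x) (tr_list xs)"
instance ..
end

lemma code_neq_Nil: "code t \<noteq> []"
  by (cases t) auto

lemma sz_pos: "0 < sz x"
  by (simp add: sz_def code_neq_Nil)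

lemma sz_pair: "sz (x, y) = 1 + sz x + sz y"
  by (simp add: sz_def tr_prod_def)

lemma sz_Nil: "sz [] = 1"
  by (simp add: sz_def)

lemma sz_Cons: "sz (x # xs) = 1 + sz x + sz xs"
  by (simp add: sz_def)

lemma sz_bool: "sz b \<le> 3" for b :: bool
  by (simp add: sz_def tr_bool_def)

lemma computesD: "computes c p f \<Longrightarrow> s 0 = code (tr x) @ rest \<Longrightarrow>
     runs c s (poly p (sz x)) (s(0 := code (tr (f x)) @ rest))"
  unfolding computes_def by blast

lemma PT_E: "PT f \<Longrightarrow> (\<And>c p. computes c p f \<Longrightarrow> thesis) \<Longrightarrow> thesis"
  unfolding PT_def by blast

lemma PT_I:
  assumes "\<And>x s rest. s 0 = code (tr x) @ rest \<Longrightarrow>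
     runs c s (poly p (sz x)) (s(0 := code (tr (f x)) @ rest))"
  shows "PT f"
  using assms unfolding PT_def computes_def by blast

lemma PT_size:
  assumes "PT f"
  obtains q :: "nat poly" where "\<forall>x. sz (f x) \<le> poly q (sz x)"
proof -
  obtain c p where c: "computes c p f" by (rule PT_E[OF assms])
  have "sz (f x) \<le> poly (p + [:0, 1:]) (sz x)" for x
    using runs_length[OF computesD[OF c, of "\<lambda>_. code (tr x)" x "[]"], of 0] by (simp add: sz_def)
  then show thesis using that by blast
qed

text \<open>Change of type without work: a number and its digit list, or a list and the pair of its
  head and tail, have the same tree.\<close>

lemma PT_same_code: "(\<And>x. tr (f x) = tr x) \<Longrightarrow> PT f"
  by (rule PT_I[where c = Skip and p = "[:1:]"]) (use runs_Skip in \<open>auto simp: fun_upd_idem\<close>)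

lemma PT_id: "PT (\<lambda>x. x)"
  by (rule PT_same_code) simp

lemma PT_comp:
  fixes f :: "'a::codable \<Rightarrow> 'b::codable"
  assumes "PT f" "PT g"
  shows "PT (\<lambda>x. g (f x))"
proof -
  obtain c p where c: "computes c p f" by (rule PT_E[OF \<open>PT f\<close>])
  obtain d q where d: "computes d q g" by (rule PT_E[OF \<open>PT g\<close>])
  obtain r where r: "\<forall>x. sz (f x) \<le> poly r (sz x)" by (rule PT_size[OF \<open>PT f\<close>])
  show ?thesis
  proof (rule PT_I)
    fix x :: 'a and s :: state and rest assume "s 0 = code (tr x) @ rest"
    from runs_Seq[OF computesD[where s = s, OF c this] computesD[OF d, of _ "f x" rest]]
    show "runs (Seq c d) s (poly (p + pcompose q r) (sz x)) (s(0 := code (tr (g (f x))) @ rest))"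
      by (rule runs_eq) (auto simp: poly_pcompose intro!: poly_nat_mono r[rule_format])
  qed
qed

fun push_code :: "bool list \<Rightarrow> prog" where
  "push_code [] = Skip"
| "push_code (b # bs) = Seq (push_code bs) (Push 0 b)"

lemma runs_push_code: "runs (push_code bs) s (length bs + 1) (s(0 := bs @ s 0))"
proof (induction bs)
  case Nil
  then show ?case using runs_Skip by simp
next
  case (Cons b bs)
  show ?case by (simp, rule runs_eq[OF runs_Seq[OF Cons runs_Push]]) auto
qed

lemma PT_const: "PT (\<lambda>x::'a::codable. c)"
proof (rule PT_I)
  fix x :: 'a and s :: state and rest assume s: "s 0 = code (tr x) @ rest"
  show "runs (Seq (transfer 0 []) (push_code (code (tr c)))) s
     (poly [:sz c + 21, 20:] (sz x)) (s(0 := code (tr c) @ rest))"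
    by (rule runs_eq[OF runs_Seq[OF runs_transfer[where i = 0 and s = s, OF _ _ _ s] runs_push_code]])
       (auto simp: sz_def fun_eq_iff)
qed

text \<open>A copy of the argument waits on stack 1 while \<open>g\<close> runs. In preorder the
  second component lies below the first, so \<open>g\<close> is computed before
  \<open>f\<close>.\<close>

lemma PT_Pair:
  fixes f :: "'a::codable \<Rightarrow> 'b::codable"
  assumes "PT f" "PT g"
  shows "PT (\<lambda>x. (f x, g x))"
proof -
  obtain c p where c: "computes c p f" by (rule PT_E[OF \<open>PT f\<close>])
  obtain d q where d: "computes d q g" by (rule PT_E[OF \<open>PT g\<close>])
  show ?thesis
  proof (rule PT_I)
    fix x :: 'a and s :: state and rest assume s: "s 0 = code (tr x) @ rest"
    define s1 where "s1 = s(1 := code (tr x) @ s 1)"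
    define s2 where "s2 = s1(0 := code (tr (g x)) @ rest)"
    define s3 where "s3 = s(0 := code (tr x) @ code (tr (g x)) @ rest)"
    define s4 where "s4 = s(0 := code (tr (f x)) @ code (tr (g x)) @ rest)"
    have 1: "runs (transfer 0 [0, 1]) s (20 * sz x + 20) s1"
      by (rule runs_eq[OF runs_transfer[where i = 0 and s = s, OF _ _ _ s]]) (use s in \<open>auto simp: sz_def s1_def fun_eq_iff\<close>)
    have 2: "runs d s1 (poly q (sz x)) s2"
      unfolding s2_def by (rule computesD[OF d]) (use s in \<open>auto simp: s1_def\<close>)
    have 3: "runs (transfer 1 [0]) s2 (20 * sz x + 20) s3"
      by (rule runs_eq[OF runs_transfer[where rest = "s 1"]]) (auto simp: sz_def s1_def s2_def s3_def fun_eq_iff)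
    have 4: "runs c s3 (poly p (sz x)) s4"
      by (rule runs_eq[OF computesD[OF c, of s3 x "code (tr (g x)) @ rest"]]) (auto simp: s3_def s4_def)
    show "runs (Seq (transfer 0 [0,1]) (Seq d (Seq (transfer 1 [0]) (Seq c (Push 0 True))))) s
      (poly ([:41, 40:] + p + q) (sz x)) (s(0 := code (tr (f x, g x)) @ rest))"
      by (rule runs_eq[OF runs_Seq[OF 1 runs_Seq[OF 2 runs_Seq[OF 3 runs_Seq[OF 4 runs_Push]]]]])
         (auto simp: s4_def tr_prod_def)
  qed
qed

text \<open>This serves \<open>fst\<close> and \<open>hd\<close> alike. On a leaf, \<open>hd\<close>
  returns the unspecified but fixed value \<open>hd []\<close>, whose code can be pushed as a
  constant.\<close>

lemma PT_first_subtree: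
  fixes f :: "'a::codable \<Rightarrow> 'b::codable"
  assumes "\<And>x. \<exists>a b. (tr x = Node a b \<and> tr (f x) = a) \<or> (tr x = Leaf \<and> f x = c)"
  shows "PT f"
proof (rule PT_I)
  fix x :: 'a and s :: state and rest assume s: "s 0 = code (tr x) @ rest"
  let ?c = "Cond (TopTrue 0) (Seq (Pop 0) (Seq (transfer 0 [1]) (Seq (transfer 0 []) (transfer 1 [0]))))
     (Seq (Pop 0) (push_code (code (tr c))))"
  let ?p = "[:sz c + 100, 100:]"
  consider a b where "tr x = Node a b" "tr (f x) = a" | "tr x = Leaf" "f x = c"
    using assms by blast
  then show "runs ?c s (poly ?p (sz x)) (s(0 := code (tr (f x)) @ rest))"
  proof cases
    case 1
    define s1 where "s1 = s(0 := code a @ code b @ rest)"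
    define s2 where "s2 = s(0 := code b @ rest, 1 := code a @ s 1)"
    define s3 where "s3 = s(0 := rest, 1 := code a @ s 1)"
    have r1: "runs (Pop 0) s 1 s1"
      by (rule runs_eq[OF runs_Pop]) (use s 1 in \<open>auto simp: s1_def\<close>)
    have r2: "runs (transfer 0 [1]) s1 (20 * length (code a) + 20) s2"
      by (rule runs_eq[OF runs_transfer[where rest = "code b @ rest"]])
         (auto simp: s1_def s2_def fun_eq_iff)
    have r3: "runs (transfer 0 []) s2 (20 * length (code b) + 20) s3"
      by (rule runs_eq[OF runs_transfer[where rest = "rest"]])
         (auto simp: s3_def s2_def fun_eq_iff)
    have r4: "runs (transfer 1 [0]) s3 (20 * length (code a) + 20) (s(0 := code (tr (f x)) @ rest))"
      by (rule runs_eq[OF runs_transfer[where rest = "s 1"]])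
         (auto simp: s3_def 1 fun_eq_iff)
    show ?thesis
      by (rule runs_eq[OF runs_CondT[OF _ runs_Seq[OF r1 runs_Seq[OF r2 runs_Seq[OF r3 r4]]]]])
         (use s 1 in \<open>auto simp: sz_def\<close>)
  next
    case 2
    show ?thesis
      by (rule runs_eq[OF runs_CondF[OF _ runs_Seq[OF runs_Pop runs_push_code]]])
         (use s 2 in \<open>auto simp: sz_def\<close>)
  qed
qed

lemma PT_second_subtree:
  fixes f :: "'a::codable \<Rightarrow> 'b::codable"
  assumes "\<And>x. \<exists>a b. (tr x = Node a b \<and> tr (f x) = b) \<or> (tr x = Leaf \<and> tr (f x) = Leaf)"
  shows "PT f"
proof (rule PT_I)
  fix x :: 'a and s :: state and rest assume s: "s 0 = code (tr x) @ rest"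
  let ?c = "Cond (TopTrue 0) (Seq (Pop 0) (transfer 0 [])) Skip"
  consider a b where "tr x = Node a b" "tr (f x) = b" | "tr x = Leaf" "tr (f x) = Leaf"
    using assms by blast
  then show "runs ?c s (poly [:100, 100:] (sz x)) (s(0 := code (tr (f x)) @ rest))"
  proof cases
    case 1
    have r1: "runs (Pop 0) s 1 (s(0 := code a @ code b @ rest))"
      by (rule runs_eq[OF runs_Pop]) (use s 1 in auto)
    have r2: "runs (transfer 0 []) (s(0 := code a @ code b @ rest)) (20 * length (code a) + 20)
        (s(0 := code b @ rest))"
      by (rule runs_eq[OF runs_transfer[where rest = "code b @ rest"]]) (auto simp: fun_eq_iff)
    show ?thesis
      by (rule runs_eq[OF runs_CondT[OF _ runs_Seq[OF r1 r2]]]) (use s 1 in \<open>auto simp: sz_def\<close>)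
  next
    case 2
    show ?thesis
      by (rule runs_eq[OF runs_CondF[OF _ runs_Skip]]) (use s 2 in auto)
  qed
qed

lemma PT_fst: "PT f \<Longrightarrow> PT (\<lambda>x. fst (f x))"
  by (rule PT_comp[where g = fst], assumption, rule PT_first_subtree[where c = undefined])
     (simp add: tr_prod_def)

lemma PT_snd: "PT f \<Longrightarrow> PT (\<lambda>x. snd (f x))"
  by (rule PT_comp[where g = snd], assumption, rule PT_second_subtree) (simp add: tr_prod_def)

lemma PT_hd: "PT f \<Longrightarrow> PT (\<lambda>x. hd (f x))"
  by (rule PT_comp[where g = hd], assumption, rule PT_first_subtree[where c = "hd []"])
     (metis list.sel(1) neq_Nil_conv tr_list.simps)

lemma PT_tl: "PT f \<Longrightarrow> PT (\<lambda>x. tl (f x))"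
  by (rule PT_comp[where g = tl], assumption, rule PT_second_subtree)
     (metis list.sel(2,3) neq_Nil_conv tr_list.simps)

lemma PT_Cons: "PT f \<Longrightarrow> PT g \<Longrightarrow> PT (\<lambda>x. f x # g x)"
  by (rule PT_comp[where f = "\<lambda>x. (f x, g x)" and g = "\<lambda>p. fst p # snd p", simplified, OF PT_Pair])
     (auto intro: PT_same_code simp: tr_prod_def)

text \<open>The first bit of a code tells \<open>Leaf\<close> from \<open>Node\<close>, so one test
  decides Boolean conditions and emptiness of lists alike. Each branch then removes the tested value
  and fetches the saved argument back.\<close>

lemma PT_if_nonleaf:
  fixes f :: "'a::codable \<Rightarrow> 'b::codable"
  assumes t: "PT t" and b: "\<And>x. b x \<longleftrightarrow> tr (t x) \<noteq> Leaf" and "PT f" "PT g"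
  shows "PT (\<lambda>x. if b x then f x else g x)"
proof -
  obtain e r where e: "computes e r t" by (rule PT_E[OF t])
  obtain l where l: "\<forall>x. sz (t x) \<le> poly l (sz x)" by (rule PT_size[OF t])
  obtain c p where c: "computes c p f" by (rule PT_E[OF \<open>PT f\<close>])
  obtain d q where d: "computes d q g" by (rule PT_E[OF \<open>PT g\<close>])
  let ?m = "Seq (transfer 0 []) (transfer 1 [0])"
  show ?thesis
  proof (rule PT_I)
    fix x :: 'a and s :: state and rest assume s: "s 0 = code (tr x) @ rest"
    define s1 where "s1 = s(1 := code (tr x) @ s 1)"
    define s2 where "s2 = s1(0 := code (tr (t x)) @ rest)"
    define s3 where "s3 = s1(0 := rest)"
    have 1: "runs (transfer 0 [0, 1]) s (20 * sz x + 20) s1"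
      by (rule runs_eq[OF runs_transfer[where i = 0 and s = s, OF _ _ _ s]]) (use s in \<open>auto simp: sz_def s1_def fun_eq_iff\<close>)
    have 2: "runs e s1 (poly r (sz x)) s2"
      unfolding s2_def by (rule computesD[OF e]) (use s in \<open>auto simp: s1_def\<close>)
    have 3: "runs (transfer 0 []) s2 (20 * sz (t x) + 20) s3"
      by (rule runs_eq[OF runs_transfer[where rest = "rest"]]) (auto simp: sz_def s3_def s2_def fun_eq_iff)
    have 4: "runs (transfer 1 [0]) s3 (20 * sz x + 20) s"
      by (rule runs_eq[OF runs_transfer[where rest = "s 1"]]) 
         (use s in \<open>auto simp: sz_def s1_def s3_def fun_eq_iff\<close>)
    have 34: "runs ?m s2 (20 * sz (t x) + 20 + (20 * sz x + 20)) s"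
      by (rule runs_Seq[OF 3 4])
    have top: "holds (TopTrue 0) s2 \<longleftrightarrow> b x"
      using b[of x] by (cases "tr (t x)") (auto simp: s2_def)
    let ?b = "20 * poly l (sz x) + 20 + (20 * sz x + 20) + poly p (sz x) + poly q (sz x)"
    have 5: "runs (Cond (TopTrue 0) (Seq ?m c) (Seq ?m d)) s2 (?b + 1)
        (s(0 := code (tr (if b x then f x else g x)) @ rest))"
    proof (cases "b x")
      case True
      show ?thesis
        by (rule runs_eq[OF runs_CondT[OF _ runs_Seq[OF 34 computesD[where s = s, OF c s]]]]) (use True top l[rule_format, of x] in auto)
    next
      case False
      show ?thesis
        by (rule runs_eq[OF runs_CondF[OF _ runs_Seq[OF 34 computesD[where s = s, OF d s]]]]) (use False top l[rule_format, of x] in auto)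
    qed
    show "runs (Seq (transfer 0 [0,1]) (Seq e (Cond (TopTrue 0) (Seq ?m c) (Seq ?m d)))) s
      (poly ([:61, 40:] + p + q + r + smult 20 l) (sz x))
      (s(0 := code (tr (if b x then f x else g x)) @ rest))"
      by (rule runs_mono[OF runs_Seq[OF 1 runs_Seq[OF 2 5]]]) auto
  qed
qed

lemma PT_if: "PT b \<Longrightarrow> PT f \<Longrightarrow> PT g \<Longrightarrow> PT (\<lambda>x. if b x then f x else g x)"
  by (rule PT_if_nonleaf[where t = b]) (auto simp: tr_bool_def)

lemma PT_not_Nil: "PT f \<Longrightarrow> PT (\<lambda>x. f x \<noteq> [])"
proof -
  assume "PT f"
  have "PT (\<lambda>x. if f x \<noteq> [] then True else False)"
    by (rule PT_if_nonleaf[where t = f]) (auto intro: PT_const \<open>PT f\<close>, (metis neq_Nil_conv tr_list.simps tree.distinct(1))+)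
  then show ?thesis by (simp add: if_bool_eq_disj)
qed

lemma PT_ext: "PT f \<Longrightarrow> (\<And>x. f x = g x) \<Longrightarrow> PT g"
  by (subgoal_tac "f = g") auto

lemma PT_not: "PT b \<Longrightarrow> PT (\<lambda>x. \<not> b x)"
  by (rule PT_ext[OF PT_if[OF _ PT_const PT_const]]) auto

lemma PT_conj: "PT a \<Longrightarrow> PT b \<Longrightarrow> PT (\<lambda>x. a x \<and> b x)"
  by (rule PT_ext[OF PT_if[where b = a and f = b, OF _ _ PT_const]]) auto

lemma PT_disj: "PT a \<Longrightarrow> PT b \<Longrightarrow> PT (\<lambda>x. a x \<or> b x)"
  by (rule PT_ext[OF PT_if[where b = a and g = b, OF _ PT_const]]) auto

lemma PT_eq_Nil: "PT f \<Longrightarrow> PT (\<lambda>x. f x = [])"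
  using PT_not[OF PT_not_Nil] by simp

lemma PT_case_list:
  assumes "PT f" "PT a" "PT (\<lambda>p. b (fst p) (fst (snd p)) (snd (snd p)))"
  shows "PT (\<lambda>x. case f x of [] \<Rightarrow> a x | y # ys \<Rightarrow> b x y ys)"
proof -
  have "PT (\<lambda>x. (x, hd (f x), tl (f x)))"
    by (intro PT_Pair PT_id PT_hd PT_tl assms)
  from PT_comp[OF this assms(3)] have "PT (\<lambda>x. if f x = [] then a x else b x (hd (f x)) (tl (f x)))"
    by (intro PT_if PT_eq_Nil assms) auto
  also have "(\<lambda>x. if f x = [] then a x else b x (hd (f x)) (tl (f x))) =
    (\<lambda>x. case f x of [] \<Rightarrow> a x | y # ys \<Rightarrow> b x y ys)"
    by (auto simp: fun_eq_iff split: list.splits)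
  finally show ?thesis .
qed

section \<open>Polynomial size bounds\<close>

definition pb :: "('a::codable \<Rightarrow> nat) \<Rightarrow> bool" where
  "pb b \<longleftrightarrow> (\<exists>q :: nat poly. \<forall>x. b x \<le> poly q (sz x))"

lemma pb_const: "pb (\<lambda>x. c)"
  unfolding pb_def by (rule exI[of _ "[:c:]"]) simp

lemma pb_add: "pb a \<Longrightarrow> pb b \<Longrightarrow> pb (\<lambda>x. a x + b x)"
  unfolding pb_def by (metis add_mono poly_add)

lemma pb_mult: "pb a \<Longrightarrow> pb b \<Longrightarrow> pb (\<lambda>x. a x * b x)"
  unfolding pb_def by (metis mult_mono poly_mult zero_le)

lemma pb_Suc: "pb a \<Longrightarrow> pb (\<lambda>x. Suc (a x))"
  using pb_add[OF _ pb_const[of 1], of a] by simp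

lemma pb_le: "pb a \<Longrightarrow> (\<And>x. b x \<le> a x) \<Longrightarrow> pb b"
  unfolding pb_def by (meson le_trans)

lemma pb_poly: "pb a \<Longrightarrow> pb (\<lambda>x. poly q (a x))"
  unfolding pb_def by (metis poly_nat_mono poly_pcompose)

lemma pb_sz: "PT f \<Longrightarrow> pb (\<lambda>x. sz (f x))"
  unfolding pb_def using PT_size by blast

lemma length_less_sz: "length xs < sz xs"
  by (induction xs) (auto simp: sz_Nil sz_Cons)

lemma sz_elem: "a \<in> set xs \<Longrightarrow> sz a < sz xs"
  by (induction xs) (auto simp: sz_Cons)

lemma pb_length: "PT f \<Longrightarrow> pb (\<lambda>x. length (f x))"
  by (rule pb_le[OF pb_sz less_imp_le[OF length_less_sz]])

lemmas pb_intros = pb_const pb_add pb_mult pb_Suc pb_sz pb_length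

lemma sz_list_le: "(\<And>a. a \<in> set xs \<Longrightarrow> sz a \<le> B) \<Longrightarrow> length xs \<le> n \<Longrightarrow> sz xs \<le> 1 + n * (B + 1)"
proof -
  assume B: "\<And>a. a \<in> set xs \<Longrightarrow> sz a \<le> B" and "length xs \<le> n"
  from B have "sz xs \<le> 1 + length xs * (B + 1)"
  proof (induction xs)
    case (Cons a xs)
    then have "sz a \<le> B" "sz xs \<le> 1 + length xs * (B + 1)" by simp_all
    then show ?case by (simp add: sz_Cons)
  qed (simp add: sz_Nil)
  also have "\<dots> \<le> 1 + n * (B + 1)" using \<open>length xs \<le> n\<close> by (intro add_left_mono mult_right_mono) auto
  finally show ?thesis .
qed

lemma sz_append: "sz (xs @ ys) + 1 = sz xs + sz ys"
  by (induction xs) (auto simp: sz_Cons sz_Nil)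

lemma sz_rev: "sz (rev xs) = sz xs"
proof (induction xs)
  case (Cons a xs)
  then show ?case using sz_append[of "rev xs" "[a]"] by (simp add: sz_Cons sz_Nil)
qed simp

lemma sz_drop: "sz (drop k xs) \<le> sz xs"
  using sz_append[of "take k xs" "drop k xs"] sz_pos[of "take k xs"] by simp

lemma sz_take: "sz (take k xs) \<le> sz xs"
  using sz_append[of "take k xs" "drop k xs"] sz_pos[of "drop k xs"] by simp

text \<open>A list element is smaller than its list, so one polynomial bounds the images of all
  elements at once.\<close>

lemma pb_elem:
  assumes "PT (\<lambda>p. f (fst p) (snd p))" "PT l"
  obtains B where "pb B" "\<And>x a. a \<in> set (l x) \<Longrightarrow> sz (f x a) \<le> B x"
proof -
  obtain q :: "nat poly" where q: "\<forall>p. sz (f (fst p) (snd p)) \<le> poly q (sz p)"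
    using PT_size[OF assms(1)] .
  have "sz (f x a) \<le> poly q (1 + sz x + sz (l x))" if "a \<in> set (l x)" for x a
    using q[rule_format, of "(x, a)"] sz_elem[OF that]
    by (simp add: sz_pair) (meson add_left_mono less_imp_le order_trans poly_nat_mono not_less_eq_eq)
  moreover have "pb (\<lambda>x. poly q (1 + sz x + sz (l x)))"
    by (intro pb_poly pb_intros PT_id assms)
  ultimately show thesis using that by blast
qed

section \<open>Bounded iteration\<close>

text \<open>A list on stack 1 is the loop counter: a cons cell shows \<open>True\<close> on top, and
  the code of the empty list leaves the \<open>False\<close> that remains at the end. Each round
  discards one element.\<close>

lemma runs_loop:
  fixes h :: "'a::codable \<Rightarrow> 'a" and ls :: "'b::codable list"
  assumes h: "computes c p h"
    and "s 0 = code (tr y) @ rest" "s 1 = code (tr ls) @ r1"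
    and "\<And>k. k < length ls \<Longrightarrow> sz ((h ^^ k) y) \<le> B"
  shows "runs (While (TopTrue 1) (Seq (Pop 1) (Seq (transfer 1 []) c))) s
     (length ls * (poly p B + 30) + 20 * sz ls + 1)
     (s(0 := code (tr ((h ^^ length ls) y)) @ rest, 1 := False # r1))"
  using assms(2-)
proof (induction ls arbitrary: s y)
  case Nil
  then have s: "s(0 := code (tr ((h ^^ length []) y)) @ rest, 1 := False # r1) = s" by (auto simp: fun_eq_iff)
  show ?case unfolding s by (rule runs_mono[OF runs_WhileF]) (use Nil in auto)
next
  case (Cons l ls)
  define s1 where "s1 = s(1 := code (tr l) @ code (tr ls) @ r1)"
  define s2 where "s2 = s(1 := code (tr ls) @ r1)"
  define s3 where "s3 = s2(0 := code (tr (h y)) @ rest)"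
  have 1: "runs (Pop 1) s 1 s1"
    by (rule runs_eq[OF runs_Pop]) (use Cons.prems in \<open>auto simp: s1_def\<close>)
  have 2: "runs (transfer 1 []) s1 (20 * sz l + 20) s2"
    by (rule runs_eq[OF runs_transfer[where rest = "code (tr ls) @ r1"]])
       (auto simp: sz_def s1_def s2_def fun_eq_iff)
  have 3: "runs c s2 (poly p B) s3"
    unfolding s3_def
    by (rule runs_mono[OF computesD[OF h]])
       (use Cons.prems(1) Cons.prems(3)[of 0] in \<open>auto simp: s2_def intro: poly_nat_mono\<close>)
  have 4: "runs (While (TopTrue 1) (Seq (Pop 1) (Seq (transfer 1 []) c))) s3
     (length ls * (poly p B + 30) + 20 * sz ls + 1)
     (s3(0 := code (tr ((h ^^ length ls) (h y))) @ rest, 1 := False # r1))"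
    by (rule Cons.IH)
       (use Cons.prems(3)[of "Suc k" for k] in \<open>auto simp: s3_def s2_def funpow_swap1\<close>)
  show ?case
    by (rule runs_eq[OF runs_WhileT[OF _ runs_Seq[OF 1 runs_Seq[OF 2 3]] 4]])
       (use Cons.prems in \<open>auto simp: s3_def s2_def sz_Cons fun_eq_iff funpow_swap1\<close>)
qed

text \<open>The bound \<open>B\<close> on all iterates is a genuine condition: a step that doubles
  its argument runs in polynomial time, but its iterates grow exponentially.\<close>

lemma PT_funpow_simple:
  fixes h :: "'a::codable \<Rightarrow> 'a" and l :: "'c::codable \<Rightarrow> 'b::codable list"
  assumes "PT h" "PT l" "PT g" "pb B"
    and "\<And>x k. k \<le> length (l x) \<Longrightarrow> sz ((h ^^ k) (g x)) \<le> B x"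
  shows "PT (\<lambda>x. (h ^^ length (l x)) (g x))"
proof -
  obtain c p where c: "computes c p h" by (rule PT_E[OF \<open>PT h\<close>])
  obtain d q where d: "computes d q (\<lambda>x. (l x, g x))" by (rule PT_E[OF PT_Pair[OF \<open>PT l\<close> \<open>PT g\<close>]])
  let ?t = "\<lambda>x. length (l x) * (poly p (B x) + 30) + 20 * sz (l x) + 1"
  obtain r :: "nat poly" where r: "\<forall>x. poly q (sz x) + 40 * sz (l x) + 40 + ?t x \<le> poly r (sz x)"
  proof -
    have "pb (\<lambda>x. poly q (sz x) + 40 * sz (l x) + 40 + ?t x)"
      by (intro pb_intros pb_poly PT_id assms)
    then show thesis using that unfolding pb_def by blast
  qed
  show ?thesis
  proof (rule PT_I)
    fix x :: 'c and s :: state and rest assume s: "s 0 = code (tr x) @ rest"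
    define s1 where "s1 = s(0 := code (tr (l x, g x)) @ rest)"
    define s2 where "s2 = s(0 := code (tr (l x)) @ code (tr (g x)) @ rest)"
    define s3 where "s3 = s(0 := code (tr (g x)) @ rest, 1 := code (tr (l x)) @ s 1)"
    define s4 where "s4 = s3(0 := code (tr ((h ^^ length (l x)) (g x))) @ rest, 1 := False # s 1)"
    have 1: "runs d s (poly q (sz x)) s1"
      unfolding s1_def by (rule computesD[where s = s, OF d s])
    have 2: "runs (Pop 0) s1 1 s2"
      by (rule runs_eq[OF runs_Pop]) (auto simp: s1_def s2_def tr_prod_def)
    have 3: "runs (transfer 0 [1]) s2 (20 * sz (l x) + 20) s3"
      by (rule runs_eq[OF runs_transfer[where rest = "code (tr (g x)) @ rest"]])
         (auto simp: sz_def s2_def s3_def fun_eq_iff)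
    have 4: "runs (While (TopTrue 1) (Seq (Pop 1) (Seq (transfer 1 []) c))) s3 (?t x) s4"
      unfolding s4_def by (rule runs_loop[OF c]) (use assms(5) in \<open>auto simp: s3_def\<close>)
    have 5: "runs (Pop 1) s4 1 (s(0 := code (tr ((h ^^ length (l x)) (g x))) @ rest))"
      by (rule runs_eq[OF runs_Pop]) (auto simp: s4_def s3_def fun_eq_iff)
    show "runs (Seq d (Seq (Pop 0) (Seq (transfer 0 [1])
        (Seq (While (TopTrue 1) (Seq (Pop 1) (Seq (transfer 1 []) c))) (Pop 1))))) s (poly r (sz x))
        (s(0 := code (tr ((h ^^ length (l x)) (g x))) @ rest))"
      by (rule runs_mono[OF runs_Seq[OF 1 runs_Seq[OF 2 runs_Seq[OF 3 runs_Seq[OF 4 5]]]]])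
         (use r[rule_format, of x] in linarith)
  qed
qed

text \<open>A loop body sees only the current state, so the parameter \<open>x\<close> travels along
  as a component of it.\<close>

lemma PT_funpow:
  fixes f :: "'c::codable \<Rightarrow> 'a::codable \<Rightarrow> 'a"
  assumes "PT (\<lambda>p. f (fst p) (snd p))" "PT l" "PT g" "pb B"
    and B: "\<And>x k. k \<le> length (l x) \<Longrightarrow> sz ((f x ^^ k) (g x)) \<le> B x"
  shows "PT (\<lambda>x. (f x ^^ length (l x)) (g x))"
proof -
  let ?h = "\<lambda>p. (fst p, f (fst p) (snd p))"
  have h: "(?h ^^ k) (x, y) = (x, (f x ^^ k) y)" for k x y
    by (induction k) auto
  have "PT (\<lambda>x. (?h ^^ length (l x)) (x, g x))"
    by (rule PT_funpow_simple[where B = "\<lambda>x. 1 + sz x + B x"])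
       (use B in \<open>auto simp: h sz_pair intro!: PT_Pair PT_fst PT_id assms pb_intros\<close>)
  from PT_snd[OF this] show ?thesis by (simp add: h)
qed

lemma PT_fold:
  assumes "PT (\<lambda>p. f (fst p) (fst (snd p)) (snd (snd p)))" "PT l" "PT g" "pb B"
    and B: "\<And>x k. k \<le> length (l x) \<Longrightarrow> sz (fold (f x) (take k (l x)) (g x)) \<le> B x"
  shows "PT (\<lambda>x. fold (f x) (l x) (g x))"
proof -
  \<comment> \<open>The state holds the unread part of the list; once it is empty, further rounds
    leave the result alone.\<close>
  let ?h = "\<lambda>x p. (tl (fst p), if fst p = [] then snd p else f x (hd (fst p)) (snd p))"
  have h: "(?h x ^^ k) (ls, y) = (drop k ls, fold (f x) (take k ls) y)" for x k ls y
  proof (induction k arbitrary: ls y)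
    case (Suc k)
    then show ?case by (cases ls) (simp_all add: funpow_Suc_right del: funpow.simps)
  qed simp
  have 1: "PT (\<lambda>p. f (fst p) (hd (fst (snd p))) (snd (snd p)))"
    by (rule PT_comp[where f = "\<lambda>p. (fst p, hd (fst (snd p)), snd (snd p))", OF _ assms(1), simplified])
       (intro PT_Pair PT_fst PT_snd PT_hd PT_id)
  have 2: "PT (\<lambda>p. ?h (fst p) (snd p))"
    by (intro PT_Pair PT_tl PT_if PT_eq_Nil 1 PT_fst PT_snd PT_id)
  have "PT (\<lambda>x. (?h x ^^ length (l x)) (l x, g x))"
    by (rule PT_funpow[where B = "\<lambda>x. 1 + sz (l x) + B x", OF 2])
       (use B in \<open>auto simp: h sz_pair sz_drop add_mono intro!: PT_Pair assms pb_intros\<close>)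
  from PT_snd[OF this] show ?thesis by (simp add: h)
qed

text \<open>For folds whose intermediate values have no closed form, an invariant that entails the
  size bound is enough.\<close>

lemma PT_fold_inv:
  assumes "PT (\<lambda>p. f (fst p) (fst (snd p)) (snd (snd p)))" "PT l" "PT g" "pb B"
    and "\<And>x. I x (g x)" "\<And>x a y. a \<in> set (l x) \<Longrightarrow> I x y \<Longrightarrow> I x (f x a y)"
    and "\<And>x y. I x y \<Longrightarrow> sz y \<le> B x"
  shows "PT (\<lambda>x. fold (f x) (l x) (g x))"
proof (rule PT_fold[OF assms(1-4)])
  fix x k
  have "set as \<subseteq> set (l x) \<Longrightarrow> I x y \<Longrightarrow> I x (fold (f x) as y)" for as y
    by (induction as arbitrary: y) (auto intro: assms)
  then show "sz (fold (f x) (take k (l x)) (g x)) \<le> B x"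
    by (meson assms(5,7) set_take_subset)
qed

section \<open>List functions\<close>

lemma PT_rev: "PT l \<Longrightarrow> PT (\<lambda>x. rev (l x))"
proof -
  assume l: "PT l"
  have "PT (\<lambda>x. fold (\<lambda>a as. a # as) (l x) [])"
    by (intro PT_fold[where B = "\<lambda>x. sz (l x)"] PT_Cons PT_fst PT_snd PT_id PT_const pb_intros l)
       (simp add: fold_Cons_rev sz_rev sz_take)
  then show ?thesis by (simp add: fold_Cons_rev)
qed

lemma PT_map:
  assumes "PT (\<lambda>p. f (fst p) (snd p))" "PT l"
  shows "PT (\<lambda>x. map (f x) (l x))"
proof -
  obtain B where B: "pb B" "\<And>x a. a \<in> set (l x) \<Longrightarrow> sz (f x a) \<le> B x"
    using pb_elem[OF assms] by blast
  have h: "fold (\<lambda>a as. f x a # as) xs ys = rev (map (f x) xs) @ ys" for x xs ys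
    by (induction xs arbitrary: ys) auto
  have 1: "PT (\<lambda>p. f (fst p) (fst (snd p)))"
    using PT_comp[where f = "\<lambda>p. (fst p, fst (snd p))", OF PT_Pair[OF PT_fst[OF PT_id] PT_fst[OF PT_snd[OF PT_id]]] assms(1)]
    by simp
  have "PT (\<lambda>x. fold (\<lambda>a as. f x a # as) (l x) [])"
  proof (rule PT_fold[where B = "\<lambda>x. 1 + length (l x) * (B x + 1)"])
    fix x k
    show "sz (fold (\<lambda>a as. f x a # as) (take k (l x)) []) \<le> 1 + length (l x) * (B x + 1)"
      unfolding h by (rule sz_list_le) (use B(2) in \<open>auto dest: in_set_takeD\<close>)
  qed (intro PT_Cons 1 PT_fst PT_snd PT_id PT_const pb_intros assms B)+
  from PT_rev[OF this] show ?thesis by (simp add: h)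
qed

lemma PT_filter:
  assumes "PT (\<lambda>p. P (fst p) (snd p))" "PT l"
  shows "PT (\<lambda>x. filter (P x) (l x))"
proof -
  have h: "fold (\<lambda>a as. if P x a then a # as else as) xs ys = rev (filter (P x) xs) @ ys" for x xs ys
    by (induction xs arbitrary: ys) auto
  have 1: "PT (\<lambda>p. P (fst p) (fst (snd p)))"
    using PT_comp[where f = "\<lambda>p. (fst p, fst (snd p))", OF PT_Pair[OF PT_fst[OF PT_id] PT_fst[OF PT_snd[OF PT_id]]] assms(1)]
    by simp
  have "PT (\<lambda>x. fold (\<lambda>a as. if P x a then a # as else as) (l x) [])"
  proof (rule PT_fold[where B = "\<lambda>x. 1 + length (l x) * (sz (l x) + 1)"])
    fix x k
    show "sz (fold (\<lambda>a as. if P x a then a # as else as) (take k (l x)) []) \<le> 1 + length (l x) * (sz (l x) + 1)"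
      unfolding h
      by (rule sz_list_le) (auto dest!: in_set_takeD intro: less_imp_le sz_elem
          order.trans[OF length_filter_le])
  qed (intro PT_if PT_Cons 1 PT_fst PT_snd PT_id PT_const pb_intros assms)+
  from PT_rev[OF this] show ?thesis by (simp add: h)
qed

lemma PT_append: 
  assumes "PT f" "PT g"
  shows "PT (\<lambda>x. f x @ g x)"
proof -
  have h: "fold (\<lambda>a as. a # as) xs ys = rev xs @ ys" for xs ys :: "'b list"
    by (induction xs arbitrary: ys) auto
  have "PT (\<lambda>x. fold (\<lambda>a as. a # as) (rev (f x)) (g x))"
  proof (rule PT_fold[where B = "\<lambda>x. sz (rev (f x)) + sz (g x)"])
    fix x k
    have "sz (rev (take k (rev (f x))) @ g x) + 1 = sz (rev (take k (rev (f x)))) + sz (g x)"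
      by (rule sz_append)
    then show "sz (fold (\<lambda>a as. a # as) (take k (rev (f x))) (g x)) \<le> sz (rev (f x)) + sz (g x)"
      unfolding h using sz_take[of k "rev (f x)"] by (simp add: sz_rev)
  qed (intro PT_rev PT_Cons PT_fst PT_snd PT_id pb_intros assms)+
  then show ?thesis by (simp add: h)
qed

lemma PT_concat: 
  assumes "PT f"
  shows "PT (\<lambda>x. concat (f x))"
proof -
  have h: "fold (\<lambda>a as. as @ a) xs ys = ys @ concat xs" for xs and ys :: "'b list"
    by (induction xs arbitrary: ys) auto
  have c: "sz (concat xs) \<le> sz xs" for xs :: "'b list list"
  proof (induction xs)
    case (Cons a xs)
    then show ?case using sz_append[of a "concat xs"] by (simp add: sz_Cons)
  qed (simp add: sz_Nil)
  have "PT (\<lambda>x. fold (\<lambda>a as. as @ a) (f x) [])"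
    by (intro PT_fold[where B = "\<lambda>x. sz (f x)"] PT_append PT_fst PT_snd PT_id PT_const pb_intros assms)
       (metis h append_Nil c sz_take order_trans)
  then show ?thesis by (simp add: h)
qed

lemma PT_ball_list:
  assumes "PT (\<lambda>p. P (fst p) (snd p))" "PT l"
  shows "PT (\<lambda>x. \<forall>a\<in>set (l x). P x a)"
proof -
  have "PT (\<lambda>x. filter (\<lambda>a. \<not> P x a) (l x) = [])"
    by (intro PT_eq_Nil PT_filter PT_not assms)
  then show ?thesis by (simp add: filter_empty_conv)
qed

lemma PT_bex_list:
  assumes "PT (\<lambda>p. P (fst p) (snd p))" "PT l"
  shows "PT (\<lambda>x. \<exists>a\<in>set (l x). P x a)"
  using PT_not[OF PT_ball_list[OF PT_not[OF assms(1)] assms(2)]] by simp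

lemma PT_zip: 
  assumes "PT f" "PT g"
  shows "PT (\<lambda>x. zip (f x) (g x))"
proof -
  \<comment> \<open>The unread part of the second list is carried in the state of a fold over the
    first.\<close>
  let ?h = "\<lambda>a (p :: 'c list \<times> ('b \<times> 'c) list). case fst p of [] \<Rightarrow> p | b # bs \<Rightarrow> (bs, (a, b) # snd p)"
  have h: "snd (fold ?h xs (ys, zs)) = rev (zip xs ys) @ zs" for xs ys zs
    by (induction xs arbitrary: ys zs) (auto split: list.splits)
  have h2: "fst (fold ?h xs (ys, zs)) = drop (length xs) ys" for xs ys zs
    by (induction xs arbitrary: ys zs) (auto split: list.splits)
  have "PT (\<lambda>x. fold ?h (f x) (g x, []))"
  proof (rule PT_fold[where B = "\<lambda>x. 1 + sz (g x) + (1 + length (f x) * (1 + sz (f x) + sz (g x) + 1))"])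
    fix x k
    let ?r = "fold ?h (take k (f x)) (g x, [])"
    have "sz (snd ?r) \<le> 1 + length (f x) * (1 + sz (f x) + sz (g x) + 1)"
      unfolding h
    proof (rule sz_list_le)
      fix p assume "p \<in> set (rev (zip (take k (f x)) (g x)) @ [])"
      then have "fst p \<in> set (f x)" "snd p \<in> set (g x)"
        using in_set_takeD[of "fst p" k "f x"] set_zip_leftD[of "fst p" "snd p"] set_zip_rightD[of "fst p" "snd p"]
        by auto
      from this[THEN sz_elem] show "sz p \<le> 1 + sz (f x) + sz (g x)"
        by (cases p) (simp add: sz_pair)
    qed simp
    then show "sz ?r \<le> 1 + sz (g x) + (1 + length (f x) * (1 + sz (f x) + sz (g x) + 1))"
      using sz_drop[of "length (take k (f x))" "g x"] h2[of "take k (f x)" "g x" "[]"]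
      by (cases ?r) (auto simp: sz_pair)
  qed (intro PT_case_list PT_Pair PT_Cons PT_fst PT_snd PT_id PT_const pb_intros assms)+
  from PT_rev[OF PT_snd[OF this]] show ?thesis by (simp add: h)
qed

section \<open>Interface to polynomial time on bit strings\<close>

text \<open>Raw inputs and outputs have no end marker, so here the end is recognised by an empty
  stack.\<close>

definition flip_onto :: "nat \<Rightarrow> nat \<Rightarrow> prog" where
  "flip_onto r t = While (NonEmpty r)
     (Cond (TopTrue r) (Seq (Pop r) (Push t True)) (Seq (Pop r) (Push t False)))"

lemma runs_flip_onto:
  "r \<noteq> t \<Longrightarrow> s r = bs \<Longrightarrow> runs (flip_onto r t) s (4 * length bs + 1) (s(r := [], t := rev bs @ s t))"
proof (induction bs arbitrary: s)
  case Nil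
  then have s: "s(r := [], t := rev [] @ s t) = s" by (auto simp: fun_eq_iff)
  show ?case unfolding flip_onto_def s by (rule runs_mono[OF runs_WhileF]) (use Nil in auto)
next
  case (Cons b bs)
  define s1 where "s1 = s(r := bs, t := b # s t)"
  let ?body = "Cond (TopTrue r) (Seq (Pop r) (Push t True)) (Seq (Pop r) (Push t False))"
  have 1: "runs ?body s 3 s1"
  proof (cases b)
    case True
    show ?thesis
      by (rule runs_eq[OF runs_CondT[OF _ runs_Seq[OF runs_Pop runs_Push]]])
         (use True Cons.prems in \<open>auto simp: s1_def\<close>)
  next
    case False
    show ?thesis
      by (rule runs_eq[OF runs_CondF[OF _ runs_Seq[OF runs_Pop runs_Push]]])
         (use False Cons.prems in \<open>auto simp: s1_def\<close>)
  qed
  have 2: "runs (flip_onto r t) s1 (4 * length bs + 1) (s1(r := [], t := rev bs @ s1 t))"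
    by (rule Cons.IH) (use Cons.prems in \<open>auto simp: s1_def\<close>)
  show ?case
    unfolding flip_onto_def
    by (rule runs_eq[OF runs_WhileT[OF _ 1 2[unfolded flip_onto_def]]])
       (use Cons.prems in \<open>auto simp: s1_def\<close>)
qed

text \<open>A cons cell starts with \<open>True\<close>, followed by the code of the bit,
  \<open>[True, False, False]\<close> or \<open>[False]\<close>; this gives the two strings that are
  pushed. Reading the reversed input builds the list from its end.\<close>

definition wrap_loop :: "nat \<Rightarrow> prog" where
  "wrap_loop t = While (NonEmpty t) (Cond (TopTrue t)
     (Seq (Pop t) (push_code [True, True, False, False])) (Seq (Pop t) (push_code [True, False])))"

lemma runs_wrap_loop:
  "t \<noteq> 0 \<Longrightarrow> s t = rev bs \<Longrightarrow> s 0 = code (tr cs) @ rest \<Longrightarrow>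
   runs (wrap_loop t) s (8 * length bs + 1) (s(t := [], 0 := code (tr (bs @ cs)) @ rest))"
  for bs cs :: "bool list"
proof (induction bs arbitrary: s cs rule: rev_induct)
  case Nil
  then have s: "s(t := [], 0 := code (tr ([] @ cs)) @ rest) = s" by (auto simp: fun_eq_iff)
  show ?case unfolding wrap_loop_def s by (rule runs_mono[OF runs_WhileF]) (use Nil in auto)
next
  case (snoc b bs)
  define s1 where "s1 = s(t := rev bs, 0 := code (tr (b # cs)) @ rest)"
  let ?body = "Cond (TopTrue t)
     (Seq (Pop t) (push_code [True, True, False, False])) (Seq (Pop t) (push_code [True, False]))"
  have 1: "runs ?body s 7 s1"
  proof (cases b)
    case True
    show ?thesis
      by (rule runs_eq[OF runs_CondT[OF _ runs_Seq[OF runs_Pop runs_push_code]]])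
         (use True snoc.prems in \<open>auto simp: s1_def tr_bool_def\<close>)
  next
    case False
    show ?thesis
      by (rule runs_eq[OF runs_CondF[OF _ runs_Seq[OF runs_Pop runs_push_code]]])
         (use False snoc.prems in \<open>auto simp: s1_def tr_bool_def\<close>)
  qed
  have 2: "runs (wrap_loop t) s1 (8 * length bs + 1) (s1(t := [], 0 := code (tr (bs @ b # cs)) @ rest))"
    by (rule snoc.IH) (use snoc.prems in \<open>auto simp: s1_def\<close>)
  show ?case
    unfolding wrap_loop_def
    by (rule runs_eq[OF runs_WhileT[OF _ 1 2[unfolded wrap_loop_def]]])
       (use snoc.prems in \<open>auto simp: s1_def fun_eq_iff\<close>)
qed

definition wrap :: "nat \<Rightarrow> prog" where
  "wrap t = Seq (Push 0 False) (wrap_loop t)"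

lemma runs_wrap:
  assumes "t \<noteq> 0" "s t = rev bs"
  shows "runs (wrap t) s (8 * length bs + 2) (s(t := [], 0 := code (tr bs) @ s 0))"
  using runs_Seq[OF runs_Push runs_wrap_loop[where s = "s(0 := False # s 0)" and cs = "[]" and rest = "s 0"]] assms
  unfolding wrap_def by (force elim: runs_eq simp: fun_eq_iff)

definition unwrap_loop :: prog where
  "unwrap_loop = While (TopTrue 0) (Seq (Pop 0) (Cond (TopTrue 0)
     (seqs [Pop 0, Pop 0, Pop 0, Push 2 True]) (seqs [Pop 0, Push 2 False])))"

lemma runs_unwrap_loop:
  "s 0 = code (tr bs) @ rest \<Longrightarrow>
   runs unwrap_loop s (8 * length bs + 1) (s(0 := False # rest, 2 := rev bs @ s 2))"
  for bs :: "bool list"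
proof (induction bs arbitrary: s)
  case Nil
  then have s: "s(0 := False # rest, 2 := rev [] @ s 2) = s" by (auto simp: fun_eq_iff)
  show ?case unfolding unwrap_loop_def s by (rule runs_mono[OF runs_WhileF]) (use Nil in auto)
next
  case (Cons b bs)
  define s0 where "s0 = s(0 := code (tr b) @ code (tr bs) @ rest)"
  define s1 where "s1 = s(0 := code (tr bs) @ rest, 2 := b # s 2)"
  have 0: "runs (Pop 0) s 1 s0"
    by (rule runs_eq[OF runs_Pop]) (use Cons.prems in \<open>auto simp: s0_def\<close>)
  have 1: "runs (Cond (TopTrue 0)
     (seqs [Pop 0, Pop 0, Pop 0, Push 2 True]) (seqs [Pop 0, Push 2 False])) s0 6 s1"
  proof (cases b)
    case True
    show ?thesis
      by (rule runs_eq, rule runs_CondT, use True in \<open>simp add: s0_def tr_bool_def\<close>,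
          (rule runs_Cons runs_Nil runs_Push runs_Pop)+)
         (use True in \<open>auto simp: s0_def s1_def tr_bool_def fun_eq_iff\<close>)
  next
    case False
    show ?thesis
      by (rule runs_eq, rule runs_CondF, use False in \<open>simp add: s0_def tr_bool_def\<close>,
          (rule runs_Cons runs_Nil runs_Push runs_Pop)+)
         (use False in \<open>auto simp: s0_def s1_def tr_bool_def fun_eq_iff\<close>)
  qed
  have 2: "runs unwrap_loop s1 (8 * length bs + 1) (s1(0 := False # rest, 2 := rev bs @ s1 2))"
    by (rule Cons.IH) (use Cons.prems in \<open>auto simp: s1_def\<close>)
  show ?case
    unfolding unwrap_loop_def
    by (rule runs_eq[OF runs_WhileT[OF _ runs_Seq[OF 0 1] 2[unfolded unwrap_loop_def]]])
       (use Cons.prems in \<open>auto simp: s1_def fun_eq_iff\<close>)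
qed

text \<open>The output is no longer than the code of the argument plus the running time, and copying
  it out takes 12 units per bit (8 for unwrapping, 4 for the reversal), so the total stays
  polynomial.\<close>

lemma runs_finish:
  fixes f :: "'a::codable \<Rightarrow> bool list"
  assumes c: "computes c p f" and s: "s 0 = code (tr x)" and "s 2 = []"
  shows "\<exists>s'. runs (Seq c (Seq unwrap_loop (Seq (Pop 0) (flip_onto 2 0)))) s
     (poly (p + smult 12 (p + [:0, 1:]) + [:3:]) (sz x)) s' \<and> s' 0 = f x"
proof -
  define s1 where "s1 = s(0 := code (tr (f x)) @ [])"
  have 1: "runs c s (poly p (sz x)) s1"
    unfolding s1_def by (rule computesD[OF c]) (use s in simp)
  have "length (f x) \<le> sz (f x)" by (rule less_imp_le[OF length_less_sz])
  also have "\<dots> \<le> sz x + poly p (sz x)"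
    using runs_length[OF 1, of 0] s by (simp add: s1_def sz_def)
  finally have len: "length (f x) \<le> sz x + poly p (sz x)" .
  define s2 where "s2 = s1(0 := [False], 2 := rev (f x))"
  define s3 where "s3 = s2(0 := [])"
  define s4 where "s4 = s3(2 := [], 0 := f x)"
  have 2: "runs unwrap_loop s1 (8 * length (f x) + 1) s2"
    by (rule runs_eq[OF runs_unwrap_loop[where rest = "[]"]])
       (use assms in \<open>auto simp: s1_def s2_def\<close>)
  have 3: "runs (Pop 0) s2 1 s3"
    by (rule runs_eq[OF runs_Pop]) (auto simp: s2_def s3_def)
  have 4: "runs (flip_onto 2 0) s3 (4 * length (f x) + 1) s4"
    by (rule runs_eq[OF runs_flip_onto[where bs = "rev (f x)"]])
       (auto simp: s2_def s3_def s4_def)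
  show ?thesis
    by (rule exI[of _ s4], rule conjI, rule runs_mono[OF runs_Seq[OF 1 runs_Seq[OF 2 runs_Seq[OF 3 4]]]])
       (use len in \<open>auto simp: s4_def\<close>)
qed

lemma sz_bits: "sz bs \<le> 4 * length bs + 1" for bs :: "bool list"
  by (induction bs) (auto simp: sz_Nil sz_Cons sz_def[where x = "_ :: bool"] tr_bool_def)

lemma polytime_on_PT1:
  assumes "PT f"
  shows "polytime_on {xs. length xs = 1} (\<lambda>xs. f (xs ! 0))"
proof -
  obtain c p where c: "computes c p f" by (rule PT_E[OF assms])
  define q where "q = p + smult 12 (p + [:0, 1:]) + [:3:]"
  let ?c = "Seq (flip_onto 0 2) (Seq (wrap 2) (Seq c (Seq unwrap_loop (Seq (Pop 0) (flip_onto 2 0)))))"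
  have "\<exists>t s. exec ?c (init_state [x]) t s \<and> s 0 = f x \<and> t \<le> poly ([:3, 12:] + pcompose q [:1, 4:]) (length x)" for x
  proof -
    define s0 where "s0 = init_state [x]"
    define s1 where "s1 = s0(0 := [], 2 := rev x)"
    define s2 where "s2 = s0(0 := code (tr x))"
    have 1: "runs (flip_onto 0 2) s0 (4 * length x + 1) s1"
      by (rule runs_eq[OF runs_flip_onto[where bs = x]]) (auto simp: s0_def s1_def init_state_def)
    have 2: "runs (wrap 2) s1 (8 * length x + 2) s2"
      by (rule runs_eq[OF runs_wrap[where bs = x]]) (auto simp: s0_def s1_def s2_def init_state_def fun_eq_iff)
    obtain s' where s': "s' 0 = f x" "runs (Seq c (Seq unwrap_loop (Seq (Pop 0) (flip_onto 2 0)))) s2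
        (poly q (sz x)) s'"
      using runs_finish[OF c, of s2 x] unfolding q_def by (auto simp: s2_def s0_def init_state_def)
    have "poly q (sz x) \<le> poly q (1 + 4 * length x)"
      by (rule poly_nat_mono) (use sz_bits[of x] in simp)
    with runs_Seq[OF 1 runs_Seq[OF 2 s'(2)]] s'(1) show ?thesis
      unfolding runs_def s0_def
      by - (elim exE conjE, intro exI conjI, assumption, assumption, simp add: poly_pcompose algebra_simps)
  qed
  then show ?thesis
    unfolding polytime_on_def
    by (intro exI[of _ ?c] exI[of _ "[:3, 12:] + pcompose q [:1, 4:]"]) (auto simp: length_Suc_conv)
qed

text \<open>Both inputs are first moved out of the way, because the code of a pair needs the second
  one at the bottom of stack 0.\<close>

lemma polytime_on_PT2:
  assumes "PT f"
  shows "polytime_on {xs. length xs = 2} (\<lambda>xs. f (xs ! 0, xs ! 1))"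
proof -
  obtain c p where c: "computes c p f" by (rule PT_E[OF assms])
  define q where "q = p + smult 12 (p + [:0, 1:]) + [:3:]"
  let ?c = "Seq (flip_onto 0 2) (Seq (flip_onto 1 3) (Seq (wrap 3) (Seq (wrap 2) (Seq (Push 0 True)
     (Seq c (Seq unwrap_loop (Seq (Pop 0) (flip_onto 2 0))))))))"
  have "\<exists>t s. exec ?c (init_state [x, y]) t s \<and> s 0 = f (x, y) \<and>
      t \<le> poly ([:7, 12:] + pcompose q [:3, 4:]) (length x + length y)" for x y
  proof -
    define s0 where "s0 = init_state [x, y]"
    define s1 where "s1 = s0(0 := [], 2 := rev x)"
    define s2 where "s2 = s0(0 := [], 1 := [], 2 := rev x, 3 := rev y)"
    define s3 where "s3 = s0(0 := code (tr y), 1 := [], 2 := rev x)"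
    define s4 where "s4 = s0(0 := code (tr x) @ code (tr y), 1 := [])"
    define s5 where "s5 = s0(0 := code (tr (x, y)), 1 := [])"
    note defs = s0_def s1_def s2_def s3_def s4_def s5_def init_state_def
    have 1: "runs (flip_onto 0 2) s0 (4 * length x + 1) s1"
      by (rule runs_eq[OF runs_flip_onto[where bs = x]]) (auto simp: defs)
    have 2: "runs (flip_onto 1 3) s1 (4 * length y + 1) s2"
      by (rule runs_eq[OF runs_flip_onto[where bs = y]]) (auto simp: defs fun_eq_iff)
    have 3: "runs (wrap 3) s2 (8 * length y + 2) s3"
      by (rule runs_eq[OF runs_wrap[where bs = y]]) (auto simp: defs fun_eq_iff)
    have 4: "runs (wrap 2) s3 (8 * length x + 2) s4"
      by (rule runs_eq[OF runs_wrap[where bs = x]]) (auto simp: defs fun_eq_iff)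
    have 5: "runs (Push 0 True) s4 1 s5"
      by (rule runs_eq[OF runs_Push]) (auto simp: defs fun_eq_iff tr_prod_def)
    obtain s' where s': "s' 0 = f (x, y)" "runs (Seq c (Seq unwrap_loop (Seq (Pop 0) (flip_onto 2 0)))) s5
        (poly q (sz (x, y))) s'"
      using runs_finish[OF c, of s5 "(x, y)"] unfolding q_def by (auto simp: defs)
    have "poly q (sz (x, y)) \<le> poly q (3 + 4 * (length x + length y))"
      by (rule poly_nat_mono) (use sz_bits[of x] sz_bits[of y] in \<open>simp add: sz_pair\<close>)
    with runs_Seq[OF 1 runs_Seq[OF 2 runs_Seq[OF 3 runs_Seq[OF 4 runs_Seq[OF 5 s'(2)]]]]] s'(1) show ?thesis
      unfolding runs_def s0_def
      by - (elim exE conjE, intro exI conjI, assumption, assumption, simp add: poly_pcompose algebra_simps)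
  qed
  then show ?thesis
    unfolding polytime_on_def
    by (intro exI[of _ ?c] exI[of _ "[:7, 12:] + pcompose q [:3, 4:]"])
       (auto simp: length_Suc_conv numeral_2_eq_2)
qed

section \<open>Equality and finite functions\<close>

text \<open>The assumption is \<open>PT (\<lambda>p. fst p = snd p)\<close> unfolded, since the class instance for pairs is
  not available inside the class declaration.\<close>

class eq_codable = codable +
  assumes eq_computable: "\<exists>c. \<exists>p :: nat poly. \<forall>x y s rest. s 0 = code (Node (tr x) (tr y)) @ rest \<longrightarrow>
     runs c s (poly p (length (code (Node (tr x) (tr y)))))
       (s(0 := code (if x = y then Node Leaf Leaf else Leaf) @ rest))"

lemma eq_computableI:
  assumes "PT (\<lambda>p :: 'a \<times> 'a. fst p = snd p)"
  shows "\<exists>c. \<exists>p :: nat poly. \<forall>(x :: 'a::codable) y s rest. s 0 = code (Node (tr x) (tr y)) @ rest \<longrightarrow>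
     runs c s (poly p (length (code (Node (tr x) (tr y)))))
       (s(0 := code (if x = y then Node Leaf Leaf else Leaf) @ rest))"
  using assms unfolding PT_def computes_def
  by (simp add: split_paired_all tr_prod_def tr_bool_def sz_def del: code.simps)

lemma PT_eq_pair: "PT (\<lambda>p :: 'a::eq_codable \<times> 'a. fst p = snd p)"
  using eq_computable unfolding PT_def computes_def
  by (simp add: split_paired_all tr_prod_def tr_bool_def sz_def del: code.simps)

lemma PT_eq: "PT f \<Longrightarrow> PT g \<Longrightarrow> PT (\<lambda>x. f x = g x)" for f g :: "'a::codable \<Rightarrow> 'b::eq_codable"
  by (rule PT_comp[where f = "\<lambda>x. (f x, g x)", OF _ PT_eq_pair, simplified]) (rule PT_Pair)

instance bool :: eq_codable
proof (standard, rule eq_computableI)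
  have "PT (\<lambda>p :: bool \<times> bool. if fst p then snd p else \<not> snd p)"
    by (intro PT_if PT_fst PT_snd PT_not PT_id)
  then show "PT (\<lambda>p :: bool \<times> bool. fst p = snd p)"
    by (rule PT_ext) auto
qed

instance prod :: (eq_codable, eq_codable) eq_codable
proof (standard, rule eq_computableI)
  have "PT (\<lambda>p :: ('a \<times> 'b) \<times> ('a \<times> 'b). fst (fst p) = fst (snd p) \<and> snd (fst p) = snd (snd p))"
    by (intro PT_conj PT_eq PT_fst PT_snd PT_id)
  then show "PT (\<lambda>p :: ('a \<times> 'b) \<times> ('a \<times> 'b). fst p = snd p)"
    by (rule PT_ext) (auto simp: prod_eq_iff)
qed

lemma PT_drop_length:
  assumes "PT f" "PT g"
  shows "PT (\<lambda>x. drop (length (f x)) (g x))"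
proof -
  have h: "fold (\<lambda>_. tl) xs ys = drop (length xs) ys" for xs :: "'b list" and ys :: "'c list"
    by (induction xs arbitrary: ys) (auto simp: drop_Suc)
  have "PT (\<lambda>x. fold (\<lambda>_. tl) (f x) (g x))"
    by (rule PT_fold[where B = "\<lambda>x. sz (g x)"])
       (auto simp: h sz_drop intro!: PT_tl PT_snd PT_id assms pb_intros)
  then show ?thesis by (simp add: h)
qed

lemma PT_length_eq: "PT f \<Longrightarrow> PT g \<Longrightarrow> PT (\<lambda>x. length (f x) = length (g x))"
proof -
  assume "PT f" "PT g"
  then have "PT (\<lambda>x. drop (length (f x)) (g x) = [] \<and> drop (length (g x)) (f x) = [])"
    by (intro PT_conj PT_eq_Nil PT_drop_length)
  then show ?thesis by (rule PT_ext) auto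
qed

instance list :: (eq_codable) eq_codable
proof (standard, rule eq_computableI)
  have "PT (\<lambda>p :: 'a list \<times> 'a list. length (fst p) = length (snd p) \<and>
      (\<forall>q\<in>set (zip (fst p) (snd p)). fst q = snd q))"
    by (intro PT_conj PT_length_eq PT_ball_list PT_zip PT_eq PT_fst PT_snd PT_id)
  then show "PT (\<lambda>p :: 'a list \<times> 'a list. fst p = snd p)"
    by (rule PT_ext) (auto simp: list_eq_iff_zip_eq)
qed

lemma PT_member: "PT f \<Longrightarrow> PT l \<Longrightarrow> PT (\<lambda>x. f x \<in> set (l x))" for f :: "'a::codable \<Rightarrow> 'b::eq_codable"
proof -
  assume f: "PT f" and l: "PT l"
  have "PT (\<lambda>x. \<exists>a\<in>set (l x). a = f x)"
    by (intro PT_bex_list PT_eq PT_snd PT_id l PT_comp[OF PT_fst[OF PT_id] f])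
  then show ?thesis by simp
qed

text \<open>A finite function is a table of constants, hard-wired as nested equality tests, so
  \<open>h\<close> itself may be arbitrary. The group multiplication enters the computation this
  way.\<close>

lemma PT_finite_fun:
  fixes f :: "'a::codable \<Rightarrow> 'b::eq_codable"
  assumes "finite F" "PT f"
  shows "PT (\<lambda>x. if f x \<in> F then h (f x) else c)"
  using assms(1)
proof induction
  case (insert u F)
  then have "PT (\<lambda>x. if f x = u then h u else if f x \<in> F then h (f x) else c)"
    by (intro PT_if[OF PT_eq[OF assms(2) PT_const] PT_const insert.IH])
  then show ?case by (rule PT_ext) auto
qed (simp add: PT_const)

section \<open>Binary arithmetic\<close>

fun val :: "bool list \<Rightarrow> nat" where
  "val [] = 0"
| "val (b # bs) = of_bool b + 2 * val bs"

lemma nat_bits_0 [simp]: "nat_bits 0 = []"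
  by (simp add: nat_bits.simps)

lemma nat_bits_double: "nat_bits (of_bool b + 2 * n) = (if \<not> b \<and> n = 0 then [] else b # nat_bits n)"
  by (subst nat_bits.simps) auto

lemma val_nat_bits [simp]: "val (nat_bits n) = n"
proof (induction n rule: nat_bits.induct)
  case (1 n)
  then show ?case
    by (subst nat_bits.simps) (auto simp: mod_2_eq_odd[symmetric] simp flip: of_bool_odd_eq_mod_2)
qed

text \<open>Bits are stored least significant first; cutting the zeros at the far end restores the
  canonical form, so that equal numbers have equal codes.\<close>

definition strip :: "bool list \<Rightarrow> bool list" where
  "strip bs = fold (\<lambda>b r. if \<not> b \<and> r = [] then [] else b # r) (rev bs) []"

lemma strip_Cons: "strip (b # bs) = (if \<not> b \<and> strip bs = [] then [] else b # strip bs)"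
  by (simp add: strip_def)

lemma nat_bits_eq_Nil: "nat_bits n = [] \<longleftrightarrow> n = 0"
  by (subst nat_bits.simps) simp

lemma nat_bits_val: "nat_bits (val bs) = strip bs"
  by (induction bs) (simp_all add: nat_bits_double strip_Cons nat_bits_eq_Nil[symmetric] strip_def[of "[]"])

lemma inj_nat_bits: "inj nat_bits"
  by (metis injI val_nat_bits)

text \<open>Binary coding: the size of a number is logarithmic, so weights of exponential magnitude
  are still small data.\<close>

instantiation nat :: codable begin
definition "tr n = tr (nat_bits n)"
instance ..
end

lemma PT_nat_bits: "PT f \<Longrightarrow> PT (\<lambda>x. nat_bits (f x))"
  by (rule PT_comp[where g = nat_bits], assumption, rule PT_same_code) (simp add: tr_nat_def)

instance nat :: eq_codable
proof (standard, rule eq_computableI)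
  have "PT (\<lambda>p :: nat \<times> nat. nat_bits (fst p) = nat_bits (snd p))"
    by (intro PT_eq PT_nat_bits PT_fst PT_snd PT_id)
  then show "PT (\<lambda>p :: nat \<times> nat. fst p = snd p)"
    by (simp add: inj_eq[OF inj_nat_bits])
qed

lemma sz_nat: "sz n = sz (nat_bits n)" for n :: nat
  by (simp add: sz_def tr_nat_def)

lemma sz_strip: "sz (strip bs) \<le> sz bs"
proof (induction bs)
  case Nil
  show ?case by (simp add: strip_def)
next
  case (Cons b bs)
  then show ?case by (simp add: strip_Cons sz_Cons sz_Nil)
qed

lemma PT_strip: "PT f \<Longrightarrow> PT (\<lambda>x. strip (f x))"
proof -
  assume f: "PT f"
  show ?thesis
    unfolding strip_def
  proof (rule PT_fold[where B = "\<lambda>x. sz (f x)"])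
    fix x k
    show "sz (fold (\<lambda>b r. if \<not> b \<and> r = [] then [] else b # r) (take k (rev (f x))) []) \<le> sz (f x)"
      using sz_strip[of "rev (take k (rev (f x)))"] sz_take[of k "rev (f x)"]
      by (simp add: strip_def sz_rev)
  qed (intro PT_if PT_conj PT_not PT_eq_Nil PT_Cons PT_rev PT_fst PT_snd PT_id PT_const pb_intros f)+
qed

text \<open>The code of \<open>val bs\<close> is that of its canonical digits
  \<open>strip bs\<close>, so a program for \<open>strip\<close> already is one for
  \<open>val\<close>.\<close>

lemma PT_val: "PT f \<Longrightarrow> PT (\<lambda>x. val (f x))"
proof -
  assume f: "PT f"
  obtain c p where c: "computes c p (\<lambda>x. strip (f x))" by (rule PT_E[OF PT_strip[OF f]])
  show ?thesis
    by (rule PT_I[where c = c and p = p])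
       (use computesD[OF c] in \<open>auto simp: tr_nat_def nat_bits_val\<close>)
qed

lemma sz_nat_le: "n < 2 ^ k \<Longrightarrow> sz n \<le> 4 * k + 1" for n :: nat
proof -
  have "n < 2 ^ k \<Longrightarrow> length (nat_bits n) \<le> k"
  proof (induction k arbitrary: n)
    case (Suc k)
    then have "length (nat_bits (n div 2)) \<le> k" by simp
    then show ?case by (subst nat_bits.simps) simp
  qed simp
  then show "n < 2 ^ k \<Longrightarrow> sz n \<le> 4 * k + 1"
    using sz_bits[of "nat_bits n"] by (simp add: sz_nat)
qed

lemma val_less: "val bs < 2 ^ length bs"
  by (induction bs) auto

lemma less_2_sz: "n < 2 ^ sz n" for n :: nat
proof -
  have "n < 2 ^ length (nat_bits n)" using val_less[of "nat_bits n"] by simp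
  also have "\<dots> \<le> 2 ^ sz n" using length_less_sz[of "nat_bits n"] by (simp add: sz_nat)
  finally show ?thesis .
qed

text \<open>One column of written addition; the state consists of the two unread numbers, the carry
  and the sum digits in reverse. \<open>(x = y) = c\<close> is the parity of the three bits, and an
  exhausted number supplies zeros.\<close>

definition full_add :: "bool list \<times> bool list \<times> bool \<times> bool list \<Rightarrow> bool list \<times> bool list \<times> bool \<times> bool list" where
  "full_add p = (let x = (fst p \<noteq> [] \<and> hd (fst p)); y = (fst (snd p) \<noteq> [] \<and> hd (fst (snd p)));
     c = fst (snd (snd p)) in
     (tl (fst p), tl (fst (snd p)), (if c then x \<or> y else x \<and> y), ((x = y) = c) # snd (snd (snd p))))"

lemma val_rev_Cons: "val (rev (b # bs)) = val (rev bs) + 2 ^ length bs * of_bool b"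
proof -
  have "val (xs @ [b]) = val xs + 2 ^ length xs * of_bool b" for xs
    by (induction xs) (auto simp: algebra_simps)
  from this[of "rev bs"] show ?thesis by simp
qed

text \<open>Nothing is lost: the digits produced, plus \<open>2 ^ k\<close> times the unread parts
  and the carry, always total the sum.\<close>

lemma full_add_invariant:
  assumes "(full_add ^^ k) (xs, ys, False, []) = (xs', ys', c, acc)"
  shows "val (rev acc) + 2 ^ k * (val xs' + val ys' + of_bool c) = val xs + val ys
    \<and> length acc = k \<and> xs' = drop k xs \<and> ys' = drop k ys"
  using assms
proof (induction k arbitrary: xs' ys' c acc)
  case (Suc k)
  obtain xs1 ys1 c1 acc1 where 1: "(full_add ^^ k) (xs, ys, False, []) = (xs1, ys1, c1, acc1)"
    using prod_cases4 by blast
  have v: "val zs = of_bool (zs \<noteq> [] \<and> hd zs) + 2 * val (tl zs)" for zs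
    by (cases zs) auto
  from Suc.IH[OF 1] have IH: "val (rev acc1) + 2 ^ k * (val xs1 + val ys1 + of_bool c1) = val xs + val ys"
    "length acc1 = k" "xs1 = drop k xs" "ys1 = drop k ys" by blast+
  define x y where "x = (xs1 \<noteq> [] \<and> hd xs1)" and "y = (ys1 \<noteq> [] \<and> hd ys1)"
  have step: "full_add (xs1, ys1, c1, acc1) = (xs', ys', c, acc)"
    using Suc.prems 1 by simp
  have eq: "xs' = tl xs1" "ys' = tl ys1" "c = (if c1 then x \<or> y else x \<and> y)" "acc = ((x = y) = c1) # acc1"
    using step unfolding full_add_def Let_def fst_conv snd_conv prod.inject x_def y_def by blast+
  have bit: "of_bool ((x = y) = c1) + 2 * of_bool c = (of_bool x + of_bool y + of_bool c1 :: nat)"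
    unfolding eq by (cases x; cases y; cases c1) simp_all
  have "val xs1 + val ys1 + of_bool c1 = of_bool x + of_bool y + of_bool c1 + 2 * (val xs' + val ys')"
    using v[of xs1] v[of ys1] by (simp add: x_def y_def eq)
  also have "\<dots> = of_bool ((x = y) = c1) + 2 * (val xs' + val ys' + of_bool c)"
    unfolding bit[symmetric] by simp
  finally have "2 ^ k * (val xs1 + val ys1 + of_bool c1) =
      2 ^ k * of_bool ((x = y) = c1) + 2 ^ Suc k * (val xs' + val ys' + of_bool c)"
    by (simp add: algebra_simps)
  then have "val (rev acc) + 2 ^ Suc k * (val xs' + val ys' + of_bool c) = val xs + val ys"
    unfolding IH(1)[symmetric] unfolding eq(4) val_rev_Cons IH(2) by linarith
  moreover have "xs' = drop (Suc k) xs" "ys' = drop (Suc k) ys" "length acc = Suc k"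
    using IH(2-4) eq(1,2,4) by (simp_all add: drop_Suc tl_drop)
  ultimately show ?case by blast
qed simp

lemma PT_add:
  fixes f g :: "'a::codable \<Rightarrow> nat"
  assumes "PT f" "PT g"
  shows "PT (\<lambda>x. f x + g x)"
proof -
  \<comment> \<open>A round counter. With \<open>n\<close> entries both summands are below
    \<open>2 ^ (n - 1)\<close>, which leaves a round for the final carry.\<close>
  let ?l = "\<lambda>x. True # nat_bits (f x) @ nat_bits (g x)"
  let ?r = "\<lambda>x k. (full_add ^^ k) (nat_bits (f x), nat_bits (g x), False, [])"
  have "PT full_add"
    unfolding full_add_def Let_def
    by (intro PT_Pair PT_Cons PT_if PT_conj PT_disj PT_not_Nil PT_hd PT_tl PT_eq PT_fst PT_snd PT_id)
  then have "PT (\<lambda>x. ?r x (length (?l x)))"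
  proof (rule PT_funpow_simple[where B = "\<lambda>x. 3 + sz (nat_bits (f x)) + sz (nat_bits (g x)) + 3 + (4 * length (?l x) + 1)"])
    fix x k assume k: "k \<le> length (?l x)"
    obtain xs' ys' c acc where r: "?r x k = (xs', ys', c, acc)"
      using prod_cases4 by blast
    have "length acc = k" "xs' = drop k (nat_bits (f x))" "ys' = drop k (nat_bits (g x))"
      using full_add_invariant[OF r] by auto
    moreover have "sz acc \<le> 4 * length (?l x) + 1"
      using sz_bits[of acc] k \<open>length acc = k\<close> by linarith
    ultimately show "sz (?r x k) \<le> 3 + sz (nat_bits (f x)) + sz (nat_bits (g x)) + 3 + (4 * length (?l x) + 1)"
      unfolding r using sz_drop[of k "nat_bits (f x)"] sz_drop[of k "nat_bits (g x)"] sz_bool[of c]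
      by (simp add: sz_pair)
  qed (intro PT_Cons PT_append PT_Pair PT_nat_bits PT_const pb_intros assms)+
  then have "PT (\<lambda>x. val (rev (snd (snd (snd (?r x (length (?l x))))))))"
    by (intro PT_val PT_rev PT_snd)
  then show ?thesis
  proof (rule PT_ext)
    fix x
    let ?n = "length (?l x)"
    obtain xs' ys' c acc where r: "?r x ?n = (xs', ys', c, acc)"
      using prod_cases4 by blast
    have inv: "val (rev acc) + 2 ^ ?n * (val xs' + val ys' + of_bool c) = f x + g x"
      using full_add_invariant[OF r] unfolding val_nat_bits by blast
    have "f x < 2 ^ (?n - 1)" "g x < 2 ^ (?n - 1)"
      using val_less[of "nat_bits (f x)"] val_less[of "nat_bits (g x)"]
      by (auto elim!: less_le_trans)
    then have "f x + g x < 2 ^ ?n" by simp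
    \<comment> \<open>Otherwise the pending part alone, weighted by \<open>2 ^ ?n\<close>, would
      exceed the sum.\<close>
    then have "val xs' + val ys' + of_bool c = 0"
      using inv by (cases "val xs' + val ys' + of_bool c") auto
    then show "val (rev (snd (snd (snd (?r x ?n))))) = f x + g x"
      unfolding r using inv by simp
  qed
qed

text \<open>Horner's scheme, most significant bit first. The intermediate values multiply a
  truncation of \<open>f x\<close> by \<open>g x\<close> and so never exceed the product, whose size
  is linear in those of the factors.\<close>

lemma PT_mult:
  fixes f g :: "'a::codable \<Rightarrow> nat"
  assumes "PT f" "PT g"
  shows "PT (\<lambda>x. f x * g x)"
proof -
  have h: "fold (\<lambda>b acc. acc + acc + (if b then m else 0)) (rev bs) 0 = val bs * m" for bs and m :: nat
    by (induction bs) (auto simp: algebra_simps)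
  have 1: "PT (\<lambda>p :: 'a \<times> bool \<times> nat. g (fst p))"
    by (rule PT_comp[OF PT_fst[OF PT_id] assms(2)])
  have "PT (\<lambda>x. fold (\<lambda>b acc. acc + acc + (if b then g x else 0)) (rev (nat_bits (f x))) 0)"
  proof (rule PT_fold[where B = "\<lambda>x. 4 * (sz (f x) + sz (g x)) + 1"])
    fix x k assume "k \<le> length (rev (nat_bits (f x)))"
    let ?bs = "drop (length (nat_bits (f x)) - k) (nat_bits (f x))"
    have v: "fold (\<lambda>b acc. acc + acc + (if b then g x else 0)) (take k (rev (nat_bits (f x)))) 0 = val ?bs * g x"
      unfolding take_rev by (rule h)
    have "val (drop j bs) \<le> val bs" for j bs
    proof (induction bs arbitrary: j)
      case (Cons b bs)
      from Cons[of "j - 1"] show ?case by (cases j) auto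
    qed simp
    from this[of _ "nat_bits (f x)"] have "val ?bs * g x \<le> f x * g x" by simp
    also have "f x * g x < 2 ^ sz (f x) * 2 ^ sz (g x)"
      by (intro mult_strict_mono less_2_sz) auto
    finally have "val ?bs * g x < 2 ^ (sz (f x) + sz (g x))" by (simp only: power_add)
    then show "sz (fold (\<lambda>b acc. acc + acc + (if b then g x else 0)) (take k (rev (nat_bits (f x)))) 0)
        \<le> 4 * (sz (f x) + sz (g x)) + 1"
      unfolding v by (rule sz_nat_le)
  qed (intro PT_add PT_if 1 PT_rev PT_nat_bits PT_fst PT_snd PT_id PT_const pb_intros assms)+
  then show ?thesis by (simp add: h)
qed

lemma PT_sum_list:
  fixes f :: "'a::codable \<Rightarrow> nat list"
  assumes "PT f"
  shows "PT (\<lambda>x. sum_list (f x))"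
proof -
  have h: "fold (\<lambda>a s. s + a) xs s = s + sum_list xs" for xs and s :: nat
    by (induction xs arbitrary: s) auto
  have b: "sum_list xs < 2 ^ sz xs" for xs :: "nat list"
  proof (induction xs)
    case (Cons a xs)
    have "a + sum_list xs < 2 ^ sz a + 2 ^ sz xs" by (intro add_strict_mono Cons less_2_sz)
    also have "\<dots> \<le> 2 ^ (sz a + sz xs) + 2 ^ (sz a + sz xs)" by (intro add_mono power_increasing) auto
    finally show ?case by (simp add: sz_Cons)
  qed simp
  have "PT (\<lambda>x. fold (\<lambda>a s. s + a) (f x) 0)"
  proof (rule PT_fold[where B = "\<lambda>x. 4 * sz (f x) + 1"])
    fix x k
    have "sum_list (take k (f x)) < 2 ^ sz (f x)"
      using b[of "take k (f x)"] sz_take[of k "f x"] by (meson less_le_trans one_le_numeral power_increasing)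
    then show "sz (fold (\<lambda>a s. s + a) (take k (f x)) 0) \<le> 4 * sz (f x) + 1"
      unfolding h by (simp only: add_0 sz_nat_le)
  qed (intro PT_add PT_fst PT_snd PT_id PT_const pb_intros assms)+
  then show ?thesis by (simp add: h)
qed

text \<open>After padding to equal length, a scan from the least significant bit lets the last
  difference decide; the initial \<open>True\<close> is the answer for equal numbers.\<close>

lemma PT_le:
  fixes f g :: "'a::codable \<Rightarrow> nat"
  assumes "PT f" "PT g"
  shows "PT (\<lambda>x. f x \<le> g x)"
proof -
  define pad where "pad xs ys = xs @ map (\<lambda>_. False) ys" for xs ys :: "bool list"
  have v: "val (pad xs ys) = val xs" for xs ys
  proof (induction xs)
    case Nil
    show ?case by (induction ys) (auto simp: pad_def)
  qed (auto simp: pad_def)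
  have h: "fold (\<lambda>p r. if fst p = snd p then r else snd p) (zip xs ys) r =
      (if val xs = val ys then r else val xs < val ys)" if "length xs = length ys" for xs ys r
    using that
  proof (induction xs ys arbitrary: r rule: list_induct2)
    case (Cons x xs y ys)
    show ?case by (cases x; cases y) (simp_all add: Cons.IH, presburger+)
  qed simp
  have "PT (\<lambda>x. fold (\<lambda>p r. if fst p = snd p then r else snd p)
      (zip (pad (nat_bits (f x)) (nat_bits (g x))) (pad (nat_bits (g x)) (nat_bits (f x)))) True)"
    unfolding pad_def
    by (rule PT_fold[where B = "\<lambda>_. 3", OF _ _ _ _ sz_bool])
       (intro PT_if PT_eq PT_zip PT_append PT_map PT_nat_bits PT_fst PT_snd PT_id PT_const pb_intros assms)+
  moreover have "length (pad xs ys) = length (pad ys xs)" for xs ys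
    by (simp add: pad_def)
  ultimately show ?thesis
    by (elim PT_ext) (simp add: h v, linarith)
qed

section \<open>Encoding and parsing\<close>

lemma PT_enc_list:
  assumes "PT (\<lambda>p. e (fst p) (snd p))" "PT l"
  shows "PT (\<lambda>x. enc_list (e x) (l x))"
  unfolding enc_list_def by (intro PT_append PT_concat PT_map PT_Cons PT_const assms)

lemma PT_enc_nat: "PT f \<Longrightarrow> PT (\<lambda>x. enc_nat (f x))"
  unfolding enc_nat_def by (intro PT_enc_list PT_nat_bits PT_Cons PT_snd PT_id PT_const)

text \<open>The linear potential keeps the total output small when a parser is applied repeatedly.\<close>

definition parser :: "(bool list \<Rightarrow> 'a::codable \<times> bool list) \<Rightarrow> bool" where
  "parser p \<longleftrightarrow> PT p \<and> (\<exists>K. \<forall>r. length (snd (p r)) \<le> length r \<and>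
     sz (fst (p r)) + K * length (snd (p r)) \<le> K * length r + K)"

definition parses :: "('a \<Rightarrow> bool list) \<Rightarrow> (bool list \<Rightarrow> 'a \<times> bool list) \<Rightarrow> bool" where
  "parses e p \<longleftrightarrow> (\<forall>x z. p (e x @ z) = (x, z))"

definition parse_step :: "(bool list \<Rightarrow> 'a \<times> bool list) \<Rightarrow> 'a list \<times> bool list \<Rightarrow> 'a list \<times> bool list" where
  "parse_step p s = (if snd s \<noteq> [] \<and> hd (snd s) then (fst (p (tl (snd s))) # fst s, snd (p (tl (snd s)))) else s)"

text \<open>Each element uses up at least its marker bit, so \<open>length r\<close> rounds suffice;
  surplus rounds idle at the end marker, which \<open>tl\<close> removes.\<close>

definition parse_list :: "(bool list \<Rightarrow> 'a \<times> bool list) \<Rightarrow> bool list \<Rightarrow> 'a list \<times> bool list" where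
  "parse_list p r = (let s = (parse_step p ^^ length r) ([], r) in (rev (fst s), tl (snd s)))"

lemma parses_list:
  assumes "parses e p"
  shows "parses (enc_list e) (parse_list p)"
  unfolding parses_def
proof (intro allI)
  fix xs z
  have c: "enc_list e (x # xs) = True # e x @ enc_list e xs" for x xs
    by (simp add: enc_list_def)
  have len: "length xs \<le> length (enc_list e xs @ z)"
    by (induction xs) (auto simp: c enc_list_def)
  have stop: "(parse_step p ^^ k) (as, False # z) = (as, False # z)" for k as
    by (induction k) (auto simp: parse_step_def)
  have "length xs \<le> k \<Longrightarrow> (parse_step p ^^ k) (as, enc_list e xs @ z) = (rev xs @ as, False # z)" for k as
  proof (induction xs arbitrary: k as)
    case Nil
    then show ?case using stop by (simp add: enc_list_def)
  next
    case (Cons x xs)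
    obtain j where k: "k = Suc j" using Cons.prems by (cases k) auto
    have "parse_step p (as, enc_list e (x # xs) @ z) = (x # as, enc_list e xs @ z)"
      using assms by (simp add: parse_step_def c parses_def)
    then show ?case using Cons.IH[of j "x # as"] Cons.prems
      by (simp add: k funpow_Suc_right del: funpow.simps)
  qed
  from this[OF len] show "parse_list p (enc_list e xs @ z) = (xs, z)"
    by (simp add: parse_list_def)
qed

lemma parser_list:
  assumes "parser p"
  shows "parser (parse_list p)"
proof -
  obtain K where p: "PT p" and K: "\<And>r. length (snd (p r)) \<le> length r"
    "\<And>r. sz (fst (p r)) + K * length (snd (p r)) \<le> K * length r + K"
    using assms unfolding parser_def by blast
  \<comment> \<open>Every round consumes a marker bit, worth \<open>K + 1\<close> units of
    potential: \<open>K\<close> units pay for the slack of \<open>p\<close> and one for the new cons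
    cell.\<close>
  have inv: "length (snd ((parse_step p ^^ k) ([], r))) \<le> length r \<and>
    sz (fst ((parse_step p ^^ k) ([], r))) + (K + 1) * length (snd ((parse_step p ^^ k) ([], r))) \<le> 1 + (K + 1) * length r"
    for k r
  proof (induction k)
    case (Suc k)
    obtain as t where 1: "(parse_step p ^^ k) ([], r) = (as, t)" by fastforce
    show ?case
    proof (cases "t \<noteq> [] \<and> hd t")
      case True
      then obtain b t' where t: "t = b # t'" by (cases t) auto
      have "length (snd (p t')) \<le> length t'" "sz (fst (p t')) + K * length (snd (p t')) \<le> K * length t' + K"
        using K by auto
      moreover have "(parse_step p ^^ Suc k) ([], r) = (fst (p t') # as, snd (p t'))"
        using True by (simp only: funpow.simps o_apply 1) (simp add: parse_step_def t)
      ultimately show ?thesis using Suc unfolding 1 by (simp add: t sz_Cons del: funpow.simps)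
    next
      case False
      then have "(parse_step p ^^ Suc k) ([], r) = (as, t)"
        by (simp only: funpow.simps o_apply 1) (simp add: parse_step_def)
      with Suc show ?thesis by (simp add: 1 del: funpow.simps)
    qed
  qed (simp add: sz_Nil)
  have "PT (parse_step p)"
    unfolding parse_step_def
    by (intro PT_if PT_Pair PT_Cons PT_conj PT_not_Nil PT_hd PT_tl PT_fst PT_snd PT_id
        PT_comp[OF PT_tl[OF PT_snd[OF PT_id]] p])
  then have "PT (\<lambda>r. (parse_step p ^^ length r) ([], r))"
  proof (rule PT_funpow_simple[where B = "\<lambda>r. 1 + (1 + (K + 1) * length r) + (4 * length r + 1)"])
    fix r k
    show "sz ((parse_step p ^^ k) ([], r)) \<le> 1 + (1 + (K + 1) * length r) + (4 * length r + 1)"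
      using inv[of k r] sz_bits[of "snd ((parse_step p ^^ k) ([], r))"]
      by (cases "(parse_step p ^^ k) ([], r)") (simp add: sz_pair)
  qed (intro PT_Pair PT_const PT_id pb_intros)+
  then have "PT (parse_list p)"
    unfolding parse_list_def Let_def by (intro PT_Pair PT_rev PT_tl PT_fst PT_snd)
  moreover have "length (snd (parse_list p r)) \<le> length r \<and>
     sz (fst (parse_list p r)) + (K + 1) * length (snd (parse_list p r)) \<le> (K + 1) * length r + (K + 1)" for r
  proof -
    obtain as t where 1: "(parse_step p ^^ length r) ([], r) = (as, t)" by fastforce
    have "(K + 1) * length (tl t) \<le> (K + 1) * length t" by (intro mult_left_mono) auto
    with inv[of "length r" r] show ?thesis
      unfolding parse_list_def Let_def 1 by (auto simp: sz_rev)
  qed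
  ultimately show ?thesis unfolding parser_def by blast
qed

definition parse_pair where
  "parse_pair p q r = (let s = p r; t = q (snd s) in ((fst s, fst t), snd t))"

lemma parses_pair:
  "parses e p \<Longrightarrow> parses d q \<Longrightarrow> parses (\<lambda>x. e (fst x) @ d (snd x)) (parse_pair p q)"
  unfolding parses_def parse_pair_def by simp

lemma parser_pair:
  assumes "parser p" "parser q"
  shows "parser (parse_pair p q)"
proof -
  obtain K where p: "PT p" and K: "\<And>r. length (snd (p r)) \<le> length r"
    "\<And>r. sz (fst (p r)) + K * length (snd (p r)) \<le> K * length r + K"
    using assms unfolding parser_def by blast
  obtain L where q: "PT q" and L: "\<And>r. length (snd (q r)) \<le> length r"
    "\<And>r. sz (fst (q r)) + L * length (snd (q r)) \<le> L * length r + L"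
    using assms unfolding parser_def by blast
  have "PT (parse_pair p q)"
    unfolding parse_pair_def Let_def
    by (intro PT_Pair PT_fst PT_snd p PT_comp[OF PT_snd[OF p] q])
  \<comment> \<open>The slack consists of those of both parsers and one unit for the pair
    node.\<close>
  moreover have "length (snd (parse_pair p q r)) \<le> length r \<and>
     sz (fst (parse_pair p q r)) + (K + L + 1) * length (snd (parse_pair p q r)) \<le> (K + L + 1) * length r + (K + L + 1)" for r
  proof -
    define a b where "a = length (snd (p r))" and "b = length (snd (q (snd (p r))))"
    have "b \<le> a" "a \<le> length r" using K L by (auto simp: a_def b_def)
    then have "K * b \<le> K * a" "L * a \<le> L * length r" by auto
    with \<open>b \<le> a\<close> \<open>a \<le> length r\<close> K(2)[of r] L(2)[of "snd (p r)"] show ?thesis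
      unfolding parse_pair_def Let_def a_def b_def fst_conv snd_conv sz_pair add_mult_distrib by linarith
  qed
  ultimately show ?thesis unfolding parser_def by blast
qed

definition parse_bit :: "bool list \<Rightarrow> bool \<times> bool list" where
  "parse_bit r = (hd r, tl r)"

definition parse_nat :: "bool list \<Rightarrow> nat \<times> bool list" where
  "parse_nat r = (let s = parse_list parse_bit r in (val (fst s), snd s))"

lemma parses_nat: "parses enc_nat parse_nat"
proof -
  have "parses (\<lambda>b. [b]) parse_bit" by (simp add: parses_def parse_bit_def)
  from parses_list[OF this] show ?thesis
    unfolding parses_def parse_nat_def enc_nat_def by simp
qed

lemma parser_nat: "parser parse_nat"
proof -
  have "PT parse_bit" unfolding parse_bit_def by (intro PT_Pair PT_hd PT_tl PT_id)
  then have "parser parse_bit"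
    unfolding parser_def
  proof (intro conjI exI[of _ 3] allI)
    fix r
    show "sz (fst (parse_bit r)) + 3 * length (snd (parse_bit r)) \<le> 3 * length r + 3"
      using sz_bool[of "hd r"] by (simp add: parse_bit_def)
  qed (simp_all add: parse_bit_def)
  then have "parser (parse_list parse_bit)" by (rule parser_list)
  then obtain K where p: "PT (parse_list parse_bit)" and
    K: "\<And>r. length (snd (parse_list parse_bit r)) \<le> length r \<and>
    sz (fst (parse_list parse_bit r)) + K * length (snd (parse_list parse_bit r)) \<le> K * length r + K"
    unfolding parser_def by blast
  have "PT parse_nat" unfolding parse_nat_def Let_def by (intro PT_Pair PT_val PT_fst PT_snd p)
  moreover have "sz (val bs) \<le> sz bs" for bs
    using sz_strip by (simp add: sz_nat nat_bits_val)
  ultimately show ?thesis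
    unfolding parser_def parse_nat_def Let_def fst_conv snd_conv
    using K by (meson add_le_mono1 order_trans)
qed

text \<open>\<open>PT\<close> knows functions of one argument only. This rule and the next two turn
  a result about nested pairs into a substitution rule for several arguments.\<close>

lemma PT_app2: "PT (\<lambda>p. F (fst p) (snd p)) \<Longrightarrow> PT f \<Longrightarrow> PT g \<Longrightarrow> PT (\<lambda>x. F (f x) (g x))"
  using PT_comp[OF PT_Pair, of f g "\<lambda>p. F (fst p) (snd p)"] by simp

lemma PT_app3: "PT (\<lambda>p. F (fst p) (fst (snd p)) (snd (snd p))) \<Longrightarrow> PT f \<Longrightarrow> PT g \<Longrightarrow> PT h \<Longrightarrow>
    PT (\<lambda>x. F (f x) (g x) (h x))"
  using PT_comp[OF PT_Pair[OF _ PT_Pair], of f g h "\<lambda>p. F (fst p) (fst (snd p)) (snd (snd p))"] by simp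

lemma PT_app5: "PT (\<lambda>p. F (fst p) (fst (snd p)) (fst (snd (snd p))) (fst (snd (snd (snd p)))) (snd (snd (snd (snd p))))) \<Longrightarrow>
    PT f \<Longrightarrow> PT g \<Longrightarrow> PT h \<Longrightarrow> PT i \<Longrightarrow> PT j \<Longrightarrow> PT (\<lambda>x. F (f x) (g x) (h x) (i x) (j x))"
  using PT_comp[OF PT_Pair[OF _ PT_Pair[OF _ PT_Pair[OF _ PT_Pair]]], of f g h i j
    "\<lambda>p. F (fst p) (fst (snd p)) (fst (snd (snd p))) (fst (snd (snd (snd p)))) (snd (snd (snd (snd p))))"] by simp

lemmas PT_basic = PT_Pair PT_fst PT_snd PT_Cons PT_hd PT_tl PT_if PT_not PT_conj PT_disj PT_not_Nil PT_eq_Nil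
  PT_case_list PT_rev PT_map PT_filter PT_append PT_concat PT_ball_list PT_bex_list PT_zip PT_member PT_eq
  PT_id PT_const

section \<open>The algorithm\<close>

text \<open>Assignments are value lists aligned with the variable list \<open>vs\<close>; the
  default 0 covers variables outside it.\<close>

definition look :: "nat list \<Rightarrow> nat list \<Rightarrow> nat \<Rightarrow> nat" where
  "look vs w v = (case filter (\<lambda>p. fst p = v) (zip vs w) of [] \<Rightarrow> 0 | p # _ \<Rightarrow> snd p)"

lemma PT_look: "PT f \<Longrightarrow> PT g \<Longrightarrow> PT h \<Longrightarrow> PT (\<lambda>x. look (f x) (g x) (h x))"
  by (rule PT_app3[where F = look]) (unfold look_def, intro PT_basic)

definition proj :: "nat list \<Rightarrow> nat list \<Rightarrow> nat list \<Rightarrow> nat list" where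
  "proj vs s w = map (look vs w) s"

lemma PT_proj: "PT f \<Longrightarrow> PT g \<Longrightarrow> PT h \<Longrightarrow> PT (\<lambda>x. proj (f x) (g x) (h x))"
  by (rule PT_app3[where F = proj]) (unfold proj_def, intro PT_basic PT_look)

text \<open>The first vector of \<open>L\<close> for each pattern that occurs. The patterns
  \<open>ks\<close> will be a fixed list, so the length of the result is bounded by a
  constant.\<close>

definition reps :: "nat list \<Rightarrow> nat list list \<Rightarrow> nat list \<Rightarrow> nat list list \<Rightarrow> nat list list" where
  "reps vs ks s L = concat (map (\<lambda>k. case filter (\<lambda>w. proj vs s w = k) L of [] \<Rightarrow> [] | w # _ \<Rightarrow> [w]) ks)"

lemma PT_reps: "PT f \<Longrightarrow> PT g \<Longrightarrow> PT h \<Longrightarrow> PT (\<lambda>x. reps (f x) ks (g x) (h x))"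
  by (rule PT_app3[where F = "\<lambda>f. reps f ks"]) (unfold reps_def, intro PT_basic PT_proj)

lemma length_reps: "length (reps vs ks s L) \<le> length ks"
  by (induction ks) (auto simp: reps_def split: list.splits)

lemma set_reps: "set (reps vs ks s L) \<subseteq> set L"
proof -
  have "w \<in> set L" if "w # ws = filter P L" for P w ws
    using that by (metis filter_is_subset list.set_intros(1) subsetD)
  then show ?thesis by (auto simp: reps_def split: list.splits)
qed

text \<open>A table lists, for every variable \<open>v\<close>, elements of a group of assignments that are trivial on
  the variables before \<open>v\<close>; the values at \<open>v\<close> of these elements exhaust what the group allows.\<close>

type_synonym table = "(nat \<times> nat list list) list"

locale group_alg = group G for G :: "nat monoid" (structure) +
  fixes A :: nat
  assumes fin: "finite (carrier G)"
begin

definition ds :: "nat list" where "ds = sorted_list_of_set (carrier G)"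

text \<open>All possible value patterns on a scope. The length goes up to \<open>Suc A\<close>
  because patterns of single variables are needed as well, even if \<open>A\<close> is 0.\<close>

definition keys :: "nat list list" where
  "keys = sorted_list_of_set {xs. set xs \<subseteq> carrier G \<and> length xs \<le> Suc A}"

text \<open>The guard makes this a finite function, so that \<open>PT_finite_fun\<close> applies;
  products outside the carrier collapse to 0.\<close>

definition gmul :: "nat \<Rightarrow> nat \<Rightarrow> nat" where
  "gmul x y = (if (x, y) \<in> carrier G \<times> carrier G then x \<otimes> y else 0)"

lemma PT_gmul: "PT f \<Longrightarrow> PT g \<Longrightarrow> PT (\<lambda>x. gmul (f x) (g x))"
  by (rule PT_ext[OF PT_finite_fun[OF _ PT_Pair, of "carrier G \<times> carrier G" f g "\<lambda>q. fst q \<otimes> snd q" 0]])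
     (simp_all add: gmul_def fin)

definition vmul :: "nat list \<Rightarrow> nat list \<Rightarrow> nat list" where
  "vmul a b = map (\<lambda>p. gmul (fst p) (snd p)) (zip a b)"

lemma PT_vmul: "PT f \<Longrightarrow> PT g \<Longrightarrow> PT (\<lambda>x. vmul (f x) (g x))"
  by (rule PT_app2[where F = vmul]) (unfold vmul_def, intro PT_basic PT_gmul)

definition ones :: "nat list \<Rightarrow> nat list" where
  "ones vs = map (\<lambda>_. \<one>) vs"

lemma PT_ones: "PT f \<Longrightarrow> PT (\<lambda>x. ones (f x))"
  unfolding ones_def by (intro PT_basic)

definition prods :: "nat list list \<Rightarrow> nat list list \<Rightarrow> nat list list" where
  "prods T W = concat (map (\<lambda>t. map (vmul t) W) T)"

lemma PT_prods: "PT f \<Longrightarrow> PT g \<Longrightarrow> PT (\<lambda>x. prods (f x) (g x))"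
  by (rule PT_app2[where F = prods]) (unfold prods_def, intro PT_basic PT_vmul)

lemma set_prods: "set (prods T W) = {vmul t w |t w. t \<in> set T \<and> w \<in> set W}"
  by (auto simp: prods_def)

text \<open>One level of the pass: the elements of the group up to their values on the scope \<open>s\<close>, and
  the new level of the table for the subgroup of those \<open>w\<close> with \<open>(w a)|s \<in> R\<close>.\<close>

definition pass_step where
  "pass_step vs s R a e z = (let C = prods (snd e) (fst z) in
     (reps vs keys s C, (fst e, reps vs keys [fst e] (filter (\<lambda>w. proj vs s (vmul w a) \<in> set R) C)) # snd z))"

definition pass :: "nat list \<Rightarrow> nat list \<Rightarrow> nat list list \<Rightarrow> nat list \<Rightarrow> table \<Rightarrow> nat list list \<times> table" where
  "pass vs s R a tab = fold (pass_step vs s R a) (rev tab) ([ones vs], [])"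

lemma pass_simps [simp]:
  "pass vs s R a [] = ([ones vs], [])"
  "pass vs s R a (e # tab) = pass_step vs s R a e (pass vs s R a tab)"
  by (simp_all add: pass_def)

text \<open>A size invariant that also copes with malformed data: \<open>zip\<close> cannot lengthen
  vectors, and \<open>gmul\<close> yields only group elements or 0.\<close>

definition vb :: "nat \<Rightarrow> nat list \<Rightarrow> bool" where
  "vb n a \<longleftrightarrow> length a \<le> n \<and> set a \<subseteq> insert 0 (carrier G)"

lemma vb_vmul: "vb n b \<Longrightarrow> vb n (vmul a b)"
  by (auto simp: vb_def vmul_def gmul_def)

lemma vb_vmul_right: "vb (length b) (vmul a b)"
  by (auto simp: vb_def vmul_def gmul_def)

lemma vb_ones: "vb (length vs) (ones vs)"
  by (auto simp: vb_def ones_def)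

lemma vb_size: obtains M where "\<And>n a. vb n a \<Longrightarrow> sz a \<le> 1 + n * (M + 1)"
proof -
  have "finite (sz ` insert 0 (carrier G))" using fin by simp
  then obtain M where "\<And>d. d \<in> insert 0 (carrier G) \<Longrightarrow> sz d \<le> M"
    by (meson Max_ge imageI)
  then have "vb n a \<Longrightarrow> sz a \<le> 1 + n * (M + 1)" for n a
    unfolding vb_def by (intro sz_list_le) auto
  then show thesis by (rule that)
qed

text \<open>A level stems from \<open>reps\<close> or from \<open>init\<close>, with at most
  \<open>length keys\<close> or \<open>length ds\<close> entries; the additional one admits the
  singleton \<open>[ones vs]\<close>.\<close>

definition N :: nat where "N = Suc (length keys + length ds)"

definition sb :: "nat \<Rightarrow> nat list list \<Rightarrow> bool" where
  "sb n T \<longleftrightarrow> length T \<le> N \<and> (\<forall>t\<in>set T. vb n t)"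

definition tb :: "nat \<Rightarrow> table \<Rightarrow> bool" where
  "tb n tab \<longleftrightarrow> (\<forall>e\<in>set tab. sb n (snd e))"

text \<open>Truncation by \<open>reps\<close> restores the constant bound at every level, whatever
  the input table looks like. This prevents growth when passes are iterated.\<close>

lemma pass_bound:
  "sb (length vs) (fst (pass vs s R a tab)) \<and> tb (length vs) (snd (pass vs s R a tab)) \<and>
   map fst (snd (pass vs s R a tab)) = map fst tab"
proof (induction tab)
  case Nil
  show ?case using vb_ones by (simp add: sb_def tb_def N_def)
next
  case (Cons e tab)
  define W where "W = fst (pass vs s R a tab)"
  have C: "vb (length vs) w" if "w \<in> set (prods (snd e) W)" for w
    using that Cons vb_vmul by (auto simp: sb_def set_prods W_def)
  have r: "sb (length vs) (reps vs keys s' L)" if "set L \<subseteq> set (prods (snd e) W)" for s' L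
    using length_reps[of vs keys s' L] set_reps[of vs keys s' L] that C by (auto simp: sb_def N_def)
  show ?case
    using Cons r[of "prods (snd e) W"] r[OF filter_is_subset]
    by (auto simp: pass_step_def Let_def tb_def W_def)
qed

lemma sb_size: obtains S where "\<And>n T. sb n T \<Longrightarrow> sz T \<le> poly S n"
proof -
  obtain M where M: "\<And>n a. vb n a \<Longrightarrow> sz a \<le> 1 + n * (M + 1)" using vb_size by blast
  have "sz T \<le> poly [:1 + 2 * N, N * (M + 1):] n" if "sb n T" for n T
  proof -
    have "sz T \<le> 1 + N * (1 + n * (M + 1) + 1)"
      using that M by (auto simp: sb_def simp del: One_nat_def intro: sz_list_le[where B = "1 + n * (M + 1)"])
    then show ?thesis by (simp add: algebra_simps)
  qed
  then show thesis by (rule that)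
qed

lemma tb_size: obtains S :: "nat poly"
  where "\<And>n tab m. tb n tab \<Longrightarrow> length tab \<le> m \<Longrightarrow> (\<And>v. v \<in> set (map fst tab) \<Longrightarrow> sz v \<le> m) \<Longrightarrow> 
    sz tab \<le> 1 + m * (1 + m + poly S n + 1)"
proof -
  obtain S where S: "\<And>n T. sb n T \<Longrightarrow> sz T \<le> poly S n" using sb_size by blast
  have "sz tab \<le> 1 + m * (1 + m + poly S n + 1)"
    if "tb n tab" "length tab \<le> m" "\<And>v. v \<in> set (map fst tab) \<Longrightarrow> sz v \<le> m" for n tab m
  proof (rule sz_list_le)
    fix e assume "e \<in> set tab"
    with that S show "sz e \<le> 1 + m + poly S n"
      by (cases e) (fastforce simp: tb_def sz_pair intro: add_mono)
  qed (use that in simp)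
  then show thesis by (rule that)
qed

lemma PT_pass:
  assumes "PT f" "PT g" "PT h" "PT i" "PT j"
  shows "PT (\<lambda>x. pass (f x) (g x) (h x) (i x) (j x))"
proof (rule PT_app5[where F = pass, OF _ assms])
  obtain S where S: "\<And>n T. sb n T \<Longrightarrow> sz T \<le> poly S n" using sb_size by blast
  obtain S' :: "nat poly" where S': "\<And>n tab m. tb n tab \<Longrightarrow> length tab \<le> m \<Longrightarrow>
    (\<And>v. v \<in> set (map fst tab) \<Longrightarrow> sz v \<le> m) \<Longrightarrow> sz tab \<le> 1 + m * (1 + m + poly S' n + 1)"
    using tb_size by blast
  let ?vs = "\<lambda>p :: nat list \<times> nat list \<times> nat list list \<times> nat list \<times> table. fst p"
  let ?tab = "\<lambda>p :: nat list \<times> nat list \<times> nat list list \<times> nat list \<times> table. snd (snd (snd (snd p)))"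
  let ?B = "\<lambda>p. 1 + poly S (length (?vs p)) +
    (1 + sz (?tab p) * (1 + sz (?tab p) + poly S' (length (?vs p)) + 1))"
  show "PT (\<lambda>p. pass (?vs p) (fst (snd p)) (fst (snd (snd p))) (fst (snd (snd (snd p)))) (?tab p))"
    unfolding pass_def
  proof (rule PT_fold[where B = ?B])
    fix p :: "nat list \<times> nat list \<times> nat list list \<times> nat list \<times> table" and k
    let ?pass = "pass (?vs p) (fst (snd p)) (fst (snd (snd p))) (fst (snd (snd (snd p))))"
    define tab where "tab = drop (length (?tab p) - k) (?tab p)"
    have "sz (fst (?pass tab)) \<le> poly S (length (?vs p))"
      using pass_bound by (intro S) blast
    moreover have "sz (snd (?pass tab)) \<le> 1 + sz (?tab p) * (1 + sz (?tab p) + poly S' (length (?vs p)) + 1)"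
    proof (rule S')
      show "tb (length (?vs p)) (snd (?pass tab))" using pass_bound by blast
      have "map fst (snd (?pass tab)) = map fst tab" using pass_bound by blast
      moreover from this have "length (snd (?pass tab)) = length tab" by (metis length_map)
      ultimately show "length (snd (?pass tab)) \<le> sz (?tab p)"
        using length_less_sz[of "?tab p"] by (simp add: tab_def)
      fix v assume "v \<in> set (map fst (snd (?pass tab)))"
      then obtain T where "(v, T) \<in> set tab"
        unfolding \<open>map fst (snd (?pass tab)) = map fst tab\<close> by auto
      then have "(v, T) \<in> set (?tab p)" by (auto simp: tab_def dest: in_set_dropD)
      from sz_elem[OF this] show "sz v \<le> sz (?tab p)" by (simp add: sz_pair)
    qed
    ultimately have "sz (?pass tab) \<le> ?B p" by (cases "?pass tab") (simp add: sz_pair)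
    then show "sz (fold (pass_step (?vs p) (fst (snd p)) (fst (snd (snd p))) (fst (snd (snd (snd p)))))
      (take k (rev (?tab p))) ([ones (?vs p)], [])) \<le> ?B p"
      unfolding pass_def tab_def take_rev .
  next
    show "pb ?B" by (intro pb_intros pb_poly PT_basic)
  next
    show "PT (\<lambda>q. pass_step (?vs (fst q)) (fst (snd (fst q))) (fst (snd (snd (fst q))))
      (fst (snd (snd (snd (fst q))))) (fst (snd q)) (snd (snd q)))"
      unfolding pass_step_def Let_def by (intro PT_basic PT_reps PT_prods PT_proj PT_vmul)
  qed (intro PT_basic PT_ones)+
qed

text \<open>Base point and table of the full power of \<open>G\<close>: the vectors at level
  \<open>v\<close> take all values at \<open>v\<close> and are trivial elsewhere.\<close>

definition init :: "nat list \<Rightarrow> nat list \<times> table" where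
  "init vs = (ones vs, map (\<lambda>v. (v, map (\<lambda>d. map (\<lambda>u. if u = v then d else \<one>) vs) ds)) vs)"

lemma PT_init: "PT f \<Longrightarrow> PT (\<lambda>x. init (f x))"
  by (rule PT_comp[where g = init], assumption, unfold init_def, intro PT_basic PT_ones)

text \<open>The first pass looks for a group element that moves the base point into the constraint;
  the second computes the subgroup that belongs to the new base point. If there is no such element,
  the constraints are unsolvable and any output will do.\<close>

definition impose where
  "impose vs c z = (case filter (\<lambda>w. proj vs (fst c) (vmul w (fst z)) \<in> set (snd c))
      (fst (pass vs (fst c) (snd c) (fst z) (snd z))) of
     [] \<Rightarrow> z
   | w # _ \<Rightarrow> (vmul w (fst z), snd (pass vs (fst c) (snd c) (vmul w (fst z)) (snd z))))"

definition solve :: "nat list \<Rightarrow> (nat list \<times> nat list list) list \<Rightarrow> nat list \<times> table" where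
  "solve vs cs = fold (impose vs) cs (init vs)"

lemma PT_solve: "PT f \<Longrightarrow> PT g \<Longrightarrow> PT (\<lambda>x. solve (f x) (g x))"
proof (rule PT_app2[where F = solve])
  obtain M where M: "\<And>n a. vb n a \<Longrightarrow> sz a \<le> 1 + n * (M + 1)" using vb_size by blast
  obtain S :: "nat poly" where S: "\<And>n tab m. tb n tab \<Longrightarrow> length tab \<le> m \<Longrightarrow>
    (\<And>v. v \<in> set (map fst tab) \<Longrightarrow> sz v \<le> m) \<Longrightarrow> sz tab \<le> 1 + m * (1 + m + poly S n + 1)"
    using tb_size by blast
  let ?I = "\<lambda>p z. vb (length (fst p)) (fst z) \<and> tb (length (fst p)) (snd z) \<and> map fst (snd z) = fst p"
  let ?B = "\<lambda>p :: nat list \<times> (nat list \<times> nat list list) list. 1 + (1 + length (fst p) * (M + 1)) +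
    (1 + sz (fst p) * (1 + sz (fst p) + poly S (length (fst p)) + 1))"
  show "PT (\<lambda>p. solve (fst p) (snd p))"
    unfolding solve_def
  proof (rule PT_fold_inv[where I = ?I and B = ?B])
    show "PT (\<lambda>p :: (nat list \<times> (nat list \<times> nat list list) list) \<times> (nat list \<times> nat list list) \<times> nat list \<times> table.
        impose (fst (fst p)) (fst (snd p)) (snd (snd p)))"
      unfolding impose_def by (intro PT_basic PT_proj PT_vmul PT_pass)
    show "pb ?B" by (intro pb_intros pb_poly PT_basic)
  next
    fix p :: "nat list \<times> (nat list \<times> nat list list) list"
    have "sb (length (fst p)) (map (\<lambda>d. map (\<lambda>u. if u = v then d else \<one>) (fst p)) ds)" for v
      using fin by (auto simp: sb_def vb_def N_def ds_def)
    then show "?I p (init (fst p))"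
      using vb_ones by (auto simp: init_def tb_def comp_def)
  next
    fix p :: "nat list \<times> (nat list \<times> nat list list) list" and a z assume "?I p z"
    then show "?I p (impose (fst p) a z)"
      using pass_bound vb_vmul by (auto simp: impose_def split: list.splits)
  next
    fix p :: "nat list \<times> (nat list \<times> nat list list) list" and z assume I: "?I p z"
    then have "sz (fst z) \<le> 1 + length (fst p) * (M + 1)" by (intro M) simp
    moreover have "sz (snd z) \<le> 1 + sz (fst p) * (1 + sz (fst p) + poly S (length (fst p)) + 1)"
    proof (rule S)
      have "length (snd z) = length (fst p)" using I by (metis length_map)
      then show "length (snd z) \<le> sz (fst p)" using length_less_sz[of "fst p"] by simp
    qed (use I sz_elem[of _ "fst p"] in \<open>auto intro: less_imp_le\<close>)
    ultimately show "sz z \<le> ?B p" by (cases z) (simp add: sz_pair)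
  qed (intro PT_basic PT_init)+
qed

text \<open>If \<open>xs\<close> lists the values of a coset of a subgroup of \<open>G\<close>, this is \<open>|G|\<close> times their mean.\<close>

definition scaled_mean :: "nat list \<Rightarrow> nat" where
  "scaled_mean xs = (if xs \<in> {xs. set xs \<subseteq> carrier G \<and> length xs \<le> card (carrier G)}
     then sum_list xs * (card (carrier G) div length xs) else 0)"

lemma PT_scaled_mean: "PT f \<Longrightarrow> PT (\<lambda>x. scaled_mean (f x))"
  unfolding scaled_mean_def
  by (rule PT_finite_fun[OF finite_lists_length_le[OF fin]])

text \<open>This is \<open>card (carrier G)\<close> times the expected measure of a random element
  of the coset. By linearity only the values at single variables enter, and a pass with a
  one-element scope lists them.\<close>

definition estimate :: "(nat \<times> nat) list \<Rightarrow> table \<Rightarrow> nat list \<Rightarrow> nat" where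
  "estimate vw tab a = sum_list (map (\<lambda>p. snd p * scaled_mean
     (map (\<lambda>w. look (map fst vw) (vmul w a) (fst p)) (fst (pass (map fst vw) [fst p] [] a tab)))) vw)"

lemma PT_estimate: "PT f \<Longrightarrow> PT g \<Longrightarrow> PT h \<Longrightarrow> PT (\<lambda>x. estimate (f x) (g x) (h x))"
  by (rule PT_app3[where F = estimate])
     (unfold estimate_def, intro PT_basic PT_sum_list PT_mult PT_scaled_mean PT_look PT_vmul PT_pass)

section \<open>Conditional expectations along the table\<close>

definition improve where
  "improve vw tab t b = (if estimate vw tab b \<le> estimate vw tab t then t else b)"

text \<open>Conditioning on the variable of the first level: its vectors \<open>t\<close> move the
  base point through the possible values there, and \<open>rest\<close> describes the subgroup that
  leaves this value fixed.\<close>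

definition select_step where
  "select_step vw z = (case snd z of [] \<Rightarrow> z
     | e # rest \<Rightarrow> (fold (\<lambda>t. improve vw rest (vmul t (fst z))) (snd e) (fst z), rest))"

lemma best_cases: "fold (\<lambda>t. improve vw rest (vmul t a)) T b \<in> insert b {vmul t a |t. t \<in> set T}"
proof (induction T arbitrary: b)
  case (Cons t T)
  from Cons[of "improve vw rest (vmul t a) b"] show ?case by (auto simp: improve_def split: if_splits)
qed simp

lemma PT_select_step: "PT f \<Longrightarrow> PT g \<Longrightarrow> PT (\<lambda>x. select_step (f x) (g x))"
proof (rule PT_app2[where F = select_step])
  obtain M where M: "\<And>n a. vb n a \<Longrightarrow> sz a \<le> 1 + n * (M + 1)" using vb_size by blast
  let ?a = "\<lambda>x :: ((nat \<times> nat) list \<times> nat list \<times> table) \<times> (nat \<times> nat list list) \<times> table. fst (snd (fst x))"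
  have "PT (\<lambda>x. fold (\<lambda>t. improve (fst (fst x)) (snd (snd x)) (vmul t (?a x))) (snd (fst (snd x))) (?a x))"
  proof (rule PT_fold[where B = "\<lambda>x. sz (?a x) + (1 + length (?a x) * (M + 1))"])
    fix x k
    show "sz (fold (\<lambda>t. improve (fst (fst x)) (snd (snd x)) (vmul t (?a x))) (take k (snd (fst (snd x)))) (?a x))
       \<le> sz (?a x) + (1 + length (?a x) * (M + 1))"
      using best_cases[of "fst (fst x)" "snd (snd x)" "?a x" "take k (snd (fst (snd x)))" "?a x"]
        M[OF vb_vmul_right] by (auto intro: trans_le_add2 simp del: add_Suc add_Suc_right)
  next
    show "pb (\<lambda>x. sz (?a x) + (1 + length (?a x) * (M + 1)))" by (intro pb_intros PT_basic)
  next
    show "PT (\<lambda>q. improve (fst (fst (fst q))) (snd (snd (fst q))) (vmul (fst (snd q)) (?a (fst q))) (snd (snd q)))"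
      unfolding improve_def by (intro PT_basic PT_le PT_estimate PT_vmul)
  qed (intro PT_basic)+
  then show "PT (\<lambda>p. select_step (fst p) (snd p))"
    unfolding select_step_def by (intro PT_basic)
qed

definition select :: "(nat \<times> nat) list \<Rightarrow> nat list \<times> table \<Rightarrow> nat list" where
  "select vw z = fst ((select_step vw ^^ length (snd z)) z)"

lemma select_Nil: "select vw (a, []) = a"
  by (simp add: select_def)

lemma select_Cons: "select vw (a, e # rest) =
    select vw (fold (\<lambda>t. improve vw rest (vmul t a)) (snd e) a, rest)"
  by (simp add: select_def funpow_Suc_right select_step_def del: funpow.simps)

lemma PT_select: "PT f \<Longrightarrow> PT g \<Longrightarrow> PT (\<lambda>x. select (f x) (g x))"
proof (rule PT_app2[where F = select])
  obtain M where M: "\<And>n a. vb n a \<Longrightarrow> sz a \<le> 1 + n * (M + 1)" using vb_size by blast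
  let ?B = "\<lambda>p :: (nat \<times> nat) list \<times> nat list \<times> table. 1 + (sz (fst (snd p)) + (1 + length (fst (snd p)) * (M + 1))) + sz (snd (snd p))"
  have inv: "(fst z' = a \<or> vb (length a) (fst z')) \<and> sz (snd z') \<le> sz tab"
    if "(select_step vw ^^ k) (a, tab) = z'" for vw k a tab z'
    using that
  proof (induction k arbitrary: z')
    case (Suc k)
    obtain b tab' where z: "(select_step vw ^^ k) (a, tab) = (b, tab')" by fastforce
    with Suc.prems have z': "z' = select_step vw (b, tab')" by simp
    have b: "b = a \<or> vb (length a) b" "sz tab' \<le> sz tab" using Suc.IH[OF z] by auto
    show ?case
    proof (cases tab')
      case Nil
      with b show ?thesis by (simp add: z' select_step_def)
    next
      case (Cons e rest)
      have "vb (length a) (vmul t b)" for t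
        using b(1) vb_vmul vb_vmul_right by blast
      with best_cases[of vw rest b "snd e" b] b Cons show ?thesis
        by (auto simp: z' select_step_def sz_Cons)
    qed
  qed auto
  show "PT (\<lambda>p. select (fst p) (snd p))"
    unfolding select_def
  proof (rule PT_fst, rule PT_funpow[where B = ?B])
    fix p :: "(nat \<times> nat) list \<times> nat list \<times> table" and k
    obtain b tab where z: "(select_step (fst p) ^^ k) (snd p) = (b, tab)" by fastforce
    then have "b = fst (snd p) \<or> vb (length (fst (snd p))) b" "sz tab \<le> sz (snd (snd p))"
      using inv[of k "fst p" "fst (snd p)" "snd (snd p)" "(b, tab)"] by auto
    moreover from this(1) have "sz b \<le> sz (fst (snd p)) + (1 + length (fst (snd p)) * (M + 1))"
      using M[of "length (fst (snd p))" b] by auto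
    ultimately show "sz ((select_step (fst p) ^^ k) (snd p)) \<le> ?B p"
      by (simp add: z sz_pair)
  next
    show "pb ?B" by (intro pb_intros PT_basic)
  qed (intro PT_basic PT_select_step)+
qed

end

section \<open>Correctness of the algorithm\<close>

text \<open>Closure under the Mal'tsev operation \<open>x y\<inverse> z\<close> is all that is used of cosets.\<close>

definition (in group_alg) maltsev :: "nat list list \<Rightarrow> bool" where
  "maltsev R \<longleftrightarrow> (\<forall>x\<in>set R. \<forall>y\<in>set R. \<forall>z\<in>set R. map (\<lambda>(a, b, c). a \<otimes> inv b \<otimes> c) (zip x (zip y z)) \<in> set R)"

locale group_vec = group_alg +
  fixes vs :: "nat list"
  assumes dist: "distinct vs"
begin

lemma cancel_inv:
  assumes "x \<in> carrier G" "y \<in> carrier G"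
  shows "x \<otimes> (inv x \<otimes> y) = y" "inv x \<otimes> (x \<otimes> y) = y"
  using assms by (simp_all flip: m_assoc)

abbreviation lk :: "nat list \<Rightarrow> nat \<Rightarrow> nat" where "lk \<equiv> look vs"

definition X :: "nat list set" where
  "X = {w. length w = length vs \<and> set w \<subseteq> carrier G}"

text \<open>The power of \<open>G\<close> indexed by \<open>vs\<close>, realised on value lists so
  that general group theory speaks about what the program manipulates.\<close>

definition VG :: "nat list monoid" where
  "VG = \<lparr>carrier = X, mult = vmul, one = ones vs\<rparr>"

lemma VG_simps [simp]: "carrier VG = X" "mult VG = vmul" "one VG = ones vs"
  by (simp_all add: VG_def)

lemma finite_X: "finite X"
  unfolding X_def using finite_lists_length_eq[OF fin, of "length vs"]
  by (rule rev_finite_subset) auto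

lemma filter_zip_distinct:
  "distinct us \<Longrightarrow> length us = length w \<Longrightarrow> i < length us \<Longrightarrow>
   filter (\<lambda>p. fst p = us ! i) (zip us w) = [(us ! i, w ! i)]"
proof (induction us w arbitrary: i rule: list_induct2')
  case (4 u us x w)
  have "filter (\<lambda>p. fst p = u) (zip us w) = []"
    using 4(2) by (auto simp: filter_empty_conv dest: set_zip_leftD)
  then show ?case using 4 by (cases i) auto
qed auto

lemma look_nth: "length w = length vs \<Longrightarrow> i < length vs \<Longrightarrow> lk w (vs ! i) = w ! i"
  using filter_zip_distinct[OF dist, of w i] by (simp add: look_def)

lemma look_map: "v \<in> set vs \<Longrightarrow> lk (map f vs) v = f v"
  by (metis in_set_conv_nth length_map look_nth nth_map)

lemma vec_eqI: "w \<in> X \<Longrightarrow> w' \<in> X \<Longrightarrow> (\<And>v. v \<in> set vs \<Longrightarrow> lk w v = lk w' v) \<Longrightarrow> w = w'"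
  by (rule nth_equalityI) (auto simp: X_def dest: look_nth, metis look_nth nth_mem)

lemma look_closed [simp]: "w \<in> X \<Longrightarrow> v \<in> set vs \<Longrightarrow> lk w v \<in> carrier G"
  by (smt (verit) X_def in_set_conv_nth look_nth mem_Collect_eq nth_mem subset_iff)

lemma map_in_X: "(\<And>v. v \<in> set vs \<Longrightarrow> f v \<in> carrier G) \<Longrightarrow> map f vs \<in> X"
  by (auto simp: X_def)

lemma vmul_eq: "w \<in> X \<Longrightarrow> w' \<in> X \<Longrightarrow> vmul w w' = map (\<lambda>v. lk w v \<otimes> lk w' v) vs"
proof (rule nth_equalityI)
  fix i assume w: "w \<in> X" "w' \<in> X" and "i < length (vmul w w')"
  then have i: "i < length vs" by (simp add: vmul_def X_def)
  then have "w ! i \<in> carrier G" "w' ! i \<in> carrier G"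
    using w by (auto simp: X_def dest: nth_mem)
  then show "vmul w w' ! i = map (\<lambda>v. lk w v \<otimes> lk w' v) vs ! i"
    using w i by (simp add: vmul_def gmul_def X_def look_nth)
qed (simp add: vmul_def X_def)

lemma vmul_closed [simp]: "w \<in> X \<Longrightarrow> w' \<in> X \<Longrightarrow> vmul w w' \<in> X"
  by (simp add: vmul_eq map_in_X)

lemma ones_closed [simp]: "ones vs \<in> X"
  by (simp add: ones_def map_in_X)

lemma look_vmul [simp]: "w \<in> X \<Longrightarrow> w' \<in> X \<Longrightarrow> v \<in> set vs \<Longrightarrow> lk (vmul w w') v = lk w v \<otimes> lk w' v"
  by (simp add: vmul_eq look_map)

lemma look_ones [simp]: "v \<in> set vs \<Longrightarrow> lk (ones vs) v = \<one>"
  by (simp add: ones_def look_map)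

lemma group_VG: "group VG"
proof (rule groupI)
  fix w assume "w \<in> carrier VG"
  then have w: "w \<in> X" by simp
  have "map (\<lambda>v. inv (lk w v)) vs \<in> X" using w by (intro map_in_X) simp
  moreover from this w have "vmul (map (\<lambda>v. inv (lk w v)) vs) w = ones vs"
    by (intro vec_eqI) (simp_all add: look_map)
  ultimately show "\<exists>y\<in>carrier VG. y \<otimes>\<^bsub>VG\<^esub> w = \<one>\<^bsub>VG\<^esub>" by auto
qed (auto intro!: vec_eqI simp: m_assoc)

sublocale V: group VG
  by (rule group_VG)

abbreviation vinv :: "nat list \<Rightarrow> nat list" where "vinv \<equiv> m_inv VG"

lemma vinv_closed [simp]: "w \<in> X \<Longrightarrow> vinv w \<in> X"
  using V.inv_closed by simp

lemma vinv_right [simp]: "w \<in> X \<Longrightarrow> vmul w (vinv w) = ones vs"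
  using V.r_inv by simp

lemma vinv_left [simp]: "w \<in> X \<Longrightarrow> vmul (vinv w) w = ones vs"
  using V.l_inv by simp

lemma vmul_assoc: "x \<in> X \<Longrightarrow> y \<in> X \<Longrightarrow> z \<in> X \<Longrightarrow> vmul (vmul x y) z = vmul x (vmul y z)"
  using V.m_assoc by simp

lemma vmul_ones [simp]: "x \<in> X \<Longrightarrow> vmul (ones vs) x = x" "x \<in> X \<Longrightarrow> vmul x (ones vs) = x"
  using V.l_one V.r_one by simp_all

lemma look_vinv [simp]:
  assumes "w \<in> X" "v \<in> set vs"
  shows "lk (vinv w) v = inv (lk w v)"
proof -
  have "lk (vinv w) v \<otimes> lk w v = \<one>"
    using assms look_vmul[of "vinv w" w v] by simp
  then show ?thesis using assms by (intro inv_equality[symmetric]) auto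
qed

section \<open>Tables\<close>

abbreviation sub :: "nat list set \<Rightarrow> bool" where "sub H \<equiv> subgroup H VG"

lemma sub_facts:
  assumes "sub H"
  shows "H \<subseteq> X" "ones vs \<in> H" "x \<in> H \<Longrightarrow> y \<in> H \<Longrightarrow> vmul x y \<in> H" "x \<in> H \<Longrightarrow> vinv x \<in> H"
  using subgroup.subset[OF assms] subgroup.one_closed[OF assms] subgroup.m_closed[OF assms]
    subgroup.m_inv_closed[OF assms] by auto

text \<open>The kernel of the evaluation at \<open>v\<close>. Successive kernels form the chain of
  subgroups along which the table is built.\<close>

definition ker :: "nat list set \<Rightarrow> nat \<Rightarrow> nat list set" where
  "ker H v = {h \<in> H. lk h v = \<one>}"

lemma sub_ker: "sub H \<Longrightarrow> v \<in> set vs \<Longrightarrow> sub (ker H v)"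
proof -
  assume H: "sub H" and v: "v \<in> set vs"
  note [simp] = subsetD[OF sub_facts(1)[OF H]]
  show ?thesis
    by (rule V.subgroupI) (use sub_facts[OF H] v in \<open>auto simp: ker_def intro!: exI[of _ "ones vs"]\<close>)
qed

text \<open>The analogue of a strong generating set: each level meets every coset of the next
  kernel, repetitions allowed, and the chain ends in the trivial group.\<close>

fun good :: "nat list set \<Rightarrow> table \<Rightarrow> bool" where
  "good H [] \<longleftrightarrow> H = {ones vs}"
| "good H (e # tab) \<longleftrightarrow> fst e \<in> set vs \<and> set (snd e) \<subseteq> H \<and>
     (\<forall>h\<in>H. \<exists>t\<in>set (snd e). lk t (fst e) = lk h (fst e)) \<and> good (ker H (fst e)) tab"

text \<open>One step of sifting: pick \<open>t\<close> in the level with the value of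
  \<open>h\<close> at the variable; then \<open>vmul (vinv t) h\<close> is trivial there.\<close>

lemma good_decompose:
  assumes "sub H" "good H (e # tab)" "h \<in> H"
  obtains t k where "t \<in> set (snd e)" "k \<in> ker H (fst e)" "h = vmul t k"
proof -
  note H = sub_facts[OF assms(1)]
  obtain t where t: "t \<in> set (snd e)" "lk t (fst e) = lk h (fst e)" "t \<in> H" "fst e \<in> set vs"
    using assms(2,3) by fastforce
  have [simp]: "t \<in> X" "h \<in> X" using H assms t by auto
  have "vmul (vinv t) h \<in> ker H (fst e)"
    using t assms H by (simp add: ker_def)
  moreover have "h = vmul t (vmul (vinv t) h)" by (simp flip: vmul_assoc)
  ultimately show thesis using that t by blast
qed

lemma reps_cover:
  "w \<in> set L \<Longrightarrow> proj vs s w \<in> set ks \<Longrightarrow> \<exists>w'\<in>set (reps vs ks s L). proj vs s w' = proj vs s w"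
proof -
  assume w: "w \<in> set L" "proj vs s w \<in> set ks"
  then have "filter (\<lambda>w'. proj vs s w' = proj vs s w) L \<noteq> []" by (auto simp: filter_empty_conv)
  then obtain w' ws where f: "filter (\<lambda>w'. proj vs s w' = proj vs s w) L = w' # ws"
    by (auto simp: neq_Nil_conv)
  then have "w' \<in> set (filter (\<lambda>w'. proj vs s w' = proj vs s w) L)" by simp
  then have "proj vs s w' = proj vs s w" by simp
  moreover have "w' \<in> set (reps vs ks s L)"
    unfolding reps_def using w f by (auto intro!: bexI[of _ "proj vs s w"])
  ultimately show ?thesis by blast
qed

text \<open>Averages will be taken over representatives, so no value may be listed twice.\<close>

lemma distinct_reps: "distinct ks \<Longrightarrow> distinct (map (proj vs s) (reps vs ks s L))"
proof -
  assume "distinct ks"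
  have "map (proj vs s) (reps vs ks s L) = filter (\<lambda>k. \<exists>w\<in>set L. proj vs s w = k) ks"
  proof (induction ks)
    case (Cons k ks)
    show ?case
    proof (cases "filter (\<lambda>w. proj vs s w = k) L")
      case Nil
      then have "\<not> (\<exists>w\<in>set L. proj vs s w = k)" by (auto simp: filter_empty_conv)
      with Cons Nil show ?thesis by (simp add: reps_def)
    next
      case (Cons w ws)
      then have "w \<in> set (filter (\<lambda>w. proj vs s w = k) L)" by simp
      then have "w \<in> set L" "proj vs s w = k" by auto
      with Cons Cons.IH show ?thesis by (auto simp: reps_def)
    qed
  qed (simp add: reps_def)
  then show ?thesis using \<open>distinct ks\<close> by simp
qed

lemma finite_keys: "finite {xs. set xs \<subseteq> carrier G \<and> length xs \<le> Suc A}"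
  by (rule finite_lists_length_le[OF fin])

lemma proj_in_keys: "w \<in> X \<Longrightarrow> set s \<subseteq> set vs \<Longrightarrow> length s \<le> Suc A \<Longrightarrow> proj vs s w \<in> set keys"
  using finite_keys by (auto simp: keys_def proj_def)

lemma distinct_keys: "distinct keys"
  by (simp add: keys_def)

lemma proj_cong: "(\<And>v. v \<in> set s \<Longrightarrow> lk x v = lk y v) \<Longrightarrow> proj vs s x = proj vs s y"
  by (simp add: proj_def)

lemma proj_eqD: "proj vs s x = proj vs s y \<Longrightarrow> v \<in> set s \<Longrightarrow> lk x v = lk y v"
  by (simp add: proj_def)

text \<open>Projection to a scope is a homomorphism. This is what allows a factor to be exchanged
  for its representative.\<close>

lemma proj_vmul_cong:
  assumes "proj vs s x = proj vs s x'" "proj vs s y = proj vs s y'" "set s \<subseteq> set vs"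
    "x \<in> X" "x' \<in> X" "y \<in> X" "y' \<in> X"
  shows "proj vs s (vmul x y) = proj vs s (vmul x' y')"
  using assms by (intro proj_cong) (auto dest!: proj_eqD)

text \<open>Let h = t k with \<open>t\<close> in the first level and \<open>k\<close> in the kernel.
  By induction some \<open>w\<close> in the list for the kernel agrees with \<open>k\<close> on the
  scope, and then t w agrees with \<open>h\<close> there.\<close>

lemma pass_fst:
  assumes "sub H" "good H tab" "set s \<subseteq> set vs" "length s \<le> Suc A"
  shows "set (fst (pass vs s R a tab)) \<subseteq> H \<and>
    (\<forall>h\<in>H. \<exists>w\<in>set (fst (pass vs s R a tab)). proj vs s w = proj vs s h)"
  using assms(1,2)
proof (induction tab arbitrary: H)
  case (Cons e tab)
  note H = sub_facts[OF Cons.prems(1)]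
  have e: "fst e \<in> set vs" "set (snd e) \<subseteq> H" "good (ker H (fst e)) tab" using Cons.prems by auto
  define W where "W = fst (pass vs s R a tab)"
  have W: "set W \<subseteq> ker H (fst e)" "\<And>h. h \<in> ker H (fst e) \<Longrightarrow> \<exists>w\<in>set W. proj vs s w = proj vs s h"
    using Cons.IH[OF sub_ker[OF Cons.prems(1) e(1)] e(3)] by (auto simp: W_def)
  have kH: "ker H (fst e) \<subseteq> H" by (auto simp: ker_def)
  have C: "set (prods (snd e) W) \<subseteq> H" using W(1) e(2) H(3) kH unfolding set_prods by blast
  have "\<exists>w\<in>set (reps vs keys s (prods (snd e) W)). proj vs s w = proj vs s h" if h: "h \<in> H" for h
  proof -
    obtain t k where tk: "t \<in> set (snd e)" "k \<in> ker H (fst e)" "h = vmul t k"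
      using good_decompose[OF Cons.prems h] .
    obtain w where w: "w \<in> set W" "proj vs s w = proj vs s k" using W(2)[OF tk(2)] by blast
    have X: "t \<in> X" "k \<in> X" "w \<in> X" using tk w W e kH H by auto
    have "proj vs s (vmul t w) = proj vs s h"
      unfolding tk(3) by (rule proj_vmul_cong) (use X w assms in auto)
    moreover have "vmul t w \<in> set (prods (snd e) W)" using tk w by (auto simp: set_prods)
    moreover have "proj vs s (vmul t w) \<in> set keys" by (rule proj_in_keys) (use X assms in auto)
    ultimately show ?thesis using reps_cover by metis
  qed
  moreover have "fst (pass vs s R a (e # tab)) = reps vs keys s (prods (snd e) W)"
    by (simp add: pass_step_def Let_def W_def)
  ultimately show ?case using C set_reps by fastforce
qed auto

text \<open>The exchange of \<open>k\<close> for \<open>w\<close> keeps the values on the scope,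
  hence the constraint, and also the value at the variable of the level, where both are
  trivial.\<close>

lemma pass_snd:
  assumes "sub H" "good H tab" "set s \<subseteq> set vs" "length s \<le> Suc A" "a \<in> X"
    "proj vs s a \<in> set R"
  shows "good {h \<in> H. proj vs s (vmul h a) \<in> set R} (snd (pass vs s R a tab))"
  using assms(1,2)
proof (induction tab arbitrary: H)
  case Nil
  \<comment> \<open>The trivial vector survives because the base point satisfies the
    constraint.\<close>
  then show ?case using assms by auto
next
  case (Cons e tab)
  note H = sub_facts[OF Cons.prems(1)]
  let ?P = "\<lambda>h. proj vs s (vmul h a) \<in> set R"
  have e: "fst e \<in> set vs" "set (snd e) \<subseteq> H" "good (ker H (fst e)) tab" using Cons.prems by auto
  define W where "W = fst (pass vs s R a tab)"
  have W: "set W \<subseteq> ker H (fst e)" "\<And>h. h \<in> ker H (fst e) \<Longrightarrow> \<exists>w\<in>set W. proj vs s w = proj vs s h"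
    using pass_fst[OF sub_ker[OF Cons.prems(1) e(1)] e(3) assms(3,4)] by (auto simp: W_def)
  have kH: "ker H (fst e) \<subseteq> H" by (auto simp: ker_def)
  have C: "set (prods (snd e) W) \<subseteq> H" using W(1) e(2) H(3) kH unfolding set_prods by blast
  let ?T = "reps vs keys [fst e] (filter ?P (prods (snd e) W))"
  have T: "set ?T \<subseteq> {h \<in> H. ?P h}" using set_reps[of vs keys "[fst e]" "filter ?P (prods (snd e) W)"] C by auto
  have cover: "\<exists>t\<in>set ?T. lk t (fst e) = lk h (fst e)" if h: "h \<in> H" "?P h" for h
  proof -
    obtain t k where tk: "t \<in> set (snd e)" "k \<in> ker H (fst e)" "h = vmul t k"
      using good_decompose[OF Cons.prems h(1)] .
    obtain w where w: "w \<in> set W" "proj vs s w = proj vs s k" using W(2)[OF tk(2)] by blast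
    have X: "t \<in> X" "k \<in> X" "w \<in> X" using tk w W e kH H by auto
    have "proj vs s (vmul (vmul t w) a) = proj vs s (vmul h a)"
      unfolding tk(3) by (intro proj_vmul_cong) (use X w assms in auto)
    then have 1: "vmul t w \<in> set (filter ?P (prods (snd e) W))" using tk w h by (auto simp: set_prods)
    have 2: "proj vs [fst e] (vmul t w) \<in> set keys" by (rule proj_in_keys) (use X e in auto)
    have "lk w (fst e) = \<one>" "lk k (fst e) = \<one>" using w tk W by (auto simp: ker_def)
    then have "lk (vmul t w) (fst e) = lk h (fst e)" using X e tk by simp
    with reps_cover[OF 1 2] show ?thesis by (auto simp: proj_def)
  qed
  \<comment> \<open>Imposing the constraint commutes with taking the kernel, so the tail of the
    table comes from the induction hypothesis.\<close>
  have "{h \<in> ker H (fst e). ?P h} = ker {h \<in> H. ?P h} (fst e)" by (auto simp: ker_def)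
  with Cons.IH[OF sub_ker[OF Cons.prems(1) e(1)] e(3)]
  have "good (ker {h \<in> H. ?P h} (fst e)) (snd (pass vs s R a tab))" by simp
  moreover have "snd (pass vs s R a (e # tab)) = (fst e, ?T) # snd (pass vs s R a tab)"
    by (simp add: pass_step_def Let_def W_def)
  ultimately show ?case using e(1) T cover by simp
qed

section \<open>Solution sets as cosets\<close>

definition sols_of :: "(nat list \<times> nat list list) list \<Rightarrow> nat list set" where
  "sols_of cs = {f \<in> X. \<forall>c\<in>set cs. proj vs (fst c) f \<in> set (snd c)}"

lemma maltsev_proj:
  assumes "maltsev R" "proj vs s x \<in> set R" "proj vs s y \<in> set R" "proj vs s z \<in> set R"
    "set s \<subseteq> set vs" "x \<in> X" "y \<in> X" "z \<in> X"
  shows "proj vs s (vmul (vmul x (vinv y)) z) \<in> set R"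
proof -
  have "proj vs s (vmul (vmul x (vinv y)) z) =
    map (\<lambda>(a, b, c). a \<otimes> inv b \<otimes> c) (zip (proj vs s x) (zip (proj vs s y) (proj vs s z)))"
    using assms(5-) by (induction s) (auto simp: proj_def)
  then show ?thesis using assms(1-4) by (auto simp: maltsev_def)
qed

text \<open>Once a list of constraints is unsolvable, all its extensions are, so nothing has to be
  maintained in that case.\<close>

definition represents :: "nat list \<times> table \<Rightarrow> (nat list \<times> nat list list) list \<Rightarrow> bool" where
  "represents z cs \<longleftrightarrow> sols_of cs = {} \<or> (fst z \<in> X \<and>
     (\<exists>H. sub H \<and> good H (snd z) \<and> sols_of cs = (\<lambda>h. vmul h (fst z)) ` H))"

text \<open>A suffix of \<open>vs\<close> makes the induction work: after the levels for
  \<open>pre\<close>, the remaining kernel consists of the vectors trivial on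
  \<open>pre\<close>.\<close>

lemma good_init:
  "vs = pre @ us \<Longrightarrow> good {h \<in> X. \<forall>v\<in>set pre. lk h v = \<one>}
     (map (\<lambda>v. (v, map (\<lambda>d. map (\<lambda>u. if u = v then d else \<one>) vs) ds)) us)"
proof (induction us arbitrary: pre)
  case Nil
  then have "set pre = set vs" by simp
  then have "{h \<in> X. \<forall>v\<in>set pre. lk h v = \<one>} = {ones vs}" by (auto intro: vec_eqI)
  then show ?case by simp
next
  case (Cons v us)
  have ds: "set ds = carrier G" using fin by (simp add: ds_def)
  have v: "v \<in> set vs" "v \<notin> set pre" using Cons.prems dist by auto
  have pre: "u \<in> set vs" if "u \<in> set pre" for u using that Cons.prems by auto
  let ?H = "{h \<in> X. \<forall>v\<in>set pre. lk h v = \<one>}"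
  have "ker ?H v = {h \<in> X. \<forall>v\<in>set (pre @ [v]). lk h v = \<one>}"
    by (auto simp: ker_def)
  then have "good (ker ?H v) (map (\<lambda>v. (v, map (\<lambda>d. map (\<lambda>u. if u = v then d else \<one>) vs) ds)) us)"
    using Cons.IH[of "pre @ [v]"] Cons.prems by simp
  moreover have "map (\<lambda>u. if u = v then d else \<one>) vs \<in> ?H" if "d \<in> carrier G" for d
    using that v pre by (auto intro!: map_in_X simp: look_map)
  moreover have "\<exists>d\<in>carrier G. lk (map (\<lambda>u. if u = v then d else \<one>) vs) v = lk h v" if "h \<in> ?H" for h
    using that v by (intro bexI[of _ "lk h v"]) (auto simp: look_map)
  ultimately show ?case using v(1) ds by auto
qed

lemma represents_init: "represents (init vs) []"
proof -
  have "good X (snd (init vs))" using good_init[of "[]" vs] by (simp add: init_def)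
  moreover have "sub X" using V.subgroup_self by simp
  moreover have "sols_of [] = (\<lambda>h. vmul h (fst (init vs))) ` X"
    by (auto simp: sols_of_def init_def)
  ultimately show ?thesis unfolding represents_def by (auto simp: init_def)
qed

lemma represents_impose:
  assumes r: "represents z cs" and c: "set (fst c) \<subseteq> set vs" "length (fst c) \<le> Suc A" "maltsev (snd c)"
  shows "represents (impose vs c z) (cs @ [c])"
proof (cases "sols_of (cs @ [c]) = {}")
  case True
  then show ?thesis by (simp add: represents_def)
next
  case False
  have S: "sols_of (cs @ [c]) = {f \<in> sols_of cs. proj vs (fst c) f \<in> set (snd c)}"
    by (auto simp: sols_of_def)
  obtain a tab where z: "z = (a, tab)" by fastforce
  from False S have "sols_of cs \<noteq> {}" by auto
  then obtain H where a: "a \<in> X" and H: "sub H" "good H tab" and SH: "sols_of cs = (\<lambda>h. vmul h a) ` H"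
    using r by (auto simp: represents_def z)
  note Hs = sub_facts[OF H(1)]
  have HX [simp]: "h \<in> X" if "h \<in> H" for h using that Hs by auto
  let ?P = "\<lambda>a h. proj vs (fst c) (vmul h a) \<in> set (snd c)"
  define W where "W = fst (pass vs (fst c) (snd c) a tab)"
  have W: "set W \<subseteq> H" "\<And>h. h \<in> H \<Longrightarrow> \<exists>w\<in>set W. proj vs (fst c) w = proj vs (fst c) h"
    using pass_fst[OF H c(1,2)] by (auto simp: W_def)
  obtain f where f: "f \<in> sols_of (cs @ [c])" using False by blast
  then obtain h where h: "h \<in> H" "f = vmul h a" "?P a h" using S SH by auto
  obtain w where w: "w \<in> set W" "proj vs (fst c) w = proj vs (fst c) h" using W(2)[OF h(1)] by blast
  \<comment> \<open>The representative \<open>w\<close> of \<open>h\<close> satisfies the constraint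
    together with \<open>h\<close>, so the search in \<open>impose\<close> succeeds.\<close>
  have "proj vs (fst c) (vmul w a) = proj vs (fst c) (vmul h a)"
    by (rule proj_vmul_cong) (use w h W a c in auto)
  then have "w \<in> set (filter (?P a) W)" using w h by simp
  then have "filter (?P a) W \<noteq> []" by force
  then obtain u us where u: "filter (?P a) W = u # us" by (auto simp: neq_Nil_conv)
  then have "u \<in> set (filter (?P a) W)" by simp
  then have uH: "u \<in> H" and Pu: "?P a u" using W(1) by auto
  define b where "b = vmul u a"
  have bX: "b \<in> X" and Pb: "proj vs (fst c) b \<in> set (snd c)" using uH a Pu by (auto simp: b_def)
  have im: "impose vs c z = (b, snd (pass vs (fst c) (snd c) b tab))"
    using u by (simp add: impose_def z W_def b_def)
  let ?H = "{h \<in> H. ?P b h}"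
  have "sub ?H"
  \<comment> \<open>The identity belongs to the set since \<open>b\<close> satisfies the constraint.
    The Mal'tsev operation sends (b, x b, b) to (inv x) b and (x b, b, y b) to x y b, which gives
    inverses and products.\<close>
  proof (rule V.subgroupI)
    show "?H \<noteq> {}" using Hs(2) bX Pb by (auto intro!: exI[of _ "ones vs"])
  next
    fix x assume x: "x \<in> ?H"
    then have "vmul (vmul b (vinv (vmul x b))) b = vmul (vinv x) b"
      using bX by (intro vec_eqI) (auto simp: inv_mult_group m_assoc cancel_inv)
    with maltsev_proj[OF c(3) Pb _ Pb c(1) bX _ bX, of "vmul x b"] x bX Hs(4)
    show "vinv x \<in> ?H" by auto
  next
    fix x y assume xy: "x \<in> ?H" "y \<in> ?H"
    then have "vmul (vmul (vmul x b) (vinv b)) (vmul y b) = vmul (vmul x y) b"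
      using bX by (intro vec_eqI) (auto simp: m_assoc cancel_inv)
    with maltsev_proj[OF c(3) _ Pb _ c(1) _ bX, of "vmul x b" "vmul y b"] xy bX Hs(3)
    show "x \<otimes>\<^bsub>VG\<^esub> y \<in> ?H" by auto
  qed auto
  moreover have "good ?H (snd (pass vs (fst c) (snd c) b tab))"
    by (rule pass_snd[OF H c(1,2) bX Pb])
  moreover have "sols_of (cs @ [c]) = (\<lambda>h. vmul h b) ` ?H"
  proof (intro equalityI subsetI)
    fix g assume "g \<in> sols_of (cs @ [c])"
    then obtain k where k: "k \<in> H" "g = vmul k a" "?P a k" using S SH by auto
    \<comment> \<open>Change of base point from \<open>a\<close> to b = u a.\<close>
    have "g = vmul (vmul k (vinv u)) b"
      using k uH a by (intro vec_eqI) (auto simp: b_def m_assoc cancel_inv)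
    moreover from this k have "vmul k (vinv u) \<in> ?H" using uH Hs(3,4) by simp
    ultimately show "g \<in> (\<lambda>h. vmul h b) ` ?H" by (rule image_eqI)
  next
    fix g assume "g \<in> (\<lambda>h. vmul h b) ` ?H"
    then obtain k where k: "k \<in> H" "g = vmul k b" "proj vs (fst c) g \<in> set (snd c)" by auto
    have "g = vmul (vmul k u) a" using k uH a by (simp add: b_def vmul_assoc)
    moreover have "vmul k u \<in> H" using k uH Hs(3) by simp
    ultimately have "g \<in> sols_of cs" unfolding SH by (rule image_eqI)
    then show "g \<in> sols_of (cs @ [c])" using k S by simp
  qed
  ultimately show ?thesis using bX unfolding represents_def im fst_conv snd_conv by blast
qed

lemma represents_solve:
  assumes "\<And>c. c \<in> set cs \<Longrightarrow> set (fst c) \<subseteq> set vs \<and> length (fst c) \<le> Suc A \<and> maltsev (snd c)"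
  shows "represents (solve vs cs) cs"
  using assms unfolding solve_def
proof (induction cs rule: rev_induct)
  case Nil
  show ?case using represents_init by simp
next
  case (snoc c cs)
  then have "represents (fold (impose vs) cs (init vs)) cs" by simp
  from represents_impose[OF this] snoc.prems[of c] show ?case by simp
qed

section \<open>The approximation ratio\<close>

text \<open>The elements of \<open>H\<close> with a given value at \<open>v\<close> form one coset
  of the kernel, and \<open>W\<close> meets each of these cosets once. So all values at
  \<open>v\<close> occur equally often: this is the uniform distribution.\<close>

lemma kernel_transversal:
  assumes H: "sub H" and v: "v \<in> set vs" and W: "W \<subseteq> H" "inj_on (\<lambda>w. lk w v) W"
    "\<And>h. h \<in> H \<Longrightarrow> \<exists>w\<in>W. lk w v = lk h v"
  shows "bij_betw (\<lambda>p. vmul (fst p) (snd p)) (ker H v \<times> W) H"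
proof -
  note Hs = sub_facts[OF H]
  have K: "k \<in> H" "lk k v = \<one>" if "k \<in> ker H v" for k using that by (auto simp: ker_def)
  have HX: "h \<in> X" if "h \<in> H" for h using that Hs by auto
  have WH: "w \<in> H" if "w \<in> W" for w using that W by auto
  have inj: "k = k' \<and> w = w'" if eq: "vmul k w = vmul k' w'"
    and p: "k \<in> ker H v" "w \<in> W" "k' \<in> ker H v" "w' \<in> W" for k w k' w'
  proof -
    note X = HX[OF K(1)[OF p(1)]] HX[OF WH[OF p(2)]] HX[OF K(1)[OF p(3)]] HX[OF WH[OF p(4)]]
    have "lk w v = lk w' v"
      using arg_cong[OF eq, of "\<lambda>x. lk x v"] K(2)[OF p(1)] K(2)[OF p(3)] X v by simp
    then have w: "w = w'" using W(2) p by (meson inj_onD)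
    then have "k = k'" using eq V.right_cancel[of w k k'] X by simp
    with w show ?thesis by blast
  qed
  have surj: "\<exists>p\<in>ker H v \<times> W. vmul (fst p) (snd p) = h" if h: "h \<in> H" for h
  proof -
    obtain w where w: "w \<in> W" "lk w v = lk h v" using W(3)[OF h] by blast
    note X = HX[OF h] HX[OF WH[OF w(1)]]
    have "vmul h (vinv w) \<in> ker H v" using w X v Hs(3)[OF h Hs(4)[OF WH[OF w(1)]]] by (simp add: ker_def)
    moreover have "vmul (vmul h (vinv w)) w = h" using X by (simp add: vmul_assoc)
    ultimately show ?thesis using w(1) by (intro bexI[of _ "(vmul h (vinv w), w)"]) auto
  qed
  show ?thesis
    unfolding bij_betw_def
  proof
    show "inj_on (\<lambda>p. vmul (fst p) (snd p)) (ker H v \<times> W)"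
      using inj by (intro inj_onI) (metis mem_Times_iff prod_eq_iff)
    show "(\<lambda>p. vmul (fst p) (snd p)) ` (ker H v \<times> W) = H"
    proof (intro equalityI subsetI)
      fix h assume "h \<in> (\<lambda>p. vmul (fst p) (snd p)) ` (ker H v \<times> W)"
      then show "h \<in> H" using Hs(3) K(1) WH by auto
    next
      fix h assume "h \<in> H"
      from surj[OF this] show "h \<in> (\<lambda>p. vmul (fst p) (snd p)) ` (ker H v \<times> W)" by (auto simp: image_iff)
    qed
  qed
qed

lemma scaled_mean_correct:
  assumes H: "sub H" "good H tab" and v: "v \<in> set vs" and a: "a \<in> X"
  defines "xs \<equiv> map (\<lambda>w. lk (vmul w a) v) (fst (pass vs [v] [] a tab))"
  shows "scaled_mean xs * card H = card (carrier G) * (\<Sum>h\<in>H. lk (vmul h a) v)"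
    and "h \<in> H \<Longrightarrow> lk (vmul h a) v \<le> scaled_mean xs"
proof -
  note Hs = sub_facts[OF H(1)]
  have HX [simp]: "h \<in> X" if "h \<in> H" for h using that Hs by auto
  define W where "W = fst (pass vs [v] [] a tab)"
  have "set W \<subseteq> H \<and> (\<forall>h\<in>H. \<exists>w\<in>set W. proj vs [v] w = proj vs [v] h)"
    unfolding W_def using v by (intro pass_fst H) auto
  then have W: "set W \<subseteq> H" "\<And>h. h \<in> H \<Longrightarrow> \<exists>w\<in>set W. lk w v = lk h v"
    by (auto simp: proj_def)
  have "distinct (map (proj vs [v]) W)"
    by (cases tab) (simp_all add: W_def pass_step_def Let_def distinct_reps distinct_keys)
  then have "distinct (map (\<lambda>w. lk w v) W)"
    by (auto simp: proj_def distinct_map inj_on_def)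
  then have dW: "distinct W" and injW: "inj_on (\<lambda>w. lk w v) (set W)" by (auto simp: distinct_map)
  have bij: "bij_betw (\<lambda>p. vmul (fst p) (snd p)) (ker H v \<times> set W) H"
    by (rule kernel_transversal[OF H(1) v W(1) injW W(2)])
  have fK: "finite (ker H v)" using finite_X Hs(1) by (auto simp: ker_def intro: finite_subset)
  have cardH: "card H = card (ker H v) * length W"
    using bij_betw_same_card[OF bij] distinct_card[OF dW] by (simp add: card_cartesian_product)
  have "(\<Sum>h\<in>H. lk (vmul h a) v) = (\<Sum>p\<in>ker H v \<times> set W. lk (vmul (vmul (fst p) (snd p)) a) v)"
    using sum.reindex_bij_betw[OF bij, of "\<lambda>h. lk (vmul h a) v", symmetric] .
  \<comment> \<open>The kernel component is trivial at \<open>v\<close>, so the summand depends on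
    the component in \<open>W\<close> alone.\<close>
  also have "\<dots> = (\<Sum>p\<in>ker H v \<times> set W. lk (vmul (snd p) a) v)"
    by (rule sum.cong) (use W(1) v a in \<open>auto simp: ker_def subset_iff\<close>)
  also have "\<dots> = card (ker H v) * sum_list xs"
    using sum.cartesian_product[of "\<lambda>_ w. lk (vmul w a) v" "set W" "ker H v"]
    by (simp add: case_prod_beta xs_def W_def[symmetric] sum_list_distinct_conv_sum_set dW)
  finally have sumH: "(\<Sum>h\<in>H. lk (vmul h a) v) = card (ker H v) * sum_list xs" .
  have "lk h v \<in> (\<lambda>w. lk w v) ` set W" if "h \<in> H" for h
    using W(2)[OF that] by (metis image_eqI)
  then have "(\<lambda>w. lk w v) ` H = (\<lambda>w. lk w v) ` set W" using W(1) by auto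
  then have img: "card ((\<lambda>w. lk w v) ` H) = length W"
    using injW dW by (simp add: card_image distinct_card)
  \<comment> \<open>The values at \<open>v\<close> form a subgroup of order \<open>length W\<close>,
    and Lagrange's theorem makes the division in \<open>scaled_mean\<close> exact.\<close>
  have "subgroup ((\<lambda>w. lk w v) ` H) G"
  proof (rule subgroupI)
    fix x y assume "x \<in> (\<lambda>w. lk w v) ` H" "y \<in> (\<lambda>w. lk w v) ` H"
    then show "x \<otimes> y \<in> (\<lambda>w. lk w v) ` H"
      using Hs(3) v by (smt (verit) HX image_iff look_vmul)
  next
    fix x assume "x \<in> (\<lambda>w. lk w v) ` H"
    then show "inv x \<in> (\<lambda>w. lk w v) ` H"
      using Hs(4) v by (smt (verit) HX image_iff look_vinv)
  qed (use Hs(2) v in auto)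
  from lagrange[OF this] have dvd: "length W dvd card (carrier G)"
    unfolding img order_def by (metis dvd_triv_right)
  have pos: "0 < card (carrier G)" using fin by (auto simp: card_gt_0_iff)
  have le: "length W \<le> card (carrier G)" using dvd pos by (rule dvd_imp_le)
  have len: "length xs = length W" by (simp add: xs_def W_def)
  have "set xs \<subseteq> carrier G" using W(1) v a by (auto simp: xs_def W_def[symmetric])
  with le len have sm: "scaled_mean xs = sum_list xs * (card (carrier G) div length W)"
    by (simp add: scaled_mean_def)
  have "card (carrier G) div length W * length W = card (carrier G)" using dvd by simp
  then show "scaled_mean xs * card H = card (carrier G) * (\<Sum>h\<in>H. lk (vmul h a) v)"
    unfolding sm sumH cardH by (metis mult.assoc mult.commute)
  show "lk (vmul h a) v \<le> scaled_mean xs" if h: "h \<in> H"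
  proof -
    obtain w where w: "w \<in> set W" "lk w v = lk h v" using W(2)[OF h] by blast
    then have "lk (vmul h a) v = lk (vmul w a) v" using W(1) h v a by auto
    \<comment> \<open>A natural number is at most any sum in which it occurs, and
      \<open>scaled_mean\<close> multiplies this sum by a factor of at least 1. The ratio |G|
      originates here.\<close>
    also have "\<dots> \<le> sum_list xs" using w by (intro member_le_sum_list) (auto simp: xs_def W_def[symmetric])
    also have "0 < length W" using w by (cases W) auto
    then have "sum_list xs * 1 \<le> scaled_mean xs"
      unfolding sm using le by (intro mult_left_mono) (auto simp: Suc_le_eq div_greater_zero_iff)
    then have "sum_list xs \<le> scaled_mean xs" by simp
    finally show ?thesis .
  qed
qed

definition obj :: "(nat \<times> nat) list \<Rightarrow> nat list \<Rightarrow> nat" where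
  "obj vw w = sum_list (map (\<lambda>p. snd p * lk w (fst p)) vw)"

text \<open>Both parts are \<open>scaled_mean_correct\<close> summed over the variables with the
  weights as coefficients. The first is linearity of expectation; the second bounds every solution
  and so the optimum.\<close>

lemma estimate_correct:
  assumes H: "sub H" "good H tab" and vw: "map fst vw = vs" and a: "a \<in> X"
  shows "estimate vw tab a * card H = card (carrier G) * (\<Sum>h\<in>H. obj vw (vmul h a))"
    and "h \<in> H \<Longrightarrow> obj vw (vmul h a) \<le> estimate vw tab a"
proof -
  define m where "m v = scaled_mean (map (\<lambda>w. lk (vmul w a) v) (fst (pass vs [v] [] a tab)))" for v
  have est: "estimate vw tab a = sum_list (map (\<lambda>p. snd p * m (fst p)) vw)"
    by (simp add: estimate_def m_def vw)
  have v: "fst p \<in> set vs" if "p \<in> set vw" for p using that vw by auto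
  have "(\<Sum>h\<in>H. obj vw (vmul h a)) = sum_list (map (\<lambda>p. \<Sum>h\<in>H. snd p * lk (vmul h a) (fst p)) vw)"
    unfolding obj_def by (induction vw) (simp_all add: sum.distrib)
  also have "card (carrier G) * \<dots> = sum_list (map (\<lambda>p. snd p * (card (carrier G) * (\<Sum>h\<in>H. lk (vmul h a) (fst p)))) vw)"
    by (simp add: sum_list_const_mult[symmetric] sum_distrib_left mult.left_commute)
  also have "\<dots> = sum_list (map (\<lambda>p. snd p * (m (fst p) * card H)) vw)"
    by (rule arg_cong[where f = sum_list], rule map_cong)
       (simp_all add: m_def scaled_mean_correct(1)[OF H v a])
  also have "\<dots> = estimate vw tab a * card H"
    by (simp add: est sum_list_mult_const[symmetric] mult.assoc)
  finally show "estimate vw tab a * card H = card (carrier G) * (\<Sum>h\<in>H. obj vw (vmul h a))" by simp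
  show "obj vw (vmul h a) \<le> estimate vw tab a" if "h \<in> H"
    unfolding obj_def est m_def
    by (intro sum_list_mono mult_left_mono scaled_mean_correct(2)[OF H v a that]) auto
qed

lemma best_ge:
  "estimate vw rest b \<le> estimate vw rest (fold (\<lambda>t. improve vw rest (vmul t a)) T b)"
  "t \<in> set T \<Longrightarrow> estimate vw rest (vmul t a) \<le> estimate vw rest (fold (\<lambda>t. improve vw rest (vmul t a)) T b)"
proof (induction T arbitrary: b)
  case (Cons u T)
  {
    case 1
    show ?case using Cons.IH(1)[of "improve vw rest (vmul u a) b"]
      by (auto simp: improve_def split: if_splits)
  next
    case 2
    then show ?case using Cons.IH[of "improve vw rest (vmul u a) b"]
      by (auto simp: improve_def split: if_splits)
  }
qed simp_all

text \<open>The mean over \<open>H\<close> is the mean of the means over the cosets of the kernel,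
  so one of these is at least as large. The proof sums over all pairs of a kernel element and an
  element of \<open>H\<close>, which counts every coset equally often and avoids choosing a
  transversal.\<close>

lemma exists_good_choice:
  assumes H: "sub H" "good H (e # rest)" and vw: "map fst vw = vs" and a: "a \<in> X"
  shows "\<exists>t\<in>set (snd e). estimate vw (e # rest) a \<le> estimate vw rest (vmul t a)"
proof (rule ccontr)
  let ?K = "ker H (fst e)" and ?m = "estimate vw (e # rest) a"
  assume "\<not> ?thesis"
  then have less: "estimate vw rest (vmul t a) < ?m" if "t \<in> set (snd e)" for t
    using that by auto
  note Hs = sub_facts[OF H(1)]
  have v: "fst e \<in> set vs" and T: "set (snd e) \<subseteq> H" and g: "good ?K rest" using H(2) by auto
  have K: "sub ?K" by (rule sub_ker[OF H(1) v])
  note Ks = sub_facts[OF K]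
  have KH: "?K \<subseteq> H" by (auto simp: ker_def)
  have HX [simp]: "h \<in> X" if "h \<in> H" for h using that Hs by auto
  have fH: "finite H" and fK: "finite ?K" using finite_X Hs(1) KH by (auto intro: finite_subset)
  have "card ?K > 0" "card H > 0" using Ks(2) Hs(2) fH fK by (auto simp: card_gt_0_iff)
  have "card (carrier G) * (\<Sum>k\<in>?K. obj vw (vmul (vmul k h) a)) < card ?K * ?m" if h: "h \<in> H" for h
  proof -
    obtain t where t: "t \<in> set (snd e)" "lk t (fst e) = lk h (fst e)" using H(2) h by fastforce
    have tH: "t \<in> H" using t T by auto
    define k0 where "k0 = vmul h (vinv t)"
    have k0: "k0 \<in> ?K" using t tH h v Hs by (simp add: ker_def k0_def)
    have hk: "h = vmul k0 t" using h tH by (simp add: k0_def vmul_assoc)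
    \<comment> \<open>As h = k0 t, translating the kernel by \<open>k0\<close> turns the inner sum
      into the one for \<open>t\<close>.\<close>
    have "bij_betw (\<lambda>k. vmul k k0) ?K ?K"
      by (rule bij_betw_byWitness[where f' = "\<lambda>k. vmul k (vinv k0)"])
         (use k0 KH Ks in \<open>auto simp: vmul_assoc subset_iff\<close>)
    from sum.reindex_bij_betw[OF this, of "\<lambda>k. obj vw (vmul k (vmul t a))"]
    have "(\<Sum>k\<in>?K. obj vw (vmul (vmul k k0) (vmul t a))) = (\<Sum>k\<in>?K. obj vw (vmul k (vmul t a)))" .
    moreover have "vmul (vmul k h) a = vmul (vmul k k0) (vmul t a)" if "k \<in> ?K" for k
      using that k0 KH tH a unfolding hk by (simp add: vmul_assoc subset_iff)
    ultimately have "(\<Sum>k\<in>?K. obj vw (vmul (vmul k h) a)) = (\<Sum>k\<in>?K. obj vw (vmul k (vmul t a)))"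
      by simp
    then have "card (carrier G) * (\<Sum>k\<in>?K. obj vw (vmul (vmul k h) a)) = estimate vw rest (vmul t a) * card ?K"
      using estimate_correct(1)[OF K g vw, of "vmul t a"] tH a by simp
    also have "\<dots> < card ?K * ?m" using less[OF t(1)] \<open>card ?K > 0\<close> by simp
    finally show ?thesis .
  qed
  then have "(\<Sum>h\<in>H. card (carrier G) * (\<Sum>k\<in>?K. obj vw (vmul (vmul k h) a))) < (\<Sum>h\<in>H. card ?K * ?m)"
    using fH Hs(2) by (intro sum_strict_mono) auto
  also have "\<dots> = card ?K * (?m * card H)" by (simp add: mult_ac)
  also have "\<dots> = card ?K * (card (carrier G) * (\<Sum>h\<in>H. obj vw (vmul h a)))"
    by (simp only: estimate_correct(1)[OF H vw a])
  also have "\<dots> = card (carrier G) * (\<Sum>k\<in>?K. \<Sum>h\<in>H. obj vw (vmul h a))"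
    by (simp add: mult_ac)
  also have "(\<Sum>k\<in>?K. \<Sum>h\<in>H. obj vw (vmul h a)) = (\<Sum>k\<in>?K. \<Sum>h\<in>H. obj vw (vmul (vmul k h) a))"
  proof (rule sum.cong[OF refl])
    fix k assume "k \<in> ?K"
    then have k: "k \<in> H" using KH by auto
    \<comment> \<open>Left translation by a fixed \<open>k\<close> permutes \<open>H\<close>, so
      every kernel element contributes the same sum over \<open>H\<close>.\<close>
    have "bij_betw (\<lambda>h. vmul k h) H H"
      by (rule bij_betw_byWitness[where f' = "\<lambda>h. vmul (vinv k) h"])
         (use k Hs in \<open>auto simp: vmul_assoc[symmetric] subset_iff\<close>)
    from sum.reindex_bij_betw[OF this, of "\<lambda>h. obj vw (vmul h a)"]
    show "(\<Sum>h\<in>H. obj vw (vmul h a)) = (\<Sum>h\<in>H. obj vw (vmul (vmul k h) a))" by simp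
  qed
  also have "\<dots> = (\<Sum>h\<in>H. \<Sum>k\<in>?K. obj vw (vmul (vmul k h) a))" by (rule sum.swap)
  finally show False by (simp add: sum_distrib_left)
qed

text \<open>The estimate never decreases along the table. When the table is exhausted the group is
  trivial, and the estimate equals \<open>card (carrier G)\<close> times the measure of the selected
  vector.\<close>

lemma select_correct:
  assumes "sub H" "good H tab" "map fst vw = vs" "a \<in> X"
  shows "\<exists>h\<in>H. select vw (a, tab) = vmul h a"
    and "estimate vw tab a \<le> card (carrier G) * obj vw (select vw (a, tab))"
  using assms
proof (induction tab arbitrary: H a)
  case Nil
  {
    case 1
    then show ?case by (auto simp: select_Nil)
  next
    case 2
    then show ?case using estimate_correct(1)[OF 2(1,2,3,4)] by (simp add: select_Nil)
  }
next
  case (Cons e rest)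
  have *: "(\<exists>h\<in>H. select vw (a, e # rest) = vmul h a) \<and>
    estimate vw (e # rest) a \<le> card (carrier G) * obj vw (select vw (a, e # rest))"
    if H: "sub H" "good H (e # rest)" and a: "a \<in> X" and vw: "map fst vw = vs" for H a
  proof -
    note Hs = sub_facts[OF H(1)]
    have K: "sub (ker H (fst e))" "good (ker H (fst e)) rest" and T: "set (snd e) \<subseteq> H"
      using H by (auto intro: sub_ker)
    define b where "b = fold (\<lambda>t. improve vw rest (vmul t a)) (snd e) a"
    have "b \<in> insert a {vmul t a |t. t \<in> set (snd e)}" unfolding b_def by (rule best_cases)
    \<comment> \<open>If \<open>a\<close> is kept, the identity takes the role of
      \<open>t\<close>.\<close>
    then obtain t where t: "t \<in> H" "b = vmul t a"
      using T Hs(2) a by (cases "b = a") (fastforce intro: that[of "ones vs"])+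
    have bX: "b \<in> X" using t a Hs by auto
    obtain u where "u \<in> set (snd e)" "estimate vw (e # rest) a \<le> estimate vw rest (vmul u a)"
      using exists_good_choice[OF H vw a] by blast
    with best_ge(2)[of u "snd e" vw rest a a] have 1: "estimate vw (e # rest) a \<le> estimate vw rest b"
      by (simp add: b_def)
    obtain k where k: "k \<in> ker H (fst e)" "select vw (b, rest) = vmul k b"
      using Cons.IH(1)[OF K vw bX] by blast
    have "k \<in> H" using k by (auto simp: ker_def)
    then have "select vw (b, rest) = vmul (vmul k t) a" "vmul k t \<in> H"
      using k t a Hs by (auto simp: vmul_assoc subset_iff)
    then have "\<exists>h\<in>H. select vw (b, rest) = vmul h a" by blast
    with 1 Cons.IH(2)[OF K vw bX] show ?thesis
      unfolding select_Cons b_def[symmetric] by auto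
  qed
  {
    case 1
    show ?case using *[OF 1(1,2,4,3)] by (rule conjunct1)
  next
    case 2
    show ?case using *[OF 2(1,2,4,3)] by (rule conjunct2)
  }
qed

text \<open>The estimate at the start links both sides: it lies above the measure of every solution
  and below |G| times that of the selected one.\<close>

lemma algorithm_correct:
  assumes vw: "map fst vw = vs" and cs: "\<And>c. c \<in> set cs \<Longrightarrow> set (fst c) \<subseteq> set vs \<and>
      length (fst c) \<le> Suc A \<and> maltsev (snd c)" and f: "f \<in> sols_of cs"
  shows "select vw (solve vs cs) \<in> sols_of cs"
    and "obj vw f \<le> card (carrier G) * obj vw (select vw (solve vs cs))"
proof -
  obtain a tab where z: "solve vs cs = (a, tab)" by fastforce
  have rep: "represents (solve vs cs) cs" using cs by (rule represents_solve)
  obtain H where H: "sub H" "good H tab" "sols_of cs = (\<lambda>h. vmul h a) ` H" and a: "a \<in> X"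
    using rep f by (auto simp: represents_def z)
  show "select vw (solve vs cs) \<in> sols_of cs"
    using select_correct(1)[OF H(1,2) vw a] unfolding z H(3) by blast
  obtain h where "h \<in> H" "f = vmul h a" using f H by auto
  then have "obj vw f \<le> estimate vw tab a"
    using estimate_correct(2)[OF H(1,2) vw a] by simp
  also note select_correct(2)[OF H(1,2) vw a]
  finally show "obj vw f \<le> card (carrier G) * obj vw (select vw (solve vs cs))" unfolding z .
qed

end

section \<open>Instances and solutions as lists\<close>

type_synonym inst = "(nat \<times> nat) list \<times> nat list \<times> (nat list \<times> nat list list) list"

definition enc_inst_list :: "inst \<Rightarrow> bool list" where
  "enc_inst_list J = enc_list (\<lambda>p. enc_nat (fst p) @ enc_nat (snd p)) (fst J) @
     (enc_list enc_nat (fst (snd J)) @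
      enc_list (\<lambda>c. enc_list enc_nat (fst c) @ enc_list (enc_list enc_nat) (snd c)) (snd (snd J)))"

definition parse_inst :: "bool list \<Rightarrow> inst \<times> bool list" where
  "parse_inst = parse_pair (parse_list (parse_pair parse_nat parse_nat))
     (parse_pair (parse_list parse_nat)
        (parse_list (parse_pair (parse_list parse_nat) (parse_list (parse_list parse_nat)))))"

definition dec_inst :: "bool list \<Rightarrow> inst" where
  "dec_inst x = fst (parse_inst x)"

lemma dec_enc_inst: "dec_inst (enc_inst_list J) = J"
proof -
  have "parses enc_inst_list parse_inst"
    unfolding parse_inst_def enc_inst_list_def[abs_def]
    by (intro parses_pair parses_list parses_nat)
  then have "parse_inst (enc_inst_list J @ []) = (J, [])" unfolding parses_def by blast
  then show ?thesis by (simp add: dec_inst_def)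
qed

lemma PT_enc_inst_list: "PT f \<Longrightarrow> PT (\<lambda>x. enc_inst_list (f x))"
  by (rule PT_comp[where g = enc_inst_list], assumption, unfold enc_inst_list_def,
      intro PT_basic PT_enc_list PT_enc_nat)

lemma PT_dec_inst: "PT f \<Longrightarrow> PT (\<lambda>x. dec_inst (f x))"
proof (rule PT_comp[where g = dec_inst])
  have "parser parse_inst"
    unfolding parse_inst_def by (intro parser_pair parser_list parser_nat)
  then show "PT dec_inst" unfolding dec_inst_def parser_def by (blast intro: PT_fst)
qed

definition dec_sol :: "bool list \<Rightarrow> nat list" where
  "dec_sol y = fst (parse_list parse_nat y)"

lemma dec_enc_sol: "dec_sol (enc_list enc_nat w) = w"
proof -
  have "parse_list parse_nat (enc_list enc_nat w @ []) = (w, [])"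
    using parses_list[OF parses_nat] unfolding parses_def by blast
  then show ?thesis by (simp add: dec_sol_def)
qed

lemma PT_dec_sol: "PT f \<Longrightarrow> PT (\<lambda>x. dec_sol (f x))"
proof (rule PT_comp[where g = dec_sol])
  show "PT dec_sol" using parser_list[OF parser_nat]
    unfolding dec_sol_def parser_def by (blast intro: PT_fst)
qed

definition list_inst :: "wms_inst \<Rightarrow> inst" where
  "list_inst I = (map (\<lambda>v. (v, Weight I v)) (sorted_list_of_set (Vars I)), sorted_list_of_set (Dom I),
     map (\<lambda>c. (fst c, sorted_list_of_set (snd c))) (Constraints I))"

lemma enc_list_map: "enc_list e (map f xs) = enc_list (\<lambda>x. e (f x)) xs"
  by (simp add: enc_list_def comp_def)

lemma enc_wms_inst_list: "enc_wms_inst I = enc_inst_list (list_inst I)"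
  by (simp add: enc_wms_inst_def enc_inst_list_def list_inst_def enc_list_map case_prod_unfold)

text \<open>\<open>Rs\<close> will hold the sorted lists of the finitely many relations, so that a
  relation in the input is recognised by comparison with constants.\<close>

definition valid_inst :: "nat list \<Rightarrow> nat list list list \<Rightarrow> inst \<Rightarrow> bool" where
  "valid_inst ds Rs J \<longleftrightarrow> sorted_wrt (<) (map fst (fst J)) \<and> fst (snd J) = ds \<and>
     (\<forall>c\<in>set (snd (snd J)). snd c \<in> set Rs \<and> (\<forall>v\<in>set (fst c). v \<in> set (map fst (fst J))) \<and>
        (\<forall>t\<in>set (snd c). length t = length (fst c)))"

lemma PT_strict_sorted: "PT f \<Longrightarrow> PT (\<lambda>x. sorted_wrt (<) (f x))" for f :: "'a::codable \<Rightarrow> nat list"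
proof -
  assume f: "PT f"
  have h: "sorted_wrt (<) xs \<longleftrightarrow> (\<forall>p\<in>set (zip xs (tl xs)). \<not> snd p \<le> fst p)" for xs :: "nat list"
  proof (induction xs)
    case (Cons x xs)
    then show ?case
      by (cases xs) (simp_all add: sorted_wrt1 sorted_wrt2 not_le del: sorted_wrt.simps(2))
  qed simp
  show ?thesis unfolding h by (intro PT_basic PT_le f)
qed

lemma PT_valid_inst: "PT f \<Longrightarrow> PT (\<lambda>x. valid_inst ds Rs (f x))"
  by (rule PT_comp[where g = "valid_inst ds Rs"], assumption, unfold valid_inst_def,
      intro PT_length_eq PT_basic PT_strict_sorted)

lemma finite_relation:
  assumes "constraint_language D \<Gamma>" "R \<in> \<Gamma>"
  shows "finite R"
proof -
  have "\<exists>k. \<forall>t\<in>R. length t = k \<and> set t \<subseteq> D" and D: "finite D"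
    using assms by (simp_all add: constraint_language_def)
  then obtain k where k: "\<forall>t\<in>R. length t = k \<and> set t \<subseteq> D" by (elim exE)
  have "R \<subseteq> {t. set t \<subseteq> D \<and> length t = k}" using k by auto
  then show ?thesis using finite_lists_length_eq[OF D] by (rule finite_subset)
qed

lemma constraint_in_\<Gamma>: "I \<in> wms_instances D \<Gamma> \<Longrightarrow> c \<in> set (Constraints I) \<Longrightarrow>
    snd c \<in> \<Gamma> \<and> set (fst c) \<subseteq> Vars I \<and> (\<forall>t\<in>snd c. length t = length (fst c))"
  by (cases c) (auto simp: wms_instances_def)

context
  fixes D :: "nat set" and \<Gamma> :: "nat list set set" and Rs :: "nat list list list"
  assumes \<Gamma>: "constraint_language D \<Gamma>" and Rs: "set Rs = sorted_list_of_set ` \<Gamma>"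
begin

lemma valid_list_inst: "I \<in> wms_instances D \<Gamma> \<Longrightarrow> valid_inst (sorted_list_of_set D) Rs (list_inst I)"
proof -
  assume I: "I \<in> wms_instances D \<Gamma>"
  then have "finite (Vars I)" "Dom I = D" by (auto simp: wms_instances_def)
  moreover have "sorted_list_of_set (snd c) \<in> set Rs \<and> set (fst c) \<subseteq> Vars I \<and>
      (\<forall>t\<in>set (sorted_list_of_set (snd c)). length t = length (fst c))" if "c \<in> set (Constraints I)" for c
    using constraint_in_\<Gamma>[OF I that] finite_relation[OF \<Gamma>, of "snd c"] Rs by auto
  ultimately show ?thesis by (auto simp: valid_inst_def list_inst_def comp_def)
qed

lemma list_inst_surj:
  assumes J: "valid_inst (sorted_list_of_set D) Rs J"
  shows "\<exists>I\<in>wms_instances D \<Gamma>. list_inst I = J"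
proof -
  let ?V = "set (map fst (fst J))"
  \<comment> \<open>\<open>restrict\<close> makes the weight function extensional, as membership in
    the set of instances demands.\<close>
  define I where "I = \<lparr>Vars = ?V, Dom = D, Constraints = map (\<lambda>c. (fst c, set (snd c))) (snd (snd J)),
    Weight = restrict (\<lambda>v. the (map_of (fst J) v)) ?V\<rparr>"
  have s: "sorted_wrt (<) (map fst (fst J))" using J by (simp add: valid_inst_def)
  have R: "sorted_list_of_set (set (snd c)) = snd c \<and> set (snd c) \<in> \<Gamma>" if c: "c \<in> set (snd (snd J))" for c
  proof -
    have "snd c \<in> set Rs" using J c by (simp add: valid_inst_def)
    then obtain R where "R \<in> \<Gamma>" "snd c = sorted_list_of_set R" using Rs by auto
    then show ?thesis using finite_relation[OF \<Gamma>, of R] by simp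
  qed
  have "I \<in> wms_instances D \<Gamma>"
    using J R by (auto simp: wms_instances_def I_def valid_inst_def)
  moreover have "sorted_list_of_set ?V = map fst (fst J)"
    using s by (intro sorted_list_of_set.idem_if_sorted_distinct) (auto simp: strict_sorted_iff)
  moreover have "map (\<lambda>v. (v, restrict (\<lambda>v. the (map_of (fst J) v)) ?V v)) (map fst (fst J)) = fst J"
    unfolding map_map
  proof (rule map_idI)
    fix p assume p: "p \<in> set (fst J)"
    have "map_of (fst J) (fst p) = Some (snd p)"
      using s p by (intro map_of_is_SomeI) (auto simp: strict_sorted_iff)
    with p show "((\<lambda>v. (v, restrict (\<lambda>v. the (map_of (fst J) v)) ?V v)) \<circ> fst) p = p" by simp
  qed
  ultimately have "list_inst I = J"
    using J R by (cases J) (auto simp: list_inst_def I_def valid_inst_def comp_def intro!: map_idI)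
  with \<open>I \<in> wms_instances D \<Gamma>\<close> show ?thesis by blast
qed

lemma inj_list_inst: "inj_on list_inst (wms_instances D \<Gamma>)"
proof (rule inj_onI)
  fix I I' assume I: "I \<in> wms_instances D \<Gamma>" "I' \<in> wms_instances D \<Gamma>" and eq: "list_inst I = list_inst I'"
  have f: "finite (Vars I)" "finite (Vars I')" and D: "Dom I = D" "Dom I' = D"
    and W: "Weight I \<in> Vars I \<rightarrow>\<^sub>E UNIV" "Weight I' \<in> Vars I' \<rightarrow>\<^sub>E UNIV"
    using I by (auto simp: wms_instances_def)
  have "map fst (fst (list_inst I)) = map fst (fst (list_inst I'))" using eq by simp
  then have s: "sorted_list_of_set (Vars I) = sorted_list_of_set (Vars I')"
    by (simp add: list_inst_def comp_def)
  have V: "Vars I = Vars I'" using arg_cong[OF s, of set] unfolding f[THEN set_sorted_list_of_set] .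
  have "map (\<lambda>v. (v, Weight I v)) (sorted_list_of_set (Vars I)) = map (\<lambda>v. (v, Weight I' v)) (sorted_list_of_set (Vars I))"
    using eq s by (simp add: list_inst_def)
  then have "Weight I v = Weight I' v" if "v \<in> Vars I" for v using that f by simp
  then have W': "Weight I = Weight I'" using W V by (intro PiE_ext[of _ "Vars I" "\<lambda>_. UNIV"]) simp_all
  have C: "map (\<lambda>c. (fst c, set (snd c))) (snd (snd (list_inst I))) = Constraints I"
    if "I \<in> wms_instances D \<Gamma>" for I
    unfolding list_inst_def snd_conv map_map
  proof (rule map_idI)
    fix c assume "c \<in> set (Constraints I)"
    then have "finite (snd c)" using constraint_in_\<Gamma>[OF that] finite_relation[OF \<Gamma>] by blast
    then show "((\<lambda>c. (fst c, set (snd c))) \<circ> (\<lambda>c. (fst c, sorted_list_of_set (snd c)))) c = c" by simp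
  qed
  have "Constraints I = Constraints I'" using C[OF I(1)] C[OF I(2)] unfolding eq by simp
  with V D W' show "I = I'" by (intro wms_inst.equality) simp_all
qed

lemma valid_encodings: "enc_wms_inst ` wms_instances D \<Gamma> =
    {x. valid_inst (sorted_list_of_set D) Rs (dec_inst x) \<and> enc_inst_list (dec_inst x) = x}"
proof (intro equalityI subsetI)
  fix x assume "x \<in> enc_wms_inst ` wms_instances D \<Gamma>"
  then show "x \<in> {x. valid_inst (sorted_list_of_set D) Rs (dec_inst x) \<and> enc_inst_list (dec_inst x) = x}"
    by (auto simp: enc_wms_inst_list dec_enc_inst valid_list_inst)
next
  fix x assume x: "x \<in> {x. valid_inst (sorted_list_of_set D) Rs (dec_inst x) \<and> enc_inst_list (dec_inst x) = x}"
  then obtain I where "I \<in> wms_instances D \<Gamma>" "list_inst I = dec_inst x" using list_inst_surj by blast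
  with x show "x \<in> enc_wms_inst ` wms_instances D \<Gamma>" by (auto simp: enc_wms_inst_list intro!: image_eqI[of _ _ I])
qed

end

lemma wms_solutions_finite: "finite (Vars I) \<Longrightarrow> finite (Dom I) \<Longrightarrow> finite (wms_solutions I)"
  unfolding wms_solutions_def by (rule finite_subset[of _ "Vars I \<rightarrow>\<^sub>E Dom I"]) (auto intro: finite_PiE)

definition vars_of :: "inst \<Rightarrow> nat list" where
  "vars_of J = map fst (fst J)"

lemma vars_of_list_inst: "vars_of (list_inst I) = sorted_list_of_set (Vars I)"
  by (simp add: vars_of_def list_inst_def comp_def)

definition obj_of :: "inst \<Rightarrow> nat list \<Rightarrow> nat" where
  "obj_of J w = sum_list (map (\<lambda>p. snd p * look (vars_of J) w (fst p)) (fst J))"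

lemma PT_obj_of: "PT f \<Longrightarrow> PT g \<Longrightarrow> PT (\<lambda>x. obj_of (f x) (g x))"
  by (rule PT_app2[where F = obj_of])
     (unfold obj_of_def vars_of_def, intro PT_basic PT_sum_list PT_mult PT_look)

definition sol_test :: "nat list \<Rightarrow> inst \<Rightarrow> nat list \<Rightarrow> bool" where
  "sol_test ds J w \<longleftrightarrow> length w = length (vars_of J) \<and> (\<forall>d\<in>set w. d \<in> set ds) \<and>
     (\<forall>c\<in>set (snd (snd J)). proj (vars_of J) (fst c) w \<in> set (snd c))"

lemma PT_sol_test: "PT f \<Longrightarrow> PT g \<Longrightarrow> PT (\<lambda>x. sol_test ds (f x) (g x))"
  by (rule PT_app2[where F = "sol_test ds"])
     (unfold sol_test_def vars_of_def, intro PT_length_eq PT_basic PT_proj)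

section \<open>From instances to the group algorithm\<close>

context group_alg begin

lemma group_vec: "distinct vs \<Longrightarrow> group_vec G vs"
  by (intro group_vec.intro group_alg_axioms group_vec_axioms.intro)

text \<open>For members p a, q a and r a of a coset, the factors \<open>a\<close> cancel in (p a)
  inv (q a) (r a), which leaves (p (inv q) r) a. The rest of the proof passes between lists and
  functions on \<open>{..<k}\<close>.\<close>

lemma coset_maltsev:
  assumes R: "coset_relation G k R" and "finite R"
  shows "maltsev (sorted_list_of_set R)"
proof -
  define P where "P = group_power G k"
  have len: "length t = k" if "t \<in> R" for t using R that by (auto simp: coset_relation_def)
  obtain H where H: "subgroup H P" "tuple_fun ` R \<in> rcosets\<^bsub>P\<^esub> H"
    using R by (auto simp: coset_relation_def P_def)
  interpret P: group P unfolding P_def by (rule product_group) (rule is_group)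
  obtain a where a: "a \<in> carrier P" and RH: "tuple_fun ` R = (\<Union>h\<in>H. {h \<otimes>\<^bsub>P\<^esub> a})"
    using H(2) by (auto simp: RCOSETS_def r_coset_def)
  have HP: "h \<in> carrier P" if "h \<in> H" for h using subgroup.mem_carrier[OF H(1) that] .
  have RE: "\<exists>h\<in>H. tuple_fun t = h \<otimes>\<^bsub>P\<^esub> a" if "t \<in> R" for t
    using imageI[OF that, of tuple_fun] unfolding RH by simp
  have RI: "h \<otimes>\<^bsub>P\<^esub> a \<in> tuple_fun ` R" if "h \<in> H" for h
    unfolding RH using that by blast
  have "map (\<lambda>(a, b, c). a \<otimes> inv b \<otimes> c) (zip x (zip y z)) \<in> R" if xyz: "x \<in> R" "y \<in> R" "z \<in> R" for x y z
  proof -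
    let ?u = "map (\<lambda>(a, b, c). a \<otimes> inv b \<otimes> c) (zip x (zip y z))"
    obtain p q r where pqr: "p \<in> H" "q \<in> H" "r \<in> H" "tuple_fun x = p \<otimes>\<^bsub>P\<^esub> a"
      "tuple_fun y = q \<otimes>\<^bsub>P\<^esub> a" "tuple_fun z = r \<otimes>\<^bsub>P\<^esub> a"
      using xyz[THEN RE] by (elim bexE)
    have fP: "tuple_fun x \<in> carrier P" "tuple_fun y \<in> carrier P" "tuple_fun z \<in> carrier P"
      unfolding pqr using pqr(1-3)[THEN HP] a by simp_all
    have inv_y: "inv\<^bsub>P\<^esub> (tuple_fun y) = (\<lambda>i\<in>{..<k}. inv (tuple_fun y i))"
      using fP(2) unfolding P_def by (intro inv_product_group) (auto simp: is_group)
    have "tuple_fun ?u = tuple_fun x \<otimes>\<^bsub>P\<^esub> inv\<^bsub>P\<^esub> (tuple_fun y) \<otimes>\<^bsub>P\<^esub> tuple_fun z"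
      unfolding inv_y using xyz[THEN len] by (auto simp: P_def tuple_fun_def fun_eq_iff)
    also have "\<dots> = p \<otimes>\<^bsub>P\<^esub> inv\<^bsub>P\<^esub> q \<otimes>\<^bsub>P\<^esub> r \<otimes>\<^bsub>P\<^esub> a"
    proof -
      have "a \<otimes>\<^bsub>P\<^esub> (inv\<^bsub>P\<^esub> a \<otimes>\<^bsub>P\<^esub> w) = w" if "w \<in> carrier P" for w
        using a that by (simp flip: P.m_assoc)
      then show ?thesis
        unfolding pqr(4-6) using pqr(1-3)[THEN HP] a by (simp add: P.inv_mult_group P.m_assoc)
    qed
    also have "\<dots> \<in> tuple_fun ` R"
      using pqr(1-3) by (intro RI subgroup.m_closed[OF H(1)] subgroup.m_inv_closed[OF H(1)])
    finally obtain u where u: "u \<in> R" "tuple_fun ?u = tuple_fun u" by blast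
    have l: "length ?u = k" "length u = k" using xyz u by (simp_all add: len)
    have "?u = u"
    proof (rule nth_equalityI)
      fix i assume i: "i < length ?u"
      then have "tuple_fun ?u i = ?u ! i" "tuple_fun u i = u ! i"
        using l by (simp_all only: tuple_fun_def restrict_apply lessThan_iff if_True)
      then show "?u ! i = u ! i" using u(2) by simp
    qed (use l in simp)
    then show ?thesis using u by simp
  qed
  then show ?thesis using \<open>finite R\<close> by (simp add: maltsev_def)
qed

context
  fixes \<Gamma> :: "nat list set set" and I :: wms_inst
  assumes \<Gamma>: "constraint_language (carrier G) \<Gamma>" and I: "I \<in> wms_instances (carrier G) \<Gamma>"
begin

lemma instance_facts: "finite (Vars I)" "Dom I = carrier G"
  "c \<in> set (Constraints I) \<Longrightarrow> finite (snd c) \<and> set (fst c) \<subseteq> Vars I"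
proof -
  show "c \<in> set (Constraints I) \<Longrightarrow> finite (snd c) \<and> set (fst c) \<subseteq> Vars I"
    using constraint_in_\<Gamma>[OF I] finite_relation[OF \<Gamma>] by blast
qed (use I in \<open>auto simp: wms_instances_def\<close>)

lemma group_vec_I: "group_vec G (sorted_list_of_set (Vars I))"
  by (rule group_vec) simp

lemma solution_vector:
  assumes f: "f \<in> wms_solutions I"
  defines "w \<equiv> map f (sorted_list_of_set (Vars I))"
  shows "sol_test ds (list_inst I) w" and "obj_of (list_inst I) w = wms_measure I f"
proof -
  interpret V: group_vec G A "sorted_list_of_set (Vars I)" by (rule group_vec_I)
  let ?vs = "sorted_list_of_set (Vars I)"
  have vs: "set ?vs = Vars I" using instance_facts by simp
  have f_in: "f v \<in> set ds" if "v \<in> Vars I" for v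
    using f that fin instance_facts(2) by (auto simp: wms_solutions_def ds_def)
  have lk: "look ?vs w v = f v" if "v \<in> Vars I" for v
    unfolding w_def using that vs by (intro V.look_map) simp
  have "proj ?vs (fst c) w \<in> set (sorted_list_of_set (snd c))" if c: "c \<in> set (Constraints I)" for c
  proof -
    have "map f (fst c) \<in> snd c" using f c by (auto simp: wms_solutions_def)
    moreover have "proj ?vs (fst c) w = map f (fst c)"
      unfolding proj_def using instance_facts(3)[OF c] lk by (intro map_cong) auto
    ultimately show ?thesis using instance_facts(3)[OF c] by simp
  qed
  then show "sol_test ds (list_inst I) w"
    unfolding sol_test_def vars_of_list_inst using f_in vs by (auto simp: w_def list_inst_def)
  have "obj_of (list_inst I) w = sum_list (map (\<lambda>v. Weight I v * look ?vs w v) ?vs)"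
    unfolding obj_of_def vars_of_list_inst by (simp add: list_inst_def comp_def)
  also have "\<dots> = sum_list (map (\<lambda>v. Weight I v * f v) ?vs)"
    by (rule arg_cong[where f = sum_list], rule map_cong) (use lk vs in auto)
  also have "\<dots> = wms_measure I f"
    using vs by (simp add: wms_measure_def sum_list_distinct_conv_sum_set)
  finally show "obj_of (list_inst I) w = wms_measure I f" .
qed

lemma vector_solution:
  assumes w: "sol_test ds (list_inst I) w"
  obtains f where "f \<in> wms_solutions I" "w = map f (sorted_list_of_set (Vars I))"
proof -
  interpret V: group_vec G A "sorted_list_of_set (Vars I)" by (rule group_vec_I)
  let ?vs = "sorted_list_of_set (Vars I)"
  have vs: "set ?vs = Vars I" using instance_facts by simp
  define f where "f = restrict (look ?vs w) (Vars I)"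
  have wX: "w \<in> V.X"
    using w fin by (auto simp: sol_test_def vars_of_list_inst V.X_def ds_def)
  have "f \<in> Vars I \<rightarrow>\<^sub>E Dom I" using V.look_closed[OF wX] vs instance_facts by (auto simp: f_def)
  moreover have "map f (fst c) \<in> snd c" if c: "c \<in> set (Constraints I)" for c
  proof -
    have "proj ?vs (fst c) w \<in> set (sorted_list_of_set (snd c))"
      using w c unfolding sol_test_def vars_of_list_inst by (auto simp: list_inst_def)
    moreover have "proj ?vs (fst c) w = map f (fst c)"
      unfolding proj_def f_def using instance_facts(3)[OF c] by (intro map_cong) auto
    ultimately show ?thesis using instance_facts(3)[OF c] by simp
  qed
  ultimately have "f \<in> wms_solutions I" by (auto simp: wms_solutions_def)
  moreover have "map f ?vs = w"
  proof (rule nth_equalityI)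
    fix i assume "i < length (map f ?vs)"
    then have i: "i < length ?vs" by simp
    then have "?vs ! i \<in> Vars I" using vs nth_mem by blast
    then show "map f ?vs ! i = w ! i" using i V.look_nth[OF _ i, of w] wX by (simp add: f_def V.X_def)
  qed (use wX in \<open>simp add: V.X_def\<close>)
  ultimately show thesis using that by blast
qed

lemma algorithm_approximates:
  assumes coset: "\<forall>R\<in>\<Gamma>. \<exists>k. coset_relation G k R" and arity: "\<forall>R\<in>\<Gamma>. \<forall>t\<in>R. length t \<le> A"
    and f: "f \<in> wms_solutions I"
  defines "J \<equiv> list_inst I"
  defines "r \<equiv> select (fst J) (solve (vars_of J) (snd (snd J)))"
  shows "sol_test ds J r" and "wms_measure I f \<le> card (carrier G) * obj_of J r"
proof -
  interpret V: group_vec G A "sorted_list_of_set (Vars I)" by (rule group_vec_I)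
  have vs: "vars_of J = sorted_list_of_set (Vars I)" by (simp add: J_def vars_of_list_inst)
  have test: "sol_test ds J w \<longleftrightarrow> w \<in> V.sols_of (snd (snd J))" for w
    using fin by (auto simp: sol_test_def V.sols_of_def V.X_def ds_def vs)
  have obj: "obj_of J w = V.obj (fst J) w" for w
    by (simp add: obj_of_def V.obj_def vs)
  have vw: "map fst (fst J) = sorted_list_of_set (Vars I)" using vs by (simp add: vars_of_def)
  have cs: "set (fst c) \<subseteq> set (sorted_list_of_set (Vars I)) \<and> length (fst c) \<le> Suc A \<and> maltsev (snd c)"
    if "c \<in> set (snd (snd J))" for c
  proof -
    obtain d where d: "d \<in> set (Constraints I)" "c = (fst d, sorted_list_of_set (snd d))"
      using \<open>c \<in> set (snd (snd J))\<close> by (auto simp: J_def list_inst_def)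
    \<comment> \<open>An empty relation fits scopes of any length. The solution \<open>f\<close>
      provides a tuple of the relation, which ties the length of the scope to
      \<open>A\<close>.\<close>
    have "map f (fst d) \<in> snd d" using f d(1) by (auto simp: wms_solutions_def)
    moreover have dR: "snd d \<in> \<Gamma>" using constraint_in_\<Gamma>[OF I d(1)] by blast
    ultimately have "length (fst d) \<le> A" using arity by fastforce
    moreover have "maltsev (sorted_list_of_set (snd d))"
      using bspec[OF coset dR] coset_maltsev instance_facts(3)[OF d(1)] by blast
    ultimately show ?thesis using instance_facts(1) instance_facts(3)[OF d(1)] d(2) by simp
  qed
  have w: "map f (sorted_list_of_set (Vars I)) \<in> V.sols_of (snd (snd J))"
    using solution_vector(1)[OF f] test by (simp add: J_def)
  show "sol_test ds J r"
    unfolding test r_def vs by (rule V.algorithm_correct(1)[OF vw cs w])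
  have "V.obj (fst J) (map f (sorted_list_of_set (Vars I))) \<le> card (carrier G) * V.obj (fst J) r"
    unfolding r_def vs by (rule V.algorithm_correct(2)[OF vw cs w])
  then have "obj_of J (map f (sorted_list_of_set (Vars I))) \<le> card (carrier G) * obj_of J r"
    by (simp only: obj)
  then show "wms_measure I f \<le> card (carrier G) * obj_of J r"
    using solution_vector(2)[OF f] by (simp add: J_def)
qed

end

end

section \<open>Membership in NPO and APX\<close>

lemma polytime_on_subset:
  "polytime_on T f \<Longrightarrow> S \<subseteq> T \<Longrightarrow> (\<And>xs. xs \<in> S \<Longrightarrow> f xs = g xs) \<Longrightarrow> polytime_on S g"
  unfolding polytime_on_def by (metis subsetD)

lemma W_Max_Sol_simps [simp]:
  "instances (W_Max_Sol D \<Gamma>) = wms_instances D \<Gamma>" "sols (W_Max_Sol D \<Gamma>) = wms_solutions"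
  "objective (W_Max_Sol D \<Gamma>) = wms_measure" "enc_inst (W_Max_Sol D \<Gamma>) = enc_wms_inst"
  "enc_sol (W_Max_Sol D \<Gamma>) = enc_wms_sol"
  by (simp_all add: W_Max_Sol_def)

lemma (in group_alg) W_Max_Sol_in_NPO:
  assumes \<Gamma>: "constraint_language (carrier G) \<Gamma>"
  shows "in_NPO (W_Max_Sol (carrier G) \<Gamma>)"
proof -
  let ?Inst = "wms_instances (carrier G) \<Gamma>"
  obtain Rs where Rs: "set Rs = sorted_list_of_set ` \<Gamma>"
    using \<Gamma> finite_list[of "sorted_list_of_set ` \<Gamma>"] by (auto simp: constraint_language_def)
  define inst_ok where "inst_ok x \<longleftrightarrow> valid_inst ds Rs (dec_inst x) \<and> enc_inst_list (dec_inst x) = x" for x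
  define sol_ok where "sol_ok x y \<longleftrightarrow> inst_ok x \<and> sol_test ds (dec_inst x) (dec_sol y) \<and>
    enc_list enc_nat (dec_sol y) = y" for x y
  have inst_ok: "inst_ok x \<longleftrightarrow> (\<exists>I\<in>?Inst. x = enc_wms_inst I)" for x
    using valid_encodings[OF \<Gamma> Rs] by (auto simp: inst_ok_def ds_def set_eq_iff)
  have enc_sol: "enc_wms_sol I f = enc_list enc_nat (map f (sorted_list_of_set (Vars I)))" for I f
    by (simp add: enc_wms_sol_def)
  have sol_ok: "sol_ok x y \<longleftrightarrow> (\<exists>I f. I \<in> ?Inst \<and> f \<in> wms_solutions I \<and> x = enc_wms_inst I \<and> y = enc_wms_sol I f)"
    for x y
  proof
    assume ok: "sol_ok x y"
    then obtain I where I: "I \<in> ?Inst" "x = enc_wms_inst I" by (auto simp: sol_ok_def inst_ok)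
    have "sol_test ds (list_inst I) (dec_sol y)"
      using ok I(2) by (simp add: sol_ok_def enc_wms_inst_list dec_enc_inst)
    from vector_solution[OF \<Gamma> I(1) this] obtain f where
      "f \<in> wms_solutions I" "dec_sol y = map f (sorted_list_of_set (Vars I))" .
    moreover have "enc_list enc_nat (dec_sol y) = y" using ok by (simp add: sol_ok_def)
    ultimately show "\<exists>I f. I \<in> ?Inst \<and> f \<in> wms_solutions I \<and> x = enc_wms_inst I \<and> y = enc_wms_sol I f"
      using I unfolding enc_sol by metis
  next
    assume "\<exists>I f. I \<in> ?Inst \<and> f \<in> wms_solutions I \<and> x = enc_wms_inst I \<and> y = enc_wms_sol I f"
    then obtain I f where If: "I \<in> ?Inst" "f \<in> wms_solutions I" "x = enc_wms_inst I" "y = enc_wms_sol I f"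
      by blast
    have "inst_ok x" using If inst_ok by blast
    moreover have "sol_test ds (dec_inst x) (dec_sol y)"
      using solution_vector(1)[OF \<Gamma> If(1,2)] by (simp add: If(3,4) enc_sol enc_wms_inst_list dec_enc_inst dec_enc_sol)
    ultimately show "sol_ok x y" by (simp add: sol_ok_def If(4) enc_sol dec_enc_sol)
  qed
  have PT_inst_ok: "PT (\<lambda>x. inst_ok (f x))" if "PT f" for f :: "bool list \<times> bool list \<Rightarrow> bool list"
    unfolding inst_ok_def by (intro PT_conj PT_eq PT_valid_inst PT_enc_inst_list PT_dec_inst that)
  have PT_inst_ok1: "PT inst_ok"
    unfolding inst_ok_def[abs_def] by (intro PT_conj PT_eq PT_valid_inst PT_enc_inst_list PT_dec_inst PT_id)
  show ?thesis
    unfolding in_NPO_def W_Max_Sol_simps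
  proof (intro conjI)
    show "inj_on enc_wms_inst ?Inst"
      using inj_list_inst[OF \<Gamma> Rs] unfolding inj_on_def enc_wms_inst_list by (metis dec_enc_inst)
    show "\<forall>I\<in>?Inst. inj_on (enc_wms_sol I) (wms_solutions I)"
    proof (intro ballI inj_onI)
      fix I f g assume I: "I \<in> ?Inst" and f: "f \<in> wms_solutions I" "g \<in> wms_solutions I"
        and eq: "enc_wms_sol I f = enc_wms_sol I g"
      have "map f (sorted_list_of_set (Vars I)) = map g (sorted_list_of_set (Vars I))"
        using eq unfolding enc_sol by (metis dec_enc_sol)
      then have "f v = g v" if "v \<in> Vars I" for v
        using that instance_facts(1)[OF \<Gamma> I] by simp
      moreover have "f \<in> Vars I \<rightarrow>\<^sub>E Dom I" "g \<in> Vars I \<rightarrow>\<^sub>E Dom I" using f by (auto simp: wms_solutions_def)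
      ultimately show "f = g" by (meson PiE_ext)
    qed
    show "polytime_decidable 1 {[enc_wms_inst I] |I. I \<in> ?Inst}"
      unfolding polytime_decidable_def
    proof (rule polytime_on_subset[OF polytime_on_PT1[OF PT_Cons[OF PT_inst_ok1 PT_const[of "[]"]]] order_refl])
      fix xs :: "bool list list" assume "xs \<in> {xs. length xs = 1}"
      then obtain x where "xs = [x]" by (auto simp: length_Suc_conv)
      then show "[inst_ok (xs ! 0)] = [xs \<in> {[enc_wms_inst I] |I. I \<in> ?Inst}]" using inst_ok by auto
    qed
    show "\<exists>q :: nat poly. \<forall>I\<in>?Inst. \<forall>f\<in>wms_solutions I.
        length (enc_wms_sol I f) \<le> poly q (length (enc_wms_inst I))"
    proof -
      \<comment> \<open>Values come from the fixed finite carrier, so their codes have bounded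
        length and a solution is linear in the number of variables.\<close>
      obtain C where C: "\<And>d. d \<in> carrier G \<Longrightarrow> length (enc_nat d) \<le> C"
        using fin finite_imageI[of "carrier G" "\<lambda>d. length (enc_nat d)"] unfolding finite_nat_set_iff_bounded_le by auto
      have len: "length (enc_list e xs) \<le> 1 + length xs * (C + 1)" if "\<And>x. x \<in> set xs \<Longrightarrow> length (e x) \<le> C"
        for e :: "nat \<Rightarrow> bool list" and xs
        using that
      proof (induction xs)
        case (Cons x xs)
        then have "length (e x) \<le> C" "length (enc_list e xs) \<le> 1 + length xs * (C + 1)" by simp_all
        then show ?case by (simp add: enc_list_def)
      qed (simp add: enc_list_def)
      have len': "length xs \<le> length (enc_list e xs)" for e :: "nat \<Rightarrow> bool list" and xs
        by (induction xs) (auto simp: enc_list_def)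
      have "length (enc_wms_sol I f) \<le> poly [:1, C + 1:] (length (enc_wms_inst I))"
        if I: "I \<in> ?Inst" and f: "f \<in> wms_solutions I" for I f
      proof -
        let ?vs = "sorted_list_of_set (Vars I)"
        have "length (enc_wms_sol I f) \<le> 1 + length (map f ?vs) * (C + 1)"
          unfolding enc_sol using f instance_facts(1,2)[OF \<Gamma> I]
          by (intro len C) (auto simp: wms_solutions_def)
        also have "length ?vs \<le> length (enc_wms_inst I)"
          using len'[of ?vs] unfolding enc_wms_inst_def by (simp add: trans_le_add1)
        then have "1 + length (map f ?vs) * (C + 1) \<le> poly [:1, C + 1:] (length (enc_wms_inst I))"
          by (simp add: add_mono mult_right_mono)
        finally show ?thesis .
      qed
      then show ?thesis by blast
    qed
    have "PT (\<lambda>p. [sol_ok (fst p) (snd p)])"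
      unfolding sol_ok_def
      by (intro PT_Cons PT_const PT_conj PT_inst_ok PT_sol_test PT_eq PT_enc_list PT_enc_nat PT_dec_inst PT_dec_sol
          PT_fst PT_snd PT_id)
    from polytime_on_PT2[OF this]
    show "polytime_decidable 2 {[enc_wms_inst I, enc_wms_sol I f] |I f. I \<in> ?Inst \<and> f \<in> wms_solutions I}"
      unfolding polytime_decidable_def
    proof (rule polytime_on_subset[OF _ order_refl])
      fix xs :: "bool list list" assume "xs \<in> {xs. length xs = 2}"
      then obtain x y where "xs = [x, y]" by (auto simp: length_Suc_conv numeral_2_eq_2)
      then show "[sol_ok (fst (xs ! 0, xs ! 1)) (snd (xs ! 0, xs ! 1))] =
          [xs \<in> {[enc_wms_inst I, enc_wms_sol I f] |I f. I \<in> ?Inst \<and> f \<in> wms_solutions I}]"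
        using sol_ok by auto
    qed
    let ?g = "\<lambda>p. nat_bits (obj_of (dec_inst (fst p)) (dec_sol (snd p)))"
    have "PT ?g" by (intro PT_nat_bits PT_obj_of PT_dec_inst PT_dec_sol PT_fst PT_snd PT_id)
    from polytime_on_PT2[OF this]
    have "polytime_on {[enc_wms_inst I, enc_wms_sol I f] |I f. I \<in> ?Inst \<and> f \<in> wms_solutions I}
        (\<lambda>xs. ?g (xs ! 0, xs ! 1))"
      by (rule polytime_on_subset) auto
    moreover have "?g (enc_wms_inst I, enc_wms_sol I f) = nat_bits (wms_measure I f)"
      if "I \<in> ?Inst" "f \<in> wms_solutions I" for I f
      using solution_vector(2)[OF \<Gamma> that] by (simp add: enc_sol enc_wms_inst_list dec_enc_inst dec_enc_sol)
    ultimately show "\<exists>g. polytime_on {[enc_wms_inst I, enc_wms_sol I f] |I f. I \<in> ?Inst \<and> f \<in> wms_solutions I} g \<and>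
        (\<forall>I\<in>?Inst. \<forall>f\<in>wms_solutions I. g [enc_wms_inst I, enc_wms_sol I f] = nat_bits (wms_measure I f))"
      by (intro exI[of _ "\<lambda>xs. ?g (xs ! 0, xs ! 1)"]) simp
  qed
qed

theorem theorem6p12:
  fixes G :: "nat monoid" and D :: "nat set" and \<Gamma> :: "nat list set set"
  assumes "group G" and "carrier G = D" and "finite D"
    and "constraint_language D \<Gamma>"
    and "\<And>R. R \<in> \<Gamma> \<Longrightarrow> \<exists>k. coset_relation G k R"
  shows "in_APX (W_Max_Sol D \<Gamma>)"
proof -
  have "finite (\<Union>R\<in>\<Gamma>. length ` R)"
    using assms(4) finite_relation[OF assms(4)] by (auto simp: constraint_language_def)
  then obtain A where A: "\<forall>R\<in>\<Gamma>. \<forall>t\<in>R. length t \<le> A"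
    unfolding finite_nat_set_iff_bounded_le by blast
  have D: "D = carrier G" using assms(2) by simp
  have coset: "\<forall>R\<in>\<Gamma>. \<exists>k. coset_relation G k R" using assms(5) by blast
  interpret group_alg G A
    using assms(1,3) by (simp add: group_alg_def group_alg_axioms_def D)
  have \<Gamma>: "constraint_language (carrier G) \<Gamma>" using assms(4) D by simp
  define alg where "alg x = (let J = dec_inst x in
    enc_list enc_nat (select (fst J) (solve (map fst (fst J)) (snd (snd J)))))" for x
  have "PT alg"
    unfolding alg_def[abs_def] Let_def
    by (intro PT_enc_list PT_enc_nat PT_select PT_solve PT_map PT_dec_inst PT_fst PT_snd PT_id)
  from polytime_on_PT1[OF this]
  have poly: "polytime_on {[enc_wms_inst I] |I. I \<in> wms_instances (carrier G) \<Gamma>} (\<lambda>xs. alg (xs ! 0))"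
    by (rule polytime_on_subset) auto
  have approx: "\<exists>f. approx_sol (W_Max_Sol (carrier G) \<Gamma>) (card (carrier G)) I f \<and> alg (enc_wms_inst I) = enc_wms_sol I f"
    if I: "I \<in> wms_instances (carrier G) \<Gamma>" and ne: "wms_solutions I \<noteq> {}" for I
  proof -
    let ?J = "list_inst I"
    define r where "r = select (fst ?J) (solve (vars_of ?J) (snd (snd ?J)))"
    note best = algorithm_approximates[OF \<Gamma> I coset A, folded r_def]
    obtain h where "h \<in> wms_solutions I" using ne by blast
    from best(1)[OF this] obtain f where f: "f \<in> wms_solutions I" "r = map f (sorted_list_of_set (Vars I))"
      using vector_solution[OF \<Gamma> I] by blast
    \<comment> \<open>Finiteness makes the optimum an attained value, so the bound for a single
      solution applies to it.\<close>
    have "finite (wms_solutions I)"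
      using instance_facts(1,2)[OF \<Gamma> I] fin by (intro wms_solutions_finite) simp_all
    then have "opt (W_Max_Sol (carrier G) \<Gamma>) I \<in> wms_measure I ` wms_solutions I"
      unfolding opt_def using ne by (simp add: Max_in)
    then obtain g where g: "g \<in> wms_solutions I" "opt (W_Max_Sol (carrier G) \<Gamma>) I = wms_measure I g"
      by blast
    have "wms_measure I g \<le> card (carrier G) * wms_measure I f"
      using best(2)[OF g(1)] solution_vector(2)[OF \<Gamma> I f(1)] f(2) by simp
    then have "approx_sol (W_Max_Sol (carrier G) \<Gamma>) (card (carrier G)) I f"
      unfolding approx_sol_def using f g by (simp flip: of_nat_mult)
    moreover have "alg (enc_wms_inst I) = enc_wms_sol I f"
      using f(2) by (simp add: alg_def Let_def enc_wms_inst_list dec_enc_inst enc_wms_sol_def r_def vars_of_def)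
    ultimately show ?thesis by blast
  qed
  have "1 \<le> real (card (carrier G))"
    using fin by (simp add: Suc_le_eq card_gt_0_iff) blast
  with poly approx W_Max_Sol_in_NPO[OF \<Gamma>] show ?thesis
    unfolding in_APX_def D W_Max_Sol_simps
    by (intro conjI exI[of _ "real (card (carrier G))"] exI[of _ "\<lambda>xs. alg (xs ! 0)"]) auto
qed

end
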